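(* Let $E\to M$ be an $\mathsf S$-equivariant Courant algebroid such that the action of $\mathsf S$ on $M$ is free and proper, let $V_+\subset E$ be an admissible generalized pseudometric, $\operatorname{div}$ an equivariant divergence on $E$, and let $\tilde V_+\subset E_{/\mathsf S}$ and $\widetilde{\operatorname{div}}$ be the induced generalized pseudometric and divergence on the reduced Courant algebroid $E_{/\mathsf S}\to M/\mathsf S$. If $a_+\in\Gamma(V_+)^{\mathfrak s}$ and $b_-\in\Gamma(V_-\cap\mathfrak s_E^\perp)^{\mathfrak s}$, and if $\tilde a_+$, $\tilde b_-$ are the corresponding sections of $\tilde V_+$ and $\tilde V_-$, then $$\mathrm{GRic}^E_{V_+,\operatorname{div}}(a_+,b_-)=\pi^*\,\mathrm{GRic}^{E_{/\mathsf S}}_{\tilde V_+,\widetilde{\operatorname{div}}}(\tilde a_+,\tilde b_-),$$ where $\pi:M\to M/\mathsf S$ is the projection.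
   Context: A Courant algebroid (CA) is a vector bundle $E\to M$ with a non-degenerate symmetric fibrewise bilinear form $\langle\,,\,\rangle$, a bundle map $\rho:E\to TM$ (the anchor) and an $\mathbb R$-bilinear bracket $[\,,\,]:\Gamma(E)\times\Gamma(E)\to\Gamma(E)$ such that for $u,v,w\in\Gamma(E)$, $f\in C^\infty(M)$: $[u,[v,w]]=[[u,v],w]+[v,[u,w]]$; $[u,fv]=f[u,v]+(u\cdot f)v$; $u\cdot\langle v,w\rangle=\langle[u,v],w\rangle+\langle v,[u,w]\rangle$; $[u,v]+[v,u]=d_E\langle u,v\rangle$. Here $u\cdot f:=\rho(u)f$ and $d_Ef\in\Gamma(E)$ is defined by $\langle u,d_Ef\rangle=u\cdot f$. A generalized pseudometric is a subbundle $V_+\subset E$ on which $\langle\,,\,\rangle$ is non-degenerate; $V_-:=V_+^\perp$; subscripts $\pm$ denote orthogonal projections to $V_\pm$. A divergence on $E$ is an $\mathbb R$-linear map $\operatorname{div}:\Gamma(E)\to C^\infty(M)$ with $\operatorname{div}(fa)=f\operatorname{div}a+a\cdot f$. The generalized Ricci tensor is the $C^\infty(M)$-bilinear map, for $a_+\in\Gamma(V_+)$, $b_-\in\Gamma(V_-)$, $$\mathrm{GRic}^E_{V_+,\operatorname{div}}(a_+,b_-):=\operatorname{div}[b_-,a_+]_+-b_-\cdot\operatorname{div}a_+-\operatorname{Tr}_{V_+}[[\,\cdot\,,b_-]_-,a_+]_+ .$$ Equivariance: let $\mathfrak s$ be a Lie algebra and $\mathsf S$ a connected Lie group integrating it. An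 $\mathfrak s$-equivariant CA is a CA $E\to M$ with a linear map $\chi:\mathfrak s\to\Gamma(E)$, injective at every point of $M$, with $[\chi(u),\chi(v)]=\chi([u,v])$ and $\langle\chi(u),\chi(v)\rangle=0$. Then $\mathfrak s$ acts on $E$ by the derivations $[\chi(u),\cdot]$ and on $M$ by the vector fields $\rho(\chi(u))$; if this integrates to an action of $\mathsf S$, $E$ is called $\mathsf S$-equivariant. Let $\mathfrak s_E\subset E$ be the subbundle with fibres $\chi(\mathfrak s)$, $\mathfrak s_E^\perp$ its orthogonal; superscript $\mathfrak s$ denotes $\mathfrak s$-invariant functions/sections (for sections $x$: $[\chi(s),x]=0$ for all $s\in\mathfrak s$). Reduction: if the $\mathsf S$-action on $M$ is free and proper, $E_{/\mathsf S}\to M/\mathsf S$ is the quotient by $\mathsf S$ of $\mathfrak s_E^\perp/\mathfrak s_E$, with the CA structure induced via $C^\infty(M/\mathsf S)\cong C^\infty(M)^{\mathfrak s}$, $\Gamma(E_{/\mathsf S})\cong\Gamma(\mathfrak s_E^\perp)^{\mathfrak s}/\Gamma(\mathfrak s_E)^{\mathfrak s}$. A divergence on $E$ is equivariant if $\chi(s)\cdot\operatorname{div}x=\operatorname{div}[\chi(s),x]$ and $\operatorname{div}\chi(s)=-\operatorname{Tr}_{\mathfrak s}\mathrm{ad}_s$ for all $s\in\mathfrak s$, $x\in\Gamma(E)$; it then descends to a divergence $\widetilde{\operatorname{div}}$ on $E_{/\mathsf S}$. A generalized pseudometric $V_+\subset E$ is admissible if it is $\mathfrak s$-invariant and $V_+\subset\mathfrak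 s_E^\perp$; it then descends to a generalized pseudometric $\tilde V_+\subset E_{/\mathsf S}$ with $\Gamma(\tilde V_+)\cong\Gamma(V_+)^{\mathfrak s}$ and $\Gamma(\tilde V_-)\cong\Gamma(V_-\cap\mathfrak s_E^\perp)^{\mathfrak s}/\Gamma(\mathfrak s_E)^{\mathfrak s}$, where $\tilde V_-=\tilde V_+^\perp$. *)

theory Defs
  imports "HOL-Analysis.Analysis" "HOL-Algebra.Group_Action"
begin

section \<open>Smooth manifolds\<close>

fun Ck_on :: "nat \<Rightarrow> 'a::real_normed_vector set \<Rightarrow> ('a \<Rightarrow> 'b::real_normed_vector) \<Rightarrow> bool" where
  "Ck_on 0 S f = continuous_on S f"
| "Ck_on (Suc k) S f = ((\<forall>x\<in>S. f differentiable (at x)) \<and>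
      (\<forall>v. Ck_on k S (\<lambda>x. frechet_derivative f (at x) v)))"

text \<open>Smoothness on an arbitrary subset of a Euclidean space means that smooth extensions to
  open sets exist locally; on open sets this is the usual notion.\<close>

definition smooth_on :: "'a::euclidean_space set \<Rightarrow> ('a \<Rightarrow> 'b::real_normed_vector) \<Rightarrow> bool" where
  "smooth_on S f \<longleftrightarrow> (\<forall>x\<in>S. \<exists>N F. open N \<and> x \<in> N \<and> (\<forall>k. Ck_on k N F) \<and> (\<forall>y\<in>S \<inter> N. f y = F y))"

text \<open>The underlying space of a manifold is a whole type, Hausdorff and second countable by its
  type classes. The charts take values in open subsets of a linear subspace \<open>W\<close> of a
  Euclidean type, not of the type itself: Euclidean types have positive dimension,
  while a Lie group or an orbit space may be a single point.\<close>

type_synonym ('m, 'a) atlas = "('m set \<times> ('m \<Rightarrow> 'a)) set"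

definition smooth_manifold ::
  "('m::{t2_space, second_countable_topology}, 'a::euclidean_space) atlas \<Rightarrow> bool" where
  "smooth_manifold A \<longleftrightarrow>
     (\<Union>(U, \<phi>)\<in>A. U) = UNIV \<and>
     (\<exists>W. subspace W \<and> (\<forall>(U, \<phi>)\<in>A. open U \<and> inj_on \<phi> U \<and> openin (top_of_set W) (\<phi> ` U) \<and>
        homeomorphism U (\<phi> ` U) \<phi> (inv_into U \<phi>))) \<and>
     (\<forall>(U, \<phi>)\<in>A. \<forall>(V, \<psi>)\<in>A. smooth_on (\<phi> ` (U \<inter> V)) (\<psi> \<circ> inv_into U \<phi>))"

definition smooth_fun_on ::
  "('m, 'a::euclidean_space) atlas \<Rightarrow> 'm set \<Rightarrow> ('m \<Rightarrow> real) \<Rightarrow> bool" where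
  "smooth_fun_on A X f \<longleftrightarrow> (\<forall>(U, \<phi>)\<in>A. smooth_on (\<phi> ` (X \<inter> U)) (f \<circ> inv_into U \<phi>))"

definition Cinf :: "('m, 'a::euclidean_space) atlas \<Rightarrow> ('m \<Rightarrow> real) set" where
  "Cinf A = {f. smooth_fun_on A UNIV f}"

definition smooth_map ::
  "('m::topological_space, 'a::euclidean_space) atlas \<Rightarrow>
   ('n::topological_space, 'b::euclidean_space) atlas \<Rightarrow> ('m \<Rightarrow> 'n) \<Rightarrow> bool" where
  "smooth_map A B F \<longleftrightarrow> continuous_on UNIV F \<and>
     (\<forall>(U, \<phi>)\<in>A. \<forall>(V, \<psi>)\<in>B. smooth_on (\<phi> ` (U \<inter> F -` V)) (\<psi> \<circ> F \<circ> inv_into U \<phi>))"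

definition prod_atlas :: "('m, 'a) atlas \<Rightarrow> ('n, 'b) atlas \<Rightarrow> ('m \<times> 'n, 'a \<times> 'b) atlas" where
  "prod_atlas A B = {(U \<times> V, map_prod \<phi> \<psi>) |U \<phi> V \<psi>. (U, \<phi>) \<in> A \<and> (V, \<psi>) \<in> B}"

text \<open>Tangent vectors are point derivations of the algebra of smooth functions; only their values
  on smooth functions are meaningful.\<close>

definition derivation_at ::
  "('m, 'a::euclidean_space) atlas \<Rightarrow> 'm \<Rightarrow> (('m \<Rightarrow> real) \<Rightarrow> real) \<Rightarrow> bool" where
  "derivation_at A x D \<longleftrightarrow>
     (\<forall>f\<in>Cinf A. \<forall>h\<in>Cinf A. D (\<lambda>y. f y + h y) = D f + D h) \<and>
     (\<forall>c. \<forall>f\<in>Cinf A. D (\<lambda>y. c * f y) = c * D f) \<and>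
     (\<forall>f\<in>Cinf A. \<forall>h\<in>Cinf A. D (\<lambda>y. f y * h y) = f x * D h + h x * D f)"


section \<open>Linear algebra on subspaces of a real vector space\<close>

definition lin_on :: "'v::real_vector set \<Rightarrow> ('v \<Rightarrow> 'w::real_vector) \<Rightarrow> bool" where
  "lin_on V f \<longleftrightarrow> (\<forall>v\<in>V. \<forall>w\<in>V. f (v + w) = f v + f w) \<and> (\<forall>c. \<forall>v\<in>V. f (c *\<^sub>R v) = c *\<^sub>R f v)"

definition basis_family :: "nat \<Rightarrow> (nat \<Rightarrow> 'v::real_vector) \<Rightarrow> 'v set \<Rightarrow> bool" where
  "basis_family k e V \<longleftrightarrow>
     inj_on e {..<k} \<and> independent (e ` {..<k}) \<and> span (e ` {..<k}) = V"

text \<open>The trace of a linear endomorphism of a finite-dimensional subspace \<open>V\<close>.\<close>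

definition trace_on :: "'v::real_vector set \<Rightarrow> ('v \<Rightarrow> 'v) \<Rightarrow> real" where
  "trace_on V T =
     (let B = (SOME B. independent B \<and> span B = V) in \<Sum>b\<in>B. representation B (T b) b)"


section \<open>Vector bundles and Courant algebroids\<close>

text \<open>The fibre over \<open>x\<close> is a linear subspace \<open>fibre E x\<close> of one real vector space type (for
  abstract fibres, take their direct sum), so that a section is a function of type
  \<open>'m \<Rightarrow> 'v\<close>. No smooth structure or finite dimension is assumed on \<open>'v\<close>: the bundle
  structure is given by local frames \<open>(U, k, e)\<close>, i.e. local trivializations over \<open>U\<close> of rank \<open>k\<close>.
  The value \<open>anchor E x v\<close> is a tangent vector at \<open>x\<close>.\<close>

record ('m, 'a, 'v) courant =
  atlas :: "('m, 'a) atlas"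
  fibre :: "'m \<Rightarrow> 'v set"
  frames :: "('m set \<times> nat \<times> (nat \<Rightarrow> 'm \<Rightarrow> 'v)) set"
  pairing :: "'m \<Rightarrow> 'v \<Rightarrow> 'v \<Rightarrow> real"
  anchor :: "'m \<Rightarrow> 'v \<Rightarrow> ('m \<Rightarrow> real) \<Rightarrow> real"
  bracket :: "('m \<Rightarrow> 'v) \<Rightarrow> ('m \<Rightarrow> 'v) \<Rightarrow> 'm \<Rightarrow> 'v"

definition smooth_section_on ::
  "('m::topological_space, 'a::euclidean_space, 'v::real_vector) courant \<Rightarrow> 'm set \<Rightarrow> ('m \<Rightarrow> 'v) \<Rightarrow> bool" where
  "smooth_section_on E U s \<longleftrightarrow> (\<forall>x\<in>U. s x \<in> fibre E x) \<and>
     (\<forall>(V, k, e)\<in>frames E. \<exists>c. (\<forall>i<k. smooth_fun_on (atlas E) (U \<inter> V) (c i)) \<and>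
        (\<forall>x\<in>U \<inter> V. s x = (\<Sum>i<k. c i x *\<^sub>R e i x)))"

text \<open>Requiring every frame to be smooth in the other frames is the smoothness of the transition
  functions.\<close>

definition vector_bundle ::
  "('m::topological_space, 'a::euclidean_space, 'v::real_vector) courant \<Rightarrow> bool" where
  "vector_bundle E \<longleftrightarrow>
     (\<forall>x. subspace (fibre E x)) \<and>
     (\<Union>(U, k, e)\<in>frames E. U) = UNIV \<and>
     (\<forall>(U, k, e)\<in>frames E. open U \<and> (\<forall>x\<in>U. basis_family k (\<lambda>i. e i x) (fibre E x)) \<and>
        (\<forall>i<k. smooth_section_on E U (e i)))"

definition Sec :: "('m::topological_space, 'a::euclidean_space, 'v::real_vector) courant \<Rightarrow>
    ('m \<Rightarrow> 'v set) \<Rightarrow> ('m \<Rightarrow> 'v) set" where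
  "Sec E V = {s. smooth_section_on E UNIV s \<and> (\<forall>x. s x \<in> V x)}"

abbreviation \<Gamma> :: "('m::topological_space, 'a::euclidean_space, 'v::real_vector) courant \<Rightarrow>
    ('m \<Rightarrow> 'v) set" where
  "\<Gamma> E \<equiv> Sec E (fibre E)"

definition act :: "('m, 'a, 'v) courant \<Rightarrow> ('m \<Rightarrow> 'v) \<Rightarrow> ('m \<Rightarrow> real) \<Rightarrow> 'm \<Rightarrow> real" where
  "act E u f = (\<lambda>x. anchor E x (u x) f)"

definition pair_sections :: "('m, 'a, 'v) courant \<Rightarrow> ('m \<Rightarrow> 'v) \<Rightarrow> ('m \<Rightarrow> 'v) \<Rightarrow> 'm \<Rightarrow> real" where
  "pair_sections E u v = (\<lambda>x. pairing E x (u x) (v x))"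

definition nondegenerate_on :: "('m, 'a, 'v::real_vector) courant \<Rightarrow> ('m \<Rightarrow> 'v set) \<Rightarrow> bool" where
  "nondegenerate_on E V \<longleftrightarrow> (\<forall>x. \<forall>v\<in>V x. (\<forall>w\<in>V x. pairing E x v w = 0) \<longrightarrow> v = 0)"

definition dE :: "('m, 'a, 'v) courant \<Rightarrow> ('m \<Rightarrow> real) \<Rightarrow> 'm \<Rightarrow> 'v" where
  "dE E f = (\<lambda>x. THE w. w \<in> fibre E x \<and> (\<forall>v\<in>fibre E x. pairing E x v w = anchor E x v f))"

definition courant_algebroid ::
  "('m::{t2_space, second_countable_topology}, 'a::euclidean_space, 'v::real_vector) courant \<Rightarrow> bool" where
  "courant_algebroid E \<longleftrightarrow>
     smooth_manifold (atlas E) \<and> vector_bundle E \<and>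
     \<comment> \<open>the bilinear form\<close>
     (\<forall>x. \<forall>v\<in>fibre E x. lin_on (fibre E x) (pairing E x v)) \<and>
     (\<forall>x. \<forall>v\<in>fibre E x. \<forall>w\<in>fibre E x. pairing E x v w = pairing E x w v) \<and>
     (\<forall>u\<in>\<Gamma> E. \<forall>v\<in>\<Gamma> E. pair_sections E u v \<in> Cinf (atlas E)) \<and>
     nondegenerate_on E (fibre E) \<and>
     \<comment> \<open>the anchor\<close>
     (\<forall>x. \<forall>v\<in>fibre E x. derivation_at (atlas E) x (anchor E x v)) \<and>
     (\<forall>x. \<forall>f\<in>Cinf (atlas E). lin_on (fibre E x) (\<lambda>v. anchor E x v f)) \<and>
     (\<forall>u\<in>\<Gamma> E. \<forall>f\<in>Cinf (atlas E). act E u f \<in> Cinf (atlas E)) \<and>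
     \<comment> \<open>the bracket\<close>
     (\<forall>u\<in>\<Gamma> E. \<forall>v\<in>\<Gamma> E. bracket E u v \<in> \<Gamma> E) \<and>
     (\<forall>u\<in>\<Gamma> E. \<forall>v\<in>\<Gamma> E. \<forall>w\<in>\<Gamma> E.
        bracket E (\<lambda>x. u x + v x) w = (\<lambda>x. bracket E u w x + bracket E v w x) \<and>
        bracket E w (\<lambda>x. u x + v x) = (\<lambda>x. bracket E w u x + bracket E w v x)) \<and>
     (\<forall>c. \<forall>u\<in>\<Gamma> E. \<forall>v\<in>\<Gamma> E.
        bracket E (\<lambda>x. c *\<^sub>R u x) v = (\<lambda>x. c *\<^sub>R bracket E u v x) \<and>
        bracket E u (\<lambda>x. c *\<^sub>R v x) = (\<lambda>x. c *\<^sub>R bracket E u v x)) \<and>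
     (\<forall>u\<in>\<Gamma> E. \<forall>v\<in>\<Gamma> E. \<forall>w\<in>\<Gamma> E.
        bracket E u (bracket E v w) =
          (\<lambda>x. bracket E (bracket E u v) w x + bracket E v (bracket E u w) x)) \<and>
     (\<forall>u\<in>\<Gamma> E. \<forall>v\<in>\<Gamma> E. \<forall>f\<in>Cinf (atlas E).
        bracket E u (\<lambda>x. f x *\<^sub>R v x) = (\<lambda>x. f x *\<^sub>R bracket E u v x + act E u f x *\<^sub>R v x)) \<and>
     (\<forall>u\<in>\<Gamma> E. \<forall>v\<in>\<Gamma> E. \<forall>w\<in>\<Gamma> E.
        act E u (pair_sections E v w) = (\<lambda>x. pair_sections E (bracket E u v) w x + pair_sections E v (bracket E u w) x)) \<and>
     (\<forall>u\<in>\<Gamma> E. \<forall>v\<in>\<Gamma> E.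
        (\<lambda>x. bracket E u v x + bracket E v u x) = dE E (pair_sections E u v))"


section \<open>Generalized pseudometrics, divergences and the generalized Ricci tensor\<close>

definition subbundle ::
  "('m::topological_space, 'a::euclidean_space, 'v::real_vector) courant \<Rightarrow> ('m \<Rightarrow> 'v set) \<Rightarrow> bool" where
  "subbundle E V \<longleftrightarrow>
     (\<forall>x. subspace (V x) \<and> V x \<subseteq> fibre E x) \<and>
     (\<forall>x. \<exists>U k e. open U \<and> x \<in> U \<and> (\<forall>i<k. smooth_section_on E U (e i)) \<and>
        (\<forall>y\<in>U. basis_family k (\<lambda>i. e i y) (V y)))"

definition perp :: "('m, 'a, 'v) courant \<Rightarrow> ('m \<Rightarrow> 'v set) \<Rightarrow> 'm \<Rightarrow> 'v set" where
  "perp E V = (\<lambda>x. {w \<in> fibre E x. \<forall>v\<in>V x. pairing E x w v = 0})"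

definition generalized_pseudometric ::
  "('m::topological_space, 'a::euclidean_space, 'v::real_vector) courant \<Rightarrow> ('m \<Rightarrow> 'v set) \<Rightarrow> bool" where
  "generalized_pseudometric E V \<longleftrightarrow> subbundle E V \<and> nondegenerate_on E V"

definition orth_proj ::
  "('m, 'a, 'v::real_vector) courant \<Rightarrow> ('m \<Rightarrow> 'v set) \<Rightarrow> ('m \<Rightarrow> 'v) \<Rightarrow> 'm \<Rightarrow> 'v" where
  "orth_proj E V s = (\<lambda>x. THE w. w \<in> V x \<and> s x - w \<in> perp E V x)"

definition divergence ::
  "('m::topological_space, 'a::euclidean_space, 'v::real_vector) courant \<Rightarrow>
   (('m \<Rightarrow> 'v) \<Rightarrow> 'm \<Rightarrow> real) \<Rightarrow> bool" where
  "divergence E dv \<longleftrightarrow>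
     (\<forall>a\<in>\<Gamma> E. dv a \<in> Cinf (atlas E)) \<and>
     (\<forall>a\<in>\<Gamma> E. \<forall>b\<in>\<Gamma> E. dv (\<lambda>x. a x + b x) = (\<lambda>x. dv a x + dv b x)) \<and>
     (\<forall>c. \<forall>a\<in>\<Gamma> E. dv (\<lambda>x. c *\<^sub>R a x) = (\<lambda>x. c * dv a x)) \<and>
     (\<forall>f\<in>Cinf (atlas E). \<forall>a\<in>\<Gamma> E. dv (\<lambda>x. f x *\<^sub>R a x) = (\<lambda>x. f x * dv a x + act E a f x))"

text \<open>The trace over \<open>V\<close> of a function-linear operator \<open>T\<close> on the sections of \<open>V\<close>: at \<open>x\<close> it is
  the trace of the fibre endomorphism induced by \<open>T\<close>, obtained by extending a vector of
  the fibre to a section.\<close>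

definition fibre_map ::
  "('m::topological_space, 'a::euclidean_space, 'v::real_vector) courant \<Rightarrow> ('m \<Rightarrow> 'v set) \<Rightarrow>
   (('m \<Rightarrow> 'v) \<Rightarrow> 'm \<Rightarrow> 'v) \<Rightarrow> 'm \<Rightarrow> 'v \<Rightarrow> 'v" where
  "fibre_map E V T x v = T (SOME c. c \<in> Sec E V \<and> c x = v) x"

definition section_trace ::
  "('m::topological_space, 'a::euclidean_space, 'v::real_vector) courant \<Rightarrow> ('m \<Rightarrow> 'v set) \<Rightarrow>
   (('m \<Rightarrow> 'v) \<Rightarrow> 'm \<Rightarrow> 'v) \<Rightarrow> 'm \<Rightarrow> real" where
  "section_trace E V T = (\<lambda>x. trace_on (V x) (fibre_map E V T x))"

definition GRic ::
  "('m::topological_space, 'a::euclidean_space, 'v::real_vector) courant \<Rightarrow> ('m \<Rightarrow> 'v set) \<Rightarrow>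
   (('m \<Rightarrow> 'v) \<Rightarrow> 'm \<Rightarrow> real) \<Rightarrow> ('m \<Rightarrow> 'v) \<Rightarrow> ('m \<Rightarrow> 'v) \<Rightarrow> 'm \<Rightarrow> real" where
  "GRic E Vp dv a b = (\<lambda>x.
     dv (orth_proj E Vp (bracket E b a)) x
     - act E b (dv a) x
     - section_trace E Vp
         (\<lambda>c. orth_proj E Vp (bracket E (orth_proj E (perp E Vp) (bracket E c b)) a)) x)"


section \<open>Lie algebras and Lie groups\<close>

definition lie_algebra :: "('s::real_vector \<Rightarrow> 's \<Rightarrow> 's) \<Rightarrow> bool" where
  "lie_algebra lb \<longleftrightarrow>
     bilinear lb \<and> (\<forall>u. lb u u = 0) \<and>
     (\<forall>u v w. lb u (lb v w) = lb (lb u v) w + lb v (lb u w)) \<and>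
     (\<exists>B::'s set. finite B \<and> span B = UNIV)"

definition lie_group ::
  "'g::{t2_space, second_countable_topology} monoid \<Rightarrow> ('g, 'b::euclidean_space) atlas \<Rightarrow> bool" where
  "lie_group G A \<longleftrightarrow>
     group G \<and> carrier G = UNIV \<and> smooth_manifold A \<and>
     smooth_map (prod_atlas A A) A (\<lambda>(g, h). g \<otimes>\<^bsub>G\<^esub> h) \<and>
     smooth_map A A (\<lambda>g. inv\<^bsub>G\<^esub> g)"

definition left_invariant_field ::
  "'g monoid \<Rightarrow> ('g, 'b::euclidean_space) atlas \<Rightarrow> (('g \<Rightarrow> real) \<Rightarrow> 'g \<Rightarrow> real) \<Rightarrow> bool" where
  "left_invariant_field G A X \<longleftrightarrow>
     (\<forall>f\<in>Cinf A. X f \<in> Cinf A) \<and>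
     (\<forall>g. derivation_at A g (\<lambda>f. X f g)) \<and>
     (\<forall>g. \<forall>f\<in>Cinf A. X (\<lambda>h. f (g \<otimes>\<^bsub>G\<^esub> h)) = (\<lambda>h. X f (g \<otimes>\<^bsub>G\<^esub> h)))"

text \<open>\<open>L\<close> identifies the Lie algebra \<open>(UNIV, lb)\<close> with that of the left-invariant vector fields.\<close>

definition lie_algebra_of ::
  "'g monoid \<Rightarrow> ('g, 'b::euclidean_space) atlas \<Rightarrow> ('s::real_vector \<Rightarrow> 's \<Rightarrow> 's) \<Rightarrow>
   ('s \<Rightarrow> ('g \<Rightarrow> real) \<Rightarrow> 'g \<Rightarrow> real) \<Rightarrow> bool" where
  "lie_algebra_of G A lb L \<longleftrightarrow>
     (\<forall>u. left_invariant_field G A (L u)) \<and>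
     (\<forall>f\<in>Cinf A. \<forall>g. linear (\<lambda>u. L u f g)) \<and>
     (\<forall>u. (\<forall>f\<in>Cinf A. L u f = (\<lambda>g. 0)) \<longrightarrow> u = 0) \<and>
     (\<forall>X. left_invariant_field G A X \<longrightarrow> (\<exists>u. \<forall>f\<in>Cinf A. X f = L u f)) \<and>
     (\<forall>u v. \<forall>f\<in>Cinf A. L (lb u v) f = (\<lambda>g. L u (L v f) g - L v (L u f) g))"


section \<open>Equivariant Courant algebroids\<close>

definition lie_equivariant_CA ::
  "('m::{t2_space, second_countable_topology}, 'a::euclidean_space, 'v::real_vector) courant \<Rightarrow>
   ('s::real_vector \<Rightarrow> 's \<Rightarrow> 's) \<Rightarrow> ('s \<Rightarrow> 'm \<Rightarrow> 'v) \<Rightarrow> bool" where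
  "lie_equivariant_CA E lb \<xi> \<longleftrightarrow>
     courant_algebroid E \<and> lie_algebra lb \<and>
     (\<forall>u. \<xi> u \<in> \<Gamma> E) \<and>
     (\<forall>x. linear (\<lambda>u. \<xi> u x) \<and> inj (\<lambda>u. \<xi> u x)) \<and>
     (\<forall>u v. bracket E (\<xi> u) (\<xi> v) = \<xi> (lb u v)) \<and>
     (\<forall>u v. pair_sections E (\<xi> u) (\<xi> v) = (\<lambda>x. 0))"

text \<open>A smooth left action \<open>\<Phi>\<close> on the total space of \<open>E\<close> by fibrewise linear maps, covering an
  action \<open>\<phi>\<close> on the base; \<open>\<Phi> g x\<close> maps the fibre over \<open>x\<close> to the one over \<open>\<phi> g x\<close>.\<close>

definition smooth_bundle_action ::
  "'g::{t2_space, second_countable_topology} monoid \<Rightarrow> ('g, 'b::euclidean_space) atlas \<Rightarrow>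
   ('m::{t2_space, second_countable_topology}, 'a::euclidean_space, 'v::real_vector) courant \<Rightarrow>
   ('g \<Rightarrow> 'm \<Rightarrow> 'm) \<Rightarrow> ('g \<Rightarrow> 'm \<Rightarrow> 'v \<Rightarrow> 'v) \<Rightarrow> bool" where
  "smooth_bundle_action G A E \<phi> \<Phi> \<longleftrightarrow>
     group_action G UNIV \<phi> \<and>
     smooth_map (prod_atlas A (atlas E)) (atlas E) (\<lambda>(g, x). \<phi> g x) \<and>
     (\<forall>g x. lin_on (fibre E x) (\<Phi> g x) \<and> \<Phi> g x ` fibre E x \<subseteq> fibre E (\<phi> g x)) \<and>
     (\<forall>x. \<forall>v\<in>fibre E x. \<Phi> \<one>\<^bsub>G\<^esub> x v = v) \<and>
     (\<forall>g h x. \<forall>v\<in>fibre E x. \<Phi> (g \<otimes>\<^bsub>G\<^esub> h) x v = \<Phi> g (\<phi> h x) (\<Phi> h x v)) \<and>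
     (\<forall>s\<in>\<Gamma> E. \<forall>(U, k, e)\<in>frames E. \<exists>c.
        (\<forall>i<k. smooth_fun_on (prod_atlas A (atlas E)) {(g, x). \<phi> g x \<in> U} (c i)) \<and>
        (\<forall>g x. \<phi> g x \<in> U \<longrightarrow> \<Phi> g x (s x) = (\<Sum>i<k. c i (g, x) *\<^sub>R e i (\<phi> g x))))"

text \<open>The action integrates the infinitesimal one. For a left action the infinitesimal action that
  is a Lie algebra homomorphism is the derivative at the unit, along \<open>u\<close>, of
  \<open>f \<mapsto> f \<circ> \<phi> (inverse of g)\<close> on functions and of \<open>s \<mapsto> \<Phi> g \<circ> s \<circ> \<phi> (inverse of g)\<close> on sections;
  the latter is a derivative in a finite-dimensional fibre, tested against linear functionals.\<close>

definition group_equivariant_CA ::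
  "'g::{t2_space, second_countable_topology} monoid \<Rightarrow> ('g, 'b::euclidean_space) atlas \<Rightarrow>
   ('s::real_vector \<Rightarrow> 's \<Rightarrow> 's) \<Rightarrow> ('s \<Rightarrow> ('g \<Rightarrow> real) \<Rightarrow> 'g \<Rightarrow> real) \<Rightarrow>
   ('m::{t2_space, second_countable_topology}, 'a::euclidean_space, 'v::real_vector) courant \<Rightarrow>
   ('s \<Rightarrow> 'm \<Rightarrow> 'v) \<Rightarrow> ('g \<Rightarrow> 'm \<Rightarrow> 'm) \<Rightarrow> ('g \<Rightarrow> 'm \<Rightarrow> 'v \<Rightarrow> 'v) \<Rightarrow> bool" where
  "group_equivariant_CA G A lb L E \<xi> \<phi> \<Phi> \<longleftrightarrow>
     lie_equivariant_CA E lb \<xi> \<and>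
     lie_group G A \<and> connected (UNIV :: 'g set) \<and> lie_algebra_of G A lb L \<and>
     smooth_bundle_action G A E \<phi> \<Phi> \<and>
     (\<forall>u x. \<forall>f\<in>Cinf (atlas E).
        anchor E x (\<xi> u x) f = L u (\<lambda>g. f (\<phi> (inv\<^bsub>G\<^esub> g) x)) \<one>\<^bsub>G\<^esub>) \<and>
     (\<forall>u x. \<forall>s\<in>\<Gamma> E. \<forall>\<alpha>::'v \<Rightarrow> real. linear \<alpha> \<longrightarrow>
        \<alpha> (bracket E (\<xi> u) s x) =
          L u (\<lambda>g. \<alpha> (\<Phi> g (\<phi> (inv\<^bsub>G\<^esub> g) x) (s (\<phi> (inv\<^bsub>G\<^esub> g) x)))) \<one>\<^bsub>G\<^esub>)"

definition free_action :: "'g monoid \<Rightarrow> ('g \<Rightarrow> 'm \<Rightarrow> 'm) \<Rightarrow> bool" where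
  "free_action G \<phi> \<longleftrightarrow> (\<forall>g\<in>carrier G. \<forall>x. \<phi> g x = x \<longrightarrow> g = \<one>\<^bsub>G\<^esub>)"

definition proper_action :: "('g::topological_space \<Rightarrow> 'm::topological_space \<Rightarrow> 'm) \<Rightarrow> bool" where
  "proper_action \<phi> \<longleftrightarrow> proper_map euclidean euclidean (\<lambda>(g, x). (\<phi> g x, x))"

definition sE :: "('s \<Rightarrow> 'm \<Rightarrow> 'v) \<Rightarrow> 'm \<Rightarrow> 'v set" where
  "sE \<xi> = (\<lambda>x. range (\<lambda>u. \<xi> u x))"

definition invariant_functions ::
  "('m, 'a::euclidean_space, 'v) courant \<Rightarrow> ('s \<Rightarrow> 'm \<Rightarrow> 'v) \<Rightarrow> ('m \<Rightarrow> real) set" where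
  "invariant_functions E \<xi> = {f \<in> Cinf (atlas E). \<forall>u. act E (\<xi> u) f = (\<lambda>x. 0)}"

definition invariant_sections ::
  "('m::topological_space, 'a::euclidean_space, 'v::real_vector) courant \<Rightarrow> ('s \<Rightarrow> 'm \<Rightarrow> 'v) \<Rightarrow>
   ('m \<Rightarrow> 'v set) \<Rightarrow> ('m \<Rightarrow> 'v) set" where
  "invariant_sections E \<xi> V = {a \<in> Sec E V. \<forall>u. bracket E (\<xi> u) a = (\<lambda>x. 0)}"

definition admissible ::
  "('m::topological_space, 'a::euclidean_space, 'v::real_vector) courant \<Rightarrow> ('s \<Rightarrow> 'm \<Rightarrow> 'v) \<Rightarrow>
   ('m \<Rightarrow> 'v set) \<Rightarrow> bool" where
  "admissible E \<xi> V \<longleftrightarrow>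
     generalized_pseudometric E V \<and>
     (\<forall>u. \<forall>a\<in>Sec E V. bracket E (\<xi> u) a \<in> Sec E V) \<and>
     (\<forall>x. V x \<subseteq> perp E (sE \<xi>) x)"

definition equivariant_divergence ::
  "('m::topological_space, 'a::euclidean_space, 'v::real_vector) courant \<Rightarrow>
   ('s::real_vector \<Rightarrow> 's \<Rightarrow> 's) \<Rightarrow> ('s \<Rightarrow> 'm \<Rightarrow> 'v) \<Rightarrow> (('m \<Rightarrow> 'v) \<Rightarrow> 'm \<Rightarrow> real) \<Rightarrow> bool" where
  "equivariant_divergence E lb \<xi> dv \<longleftrightarrow>
     divergence E dv \<and>
     (\<forall>u. \<forall>a\<in>\<Gamma> E. act E (\<xi> u) (dv a) = dv (bracket E (\<xi> u) a)) \<and>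
     (\<forall>u. dv (\<xi> u) = (\<lambda>x. - trace_on UNIV (lb u)))"


section \<open>Reduction\<close>

text \<open>\<open>q x\<close> maps the fibre of \<open>\<s>\<^sub>E\<^sup>\<bottom>\<close> over \<open>x\<close> to the fibre of the quotient bundle over \<open>\<pi> x\<close>.\<close>

definition descends_to ::
  "('m \<Rightarrow> 'b) \<Rightarrow> ('m \<Rightarrow> 'v \<Rightarrow> 'w) \<Rightarrow> ('m \<Rightarrow> 'v) \<Rightarrow> ('b \<Rightarrow> 'w) \<Rightarrow> bool" where
  "descends_to \<pi> q a t \<longleftrightarrow> (\<forall>x. t (\<pi> x) = q x (a x))"

text \<open>\<open>R\<close> is the reduced Courant algebroid: its base, with projection \<open>\<pi>\<close>, is the orbit manifold, its
  fibres are the quotients of \<open>\<s>\<^sub>E\<^sup>\<bottom>/\<s>\<^sub>E\<close> by the group, and its smooth functions, its sections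
  and its structure maps are induced from the invariant ones on \<open>E\<close>. These conditions determine
  \<open>R\<close> up to isomorphism; the Courant algebroid axioms for \<open>R\<close> are not assumed, since they follow from
  those for \<open>E\<close>.\<close>

definition reduced_CA ::
  "'g monoid \<Rightarrow>
   ('m::{t2_space, second_countable_topology}, 'a::euclidean_space, 'v::real_vector) courant \<Rightarrow>
   ('s \<Rightarrow> 'm \<Rightarrow> 'v) \<Rightarrow> ('g \<Rightarrow> 'm \<Rightarrow> 'm) \<Rightarrow> ('g \<Rightarrow> 'm \<Rightarrow> 'v \<Rightarrow> 'v) \<Rightarrow>
   ('b::{t2_space, second_countable_topology}, 'c::euclidean_space, 'w::real_vector) courant \<Rightarrow>
   ('m \<Rightarrow> 'b) \<Rightarrow> ('m \<Rightarrow> 'v \<Rightarrow> 'w) \<Rightarrow> bool" where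
  "reduced_CA G E \<xi> \<phi> \<Phi> R \<pi> q \<longleftrightarrow>
     (let sp = perp E (sE \<xi>); inv_secs = invariant_sections E \<xi> sp in
     \<comment> \<open>the base\<close>
     smooth_manifold (atlas R) \<and> surj \<pi> \<and>
     (\<forall>x y. \<pi> x = \<pi> y \<longleftrightarrow> y \<in> orbit G \<phi> x) \<and>
     bij_betw (\<lambda>h. h \<circ> \<pi>) (Cinf (atlas R)) (invariant_functions E \<xi>) \<and>
     \<comment> \<open>the bundle\<close>
     vector_bundle R \<and>
     (\<forall>x. lin_on (sp x) (q x) \<and> q x ` sp x = fibre R (\<pi> x) \<and> {v \<in> sp x. q x v = 0} = sE \<xi> x) \<and>
     (\<forall>g\<in>carrier G. \<forall>x. \<forall>v\<in>sp x. q (\<phi> g x) (\<Phi> g x v) = q x v) \<and>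
     (\<forall>a\<in>inv_secs. \<exists>t\<in>\<Gamma> R. descends_to \<pi> q a t) \<and>
     (\<forall>t\<in>\<Gamma> R. \<exists>a\<in>inv_secs. descends_to \<pi> q a t) \<and>
     \<comment> \<open>the Courant algebroid structure\<close>
     (\<forall>x. \<forall>v\<in>sp x. \<forall>w\<in>sp x. pairing R (\<pi> x) (q x v) (q x w) = pairing E x v w) \<and>
     (\<forall>x. \<forall>v\<in>sp x. \<forall>h\<in>Cinf (atlas R). anchor R (\<pi> x) (q x v) h = anchor E x v (h \<circ> \<pi>)) \<and>
     (\<forall>a\<in>inv_secs. \<forall>b\<in>inv_secs. \<forall>s t. descends_to \<pi> q a s \<longrightarrow> descends_to \<pi> q b t \<longrightarrow>
        descends_to \<pi> q (bracket E a b) (bracket R s t)))"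

definition reduced_pseudometric ::
  "('m \<Rightarrow> 'b) \<Rightarrow> ('m \<Rightarrow> 'v \<Rightarrow> 'w) \<Rightarrow> ('m \<Rightarrow> 'v set) \<Rightarrow> 'b \<Rightarrow> 'w set" where
  "reduced_pseudometric \<pi> q V = (\<lambda>y. \<Union>x\<in>\<pi> -` {y}. q x ` V x)"

definition reduced_divergence ::
  "('m::topological_space, 'a::euclidean_space, 'v::real_vector) courant \<Rightarrow> ('s \<Rightarrow> 'm \<Rightarrow> 'v) \<Rightarrow>
   ('m \<Rightarrow> 'b) \<Rightarrow> ('m \<Rightarrow> 'v \<Rightarrow> 'w) \<Rightarrow> (('m \<Rightarrow> 'v) \<Rightarrow> 'm \<Rightarrow> real) \<Rightarrow> ('b \<Rightarrow> 'w) \<Rightarrow> 'b \<Rightarrow> real" where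
  "reduced_divergence E \<xi> \<pi> q dv t = (THE h.
     \<forall>a\<in>invariant_sections E \<xi> (perp E (sE \<xi>)). descends_to \<pi> q a t \<longrightarrow> h \<circ> \<pi> = dv a)"

end

theory Submission
  imports Defs
begin

text \<open>Let \<open>T c = [[c, b]\<^sub>-, a]\<^sub>+\<close> be the operator on \<open>\<Gamma>(V\<^sub>+)\<close> whose trace enters \<open>GRic(a, b)\<close>. The three
terms \<open>div [b, a]\<^sub>+\<close>, \<open>b \<cdot> div a\<close> and \<open>Tr T\<close> are built from brackets, orthogonal projections and the
divergence. Each of these maps invariant sections to invariant ones and is compatible with the
map \<open>q\<close> from \<open>\<s>\<^sub>E\<^sup>\<bottom>\<close> to the reduced bundle, so the three terms can be compared one by one. Four facts
make this work.

First, every vector \<open>v \<in> V\<^sub>+\<close> at a point is the value of an invariant section of \<open>V\<^sub>+\<close>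
(\<open>inv_V_section_through\<close>). A bump function downstairs gives a section of the reduced bundle through
\<open>q v\<close>; it lifts to an invariant section of \<open>\<s>\<^sub>E\<^sup>\<bottom>\<close>, whose value differs from \<open>v\<close> by an element of
\<open>\<s>\<^sub>E\<close>, and the projection to \<open>V\<^sub>+\<close> removes this difference since \<open>V\<^sub>+ \<subseteq> \<s>\<^sub>E\<^sup>\<bottom>\<close>. So the fibre of the reduced
pseudometric over \<open>\<pi> x\<close> is the isomorphic image under \<open>q\<close> of the fibre of \<open>V\<^sub>+\<close> over each point \<open>x\<close> of the
orbit (\<open>reduced_V\<close>, \<open>q_inj_V\<close>).

Second, both orthogonal projections descend (\<open>pos_descends\<close>, \<open>neg_descends\<close>). The projection to the
negative part relies on \<open>(\<s>\<^sub>E\<^sup>\<bottom>)\<^sup>\<bottom> = \<s>\<^sub>E\<close>, which makes the reduced pairing non-degenerate.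

Third, \<open>\<langle>T c, d\<rangle> = \<langle>c, [b, [a, d]\<^sub>-]\<rangle>\<close> for \<open>c, d \<in> \<Gamma>(V\<^sub>+)\<close> (\<open>pairing_ricci_op\<close>). Hence \<open>T c\<close> at \<open>x\<close> depends
only on \<open>c x\<close>, and the fibre endomorphism induced by \<open>T\<close> can be computed from invariant
sections. These descend, so \<open>q\<close> conjugates it to its reduced counterpart and the traces
agree (\<open>section_trace_descends\<close>).

Fourth, the reduced divergence is well defined: two invariant lifts of a section differ by an
invariant section \<open>\<Sum>\<^sub>b f\<^sub>b \<xi>(b)\<close> of \<open>\<s>\<^sub>E\<close>, and its divergence is \<open>0\<close> (\<open>div_invariant_sE\<close>), because invariance
gives \<open>\<Sum>\<^sub>b \<xi>(b) \<cdot> f\<^sub>b = \<Sum>\<^sub>b f\<^sub>b Tr ad\<^sub>b\<close> while \<open>div \<xi>(b) = - Tr ad\<^sub>b\<close>.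

The analytic input consists of bump functions and of the smoothness of solutions of linear systems with
smooth coefficients (\<open>smooth_germ_linear_system\<close>); the latter yields the smoothness of the orthogonal
projections and of the functions \<open>f\<^sub>b\<close>.\<close>

section \<open>Calculus of smooth functions on Euclidean spaces\<close>

lemma Ck_on_subset: "Ck_on k S f \<Longrightarrow> T \<subseteq> S \<Longrightarrow> Ck_on k T f"
proof (induction k arbitrary: f)
  case 0 then show ?case by (auto intro: continuous_on_subset)
next
  case (Suc k) then show ?case by auto
qed

lemma Ck_on_cong:
  assumes "open S" "\<And>x. x \<in> S \<Longrightarrow> f x = g x" "Ck_on k S f"
  shows "Ck_on k S g"
  using assms(2,3)
proof (induction k arbitrary: f g)
  case 0 then show ?case by (auto cong: continuous_on_cong)
next
  case (Suc k)
  have der: "(g has_derivative frechet_derivative f (at x)) (at x)" if "x \<in> S" for x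
  proof -
    have "(f has_derivative frechet_derivative f (at x)) (at x)"
      using Suc.prems(2) that by (simp add: frechet_derivative_works)
    then show ?thesis
      by (rule has_derivative_transform_within_open[OF _ assms(1) that]) (rule Suc.prems(1))
  qed
  have "frechet_derivative f (at x) v = frechet_derivative g (at x) v" if "x \<in> S" for x v
    using frechet_derivative_at[OF der[OF that]] by simp
  then have "Ck_on k S (\<lambda>x. frechet_derivative g (at x) v)" for v
    using Suc.IH[of "\<lambda>x. frechet_derivative f (at x) v" "\<lambda>x. frechet_derivative g (at x) v"] Suc.prems(2)
    by simp
  then show ?case using der by (auto simp: differentiable_def)
qed

lemma Ck_on_SucI:
  assumes "open S" "\<And>x. x \<in> S \<Longrightarrow> (f has_derivative D x) (at x)" "\<And>v. Ck_on k S (\<lambda>x. D x v)"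
  shows "Ck_on (Suc k) S f"
proof -
  have "D x v = frechet_derivative f (at x) v" if "x \<in> S" for x v
    using frechet_derivative_at[OF assms(2)[OF that]] by simp
  then have "Ck_on k S (\<lambda>x. frechet_derivative f (at x) v)" for v
    using Ck_on_cong[OF assms(1) _ assms(3)[of v]] by simp
  then show ?thesis using assms(2) by (auto simp: differentiable_def)
qed

lemma Ck_on_SucD: "Ck_on (Suc k) S f \<Longrightarrow> Ck_on k S f"
proof (induction k arbitrary: f)
  case 0
  then show ?case
    by (auto intro!: continuous_at_imp_continuous_on differentiable_imp_continuous_within)
next
  case (Suc k) then show ?case by simp
qed

lemma Ck_on_Suc_has_derivative:
  "Ck_on (Suc k) S f \<Longrightarrow> x \<in> S \<Longrightarrow> (f has_derivative frechet_derivative f (at x)) (at x)"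
  by (simp add: frechet_derivative_works)

lemma Ck_on_const: "Ck_on k S (\<lambda>x. c)"
  by (induction k arbitrary: c) auto

lemma Ck_on_add:
  assumes "open S" "Ck_on k S f" "Ck_on k S g"
  shows "Ck_on k S (\<lambda>x. f x + g x)"
  using assms(2,3)
proof (induction k arbitrary: f g)
  case 0 then show ?case by (auto intro: continuous_on_add)
next
  case (Suc k)
  have "Ck_on k S (\<lambda>x. frechet_derivative f (at x) v + frechet_derivative g (at x) v)" for v
    using Suc by simp
  then show ?case
    by (rule Ck_on_SucI[OF assms(1) has_derivative_add, rotated 2])
      (use Suc.prems in \<open>auto intro: Ck_on_Suc_has_derivative\<close>)
qed

lemma Ck_on_bilinear:
  assumes "open S" "bounded_bilinear mul" "Ck_on k S f" "Ck_on k S g"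
  shows "Ck_on k S (\<lambda>x. mul (f x) (g x))"
  using assms(3,4)
proof (induction k arbitrary: f g)
  case 0 then show ?case by (auto intro: bounded_bilinear.continuous_on[OF assms(2)])
next
  case (Suc k)
  have "Ck_on k S (\<lambda>x. mul (f x) (frechet_derivative g (at x) v) + mul (frechet_derivative f (at x) v) (g x))" for v
    using Suc.prems Ck_on_SucD[OF Suc.prems(1)] Ck_on_SucD[OF Suc.prems(2)]
    by (auto intro!: Ck_on_add[OF assms(1)] Suc.IH)
  then show ?case
    by (rule Ck_on_SucI[OF assms(1) bounded_bilinear.FDERIV[OF assms(2)], rotated 2])
      (use Suc.prems in \<open>auto intro: Ck_on_Suc_has_derivative\<close>)
qed

lemmas Ck_on_mult = Ck_on_bilinear[OF _ bounded_bilinear_mult]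

lemma Ck_on_inverse:
  fixes f :: "'a::real_normed_vector \<Rightarrow> real"
  assumes "open S" "\<And>x. x \<in> S \<Longrightarrow> f x \<noteq> 0" "Ck_on k S f"
  shows "Ck_on k S (\<lambda>x. inverse (f x))"
  using assms(3)
proof (induction k)
  case 0 then show ?case using assms(2) by (auto intro: continuous_on_inverse)
next
  case (Suc k)
  have "Ck_on k S (\<lambda>x. - 1 * ((inverse (f x) * frechet_derivative f (at x) v) * inverse (f x)))" for v
    using Suc.prems Suc.IH[OF Ck_on_SucD[OF Suc.prems]]
    by (intro Ck_on_mult Ck_on_const assms(1)) auto
  then have *: "Ck_on k S (\<lambda>x. - (inverse (f x) * frechet_derivative f (at x) v * inverse (f x)))" for v
    by simp
  show ?case
    by (rule Ck_on_SucI[OF assms(1) Deriv.has_derivative_inverse *])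
      (use assms(2) Suc.prems in \<open>auto intro: Ck_on_Suc_has_derivative\<close>)
qed

text \<open>The family is closed under differentiation, which makes the flat function
  \<open>t \<mapsto> exp (- 1 / t)\<close> smooth by induction on the order, for all members at once.\<close>

definition flat_exp :: "nat \<Rightarrow> real \<Rightarrow> real" where
  "flat_exp n t = (if t > 0 then inverse t ^ n * exp (- inverse t) else 0)"

text \<open>One term of the exponential series at \<open>1 / t\<close> already beats the pole. A quadratic bound is what
the derivative at \<open>0\<close> needs.\<close>

lemma flat_exp_bound: "\<bar>flat_exp n t\<bar> \<le> fact (n + 2) * t\<^sup>2"
proof (cases "t > 0")
  case True
  define s where "s = inverse t"
  have s: "s > 0" "t = inverse s" using True by (auto simp: s_def)
  have "s ^ (n + 2) / fact (n + 2) \<le> exp s"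
  proof -
    have "(\<lambda>k. s ^ k /\<^sub>R fact k) sums exp s" by (rule exp_converges)
    moreover have "\<And>k. 0 \<le> s ^ k /\<^sub>R fact k" using s by simp
    ultimately have "s ^ (n + 2) /\<^sub>R fact (n + 2) \<le> exp s"
      using sum_le_suminf[of "\<lambda>k. s ^ k /\<^sub>R fact k" "{n+2}"] by (simp add: sums_iff)
    then show ?thesis by (simp add: field_simps)
  qed
  then have "s ^ n * exp (- s) * s\<^sup>2 \<le> fact (n + 2)"
    by (simp add: exp_minus divide_simps power_add del: fact_Suc)
      (simp add: mult_ac power2_eq_square del: fact_Suc)
  then have "s ^ n * exp (- s) \<le> fact (n + 2) * (inverse s)\<^sup>2"
    using s(1) by (simp add: field_simps)
  then show ?thesis using True s by (simp add: flat_exp_def abs_mult)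
qed (simp add: flat_exp_def)

lemma flat_exp_has_derivative:
  "(flat_exp n has_real_derivative (flat_exp (n + 2) t - real n * flat_exp (n + 1) t)) (at t)"
proof -
  consider "t > 0" | "t < 0" | "t = 0" by linarith
  then show ?thesis
  proof cases
    case 1
    \<comment> \<open>for \<open>n = 0\<close> the truncated exponent is harmless because of the factor \<open>n\<close>\<close>
    have e: "real n * inverse t ^ (n - Suc 0) * (inverse t * inverse t) = real n * inverse t ^ (n + 1)"
      by (cases n) auto
    have "((\<lambda>t. inverse t ^ n * exp (- inverse t)) has_real_derivative
        inverse t ^ n * (exp (- inverse t) * (inverse t * inverse t)) -
        real n * inverse t ^ (n - Suc 0) * (inverse t * inverse t) * exp (- inverse t)) (at t)"
      using 1 by (auto intro!: derivative_eq_intros simp: algebra_simps)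
    then have "((\<lambda>t. inverse t ^ n * exp (- inverse t)) has_real_derivative
        (flat_exp (n + 2) t - real n * flat_exp (n + 1) t)) (at t)"
      unfolding e using 1 by (simp add: flat_exp_def mult_ac)
    then show ?thesis
      by (rule has_field_derivative_transform_within_open[where S = "{0<..}"])
        (use 1 in \<open>auto simp: flat_exp_def\<close>)
  next
    case 2
    have "((\<lambda>t. 0) has_real_derivative (flat_exp (n + 2) t - real n * flat_exp (n + 1) t)) (at t)"
      using 2 by (simp add: flat_exp_def)
    then show ?thesis
      by (rule has_field_derivative_transform_within_open[where S = "{..<0}"])
        (use 2 in \<open>auto simp: flat_exp_def\<close>)
  next
    case 3
    have "((\<lambda>h. flat_exp n h / h) \<longlongrightarrow> 0) (at 0)"
    proof (rule Lim_null_comparison)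
      show "\<forall>\<^sub>F h in at 0. norm (flat_exp n h / h) \<le> fact (n + 2) * \<bar>h\<bar>"
      proof (rule eventuallyI)
        fix h :: real
        show "norm (flat_exp n h / h) \<le> fact (n + 2) * \<bar>h\<bar>"
        proof (cases "h = 0")
          case False
          then show ?thesis
            using flat_exp_bound[of n h] by (simp add: pos_divide_le_eq power2_eq_square mult.assoc)
        qed simp
      qed
      show "((\<lambda>h. fact (n + 2) * \<bar>h\<bar>) \<longlongrightarrow> 0) (at (0::real))"
        by (intro tendsto_mult_right_zero tendsto_rabs_zero tendsto_ident_at)
    qed
    then show ?thesis
      using 3 by (simp add: has_field_derivative_def DERIV_def[unfolded has_field_derivative_def] flat_exp_def)
  qed
qed

text \<open>The order of differentiability is the induction variable and the index \<open>n\<close> is arbitrary, since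
differentiation shifts the index.\<close>

lemma Ck_on_flat_exp:
  fixes f :: "'a::real_normed_vector \<Rightarrow> real"
  assumes "open S" "Ck_on k S f"
  shows "Ck_on k S (\<lambda>x. flat_exp n (f x))"
  using assms(2)
proof (induction k arbitrary: n)
  case 0
  have "continuous_on UNIV (flat_exp n)"
    by (meson DERIV_isCont flat_exp_has_derivative continuous_at_imp_continuous_on)
  then show ?case
    using 0 continuous_on_compose2[of UNIV "flat_exp n" S f] by simp
next
  case (Suc k)
  have "Ck_on k S (\<lambda>x. frechet_derivative f (at x) v *
     (flat_exp (n + 2) (f x) + (- real n) * flat_exp (n + 1) (f x)))" for v
    using Suc.prems Ck_on_SucD[OF Suc.prems]
    by (intro Ck_on_mult Ck_on_add Ck_on_const Suc.IH assms(1)) auto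
  then have *: "Ck_on k S (\<lambda>x. frechet_derivative f (at x) v *
     (flat_exp (n + 2) (f x) - real n * flat_exp (n + 1) (f x)))" for v
    by simp
  show ?case
  proof (rule Ck_on_SucI[OF assms(1) _ *])
    fix x assume "x \<in> S"
    then show "((\<lambda>x. flat_exp n (f x)) has_derivative
       (\<lambda>v. frechet_derivative f (at x) v * (flat_exp (n + 2) (f x) - real n * flat_exp (n + 1) (f x)))) (at x)"
      using DERIV_compose_FDERIV[OF flat_exp_has_derivative Ck_on_Suc_has_derivative[OF Suc.prems]]
      by simp
  qed
qed

section \<open>Germs of smooth functions and bump functions\<close>

text \<open>Functions with values in any normed space are admitted, so that charts themselves are smooth germs.\<close>

definition smooth_germ ::
  "('m::topological_space, 'a::euclidean_space) atlas \<Rightarrow> 'm \<Rightarrow> ('m \<Rightarrow> 'r::real_normed_vector) \<Rightarrow> bool" where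
  "smooth_germ A x f \<longleftrightarrow> (\<forall>(U, \<phi>)\<in>A. x \<in> U \<longrightarrow>
     (\<exists>N F. open N \<and> \<phi> x \<in> N \<and> (\<forall>k. Ck_on k N F) \<and> (\<forall>y\<in>U. \<phi> y \<in> N \<longrightarrow> f y = F (\<phi> y))))"

lemma smooth_germI:
  assumes "\<And>U \<phi>. (U, \<phi>) \<in> A \<Longrightarrow> x \<in> U \<Longrightarrow>
     \<exists>N F. open N \<and> \<phi> x \<in> N \<and> (\<forall>k. Ck_on k N F) \<and> (\<forall>y\<in>U. \<phi> y \<in> N \<longrightarrow> f y = F (\<phi> y))"
  shows "smooth_germ A x f"
  using assms by (auto simp: smooth_germ_def)

lemma smooth_germE:
  assumes "smooth_germ A x f" "(U, \<phi>) \<in> A" "x \<in> U"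
  obtains N F where "open N" "\<phi> x \<in> N" "\<And>k. Ck_on k N F" "\<And>y. y \<in> U \<Longrightarrow> \<phi> y \<in> N \<Longrightarrow> f y = F (\<phi> y)"
  using assms by (fastforce simp: smooth_germ_def)

lemma smooth_germ_const: "smooth_germ A x (\<lambda>y. c)"
  by (rule smooth_germI, rule exI[of _ UNIV]) (auto intro: Ck_on_const)

lemma smooth_germ_add:
  assumes "smooth_germ A x f" "smooth_germ A x g"
  shows "smooth_germ A x (\<lambda>y. f y + g y)"
proof (rule smooth_germI)
  fix U \<phi> assume U: "(U, \<phi>) \<in> A" "x \<in> U"
  obtain N F where N: "open N" "\<phi> x \<in> N" "\<And>k. Ck_on k N F" "\<And>y. y \<in> U \<Longrightarrow> \<phi> y \<in> N \<Longrightarrow> f y = F (\<phi> y)"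
    by (rule smooth_germE[OF assms(1) U]) blast
  obtain M H where M: "open M" "\<phi> x \<in> M" "\<And>k. Ck_on k M H" "\<And>y. y \<in> U \<Longrightarrow> \<phi> y \<in> M \<Longrightarrow> g y = H (\<phi> y)"
    by (rule smooth_germE[OF assms(2) U]) blast
  have "Ck_on k (N \<inter> M) (\<lambda>z. F z + H z)" for k
    using N M by (intro Ck_on_add) (auto intro: Ck_on_subset)
  then show "\<exists>N F. open N \<and> \<phi> x \<in> N \<and> (\<forall>k. Ck_on k N F) \<and> (\<forall>y\<in>U. \<phi> y \<in> N \<longrightarrow> f y + g y = F (\<phi> y))"
    using N M by (intro exI[of _ "N \<inter> M"] exI[of _ "\<lambda>z. F z + H z"]) auto
qed

lemma smooth_germ_bilinear:
  assumes "bounded_bilinear mul" "smooth_germ A x f" "smooth_germ A x g"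
  shows "smooth_germ A x (\<lambda>y. mul (f y) (g y))"
proof (rule smooth_germI)
  fix U \<phi> assume U: "(U, \<phi>) \<in> A" "x \<in> U"
  obtain N F where N: "open N" "\<phi> x \<in> N" "\<And>k. Ck_on k N F" "\<And>y. y \<in> U \<Longrightarrow> \<phi> y \<in> N \<Longrightarrow> f y = F (\<phi> y)"
    by (rule smooth_germE[OF assms(2) U]) blast
  obtain M H where M: "open M" "\<phi> x \<in> M" "\<And>k. Ck_on k M H" "\<And>y. y \<in> U \<Longrightarrow> \<phi> y \<in> M \<Longrightarrow> g y = H (\<phi> y)"
    by (rule smooth_germE[OF assms(3) U]) blast
  have "Ck_on k (N \<inter> M) (\<lambda>z. mul (F z) (H z))" for k
    using N M by (intro Ck_on_bilinear[OF _ assms(1)]) (auto intro: Ck_on_subset)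
  then show "\<exists>N F. open N \<and> \<phi> x \<in> N \<and> (\<forall>k. Ck_on k N F) \<and> (\<forall>y\<in>U. \<phi> y \<in> N \<longrightarrow> mul (f y) (g y) = F (\<phi> y))"
    using N M by (intro exI[of _ "N \<inter> M"] exI[of _ "\<lambda>z. mul (F z) (H z)"]) auto
qed

lemmas smooth_germ_mult = smooth_germ_bilinear[OF bounded_bilinear_mult]

lemma smooth_germ_minus:
  fixes f :: "'m::topological_space \<Rightarrow> 'r::real_normed_vector"
  assumes "smooth_germ A x f" shows "smooth_germ A x (\<lambda>y. - f y)"
  using smooth_germ_bilinear[OF bounded_bilinear_scaleR smooth_germ_const[of A x "-1"] assms] by simp

lemma smooth_germ_diff:
  fixes f :: "'m::topological_space \<Rightarrow> 'r::real_normed_vector"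
  assumes "smooth_germ A x f" "smooth_germ A x g" shows "smooth_germ A x (\<lambda>y. f y - g y)"
  using smooth_germ_add[OF assms(1) smooth_germ_minus[OF assms(2)]] by simp

lemma smooth_germ_sum:
  fixes f :: "'i \<Rightarrow> 'm::topological_space \<Rightarrow> 'r::real_normed_vector"
  assumes "\<And>i. i \<in> I \<Longrightarrow> smooth_germ A x (f i)"
  shows "smooth_germ A x (\<lambda>y. \<Sum>i\<in>I. f i y)"
  using assms by (induction I rule: infinite_finite_induct) (auto intro: smooth_germ_add smooth_germ_const)

lemma smooth_germ_inverse:
  fixes f :: "'m::topological_space \<Rightarrow> real"
  assumes "smooth_germ A x f" "f x \<noteq> 0"
  shows "smooth_germ A x (\<lambda>y. inverse (f y))"
proof (rule smooth_germI)
  fix U \<phi> assume U: "(U, \<phi>) \<in> A" "x \<in> U"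
  obtain N F where N: "open N" "\<phi> x \<in> N" "\<And>k. Ck_on k N F" "\<And>y. y \<in> U \<Longrightarrow> \<phi> y \<in> N \<Longrightarrow> f y = F (\<phi> y)"
    by (rule smooth_germE[OF assms(1) U]) blast
  let ?M = "N \<inter> F -` (- {0})"
  have "continuous_on N F" using N(3)[of 0] by simp
  then have o: "open ?M" by (rule continuous_open_preimage) (use N in auto)
  have "Ck_on k ?M (\<lambda>z. inverse (F z))" for k
    using N by (intro Ck_on_inverse[OF o]) (auto intro: Ck_on_subset)
  then show "\<exists>N F. open N \<and> \<phi> x \<in> N \<and> (\<forall>k. Ck_on k N F) \<and> (\<forall>y\<in>U. \<phi> y \<in> N \<longrightarrow> inverse (f y) = F (\<phi> y))"
    using N o U assms(2) by (intro exI[of _ ?M] exI[of _ "\<lambda>z. inverse (F z)"]) auto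
qed

lemma smooth_germ_flat_exp:
  assumes "smooth_germ A x f"
  shows "smooth_germ A x (\<lambda>y. flat_exp n (f y))"
proof (rule smooth_germI)
  fix U \<phi> assume U: "(U, \<phi>) \<in> A" "x \<in> U"
  obtain N F where N: "open N" "\<phi> x \<in> N" "\<And>k. Ck_on k N F" "\<And>y. y \<in> U \<Longrightarrow> \<phi> y \<in> N \<Longrightarrow> f y = F (\<phi> y)"
    by (rule smooth_germE[OF assms(1) U]) blast
  then show "\<exists>N F. open N \<and> \<phi> x \<in> N \<and> (\<forall>k. Ck_on k N F) \<and> (\<forall>y\<in>U. \<phi> y \<in> N \<longrightarrow> flat_exp n (f y) = F (\<phi> y))"
    by (intro exI[of _ N] exI[of _ "\<lambda>z. flat_exp n (F z)"]) (auto intro: Ck_on_flat_exp)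
qed

lemma smooth_manifold_chart:
  assumes "smooth_manifold A" "(U, \<phi>) \<in> A"
  shows "open U" "inj_on \<phi> U" "homeomorphism U (\<phi> ` U) \<phi> (inv_into U \<phi>)"
    and smooth_manifold_model: "\<exists>W. subspace W \<and> openin (top_of_set W) (\<phi> ` U)"
proof -
  obtain W where W: "subspace W" "\<forall>(U, \<phi>)\<in>A. open U \<and> inj_on \<phi> U \<and> openin (top_of_set W) (\<phi> ` U) \<and>
        homeomorphism U (\<phi> ` U) \<phi> (inv_into U \<phi>)"
    using assms(1) unfolding smooth_manifold_def by (elim conjE exE)
  from bspec[OF W(2) assms(2)] W(1)
  show "open U" "inj_on \<phi> U" "homeomorphism U (\<phi> ` U) \<phi> (inv_into U \<phi>)"
    "\<exists>W. subspace W \<and> openin (top_of_set W) (\<phi> ` U)"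
    by auto
qed

lemma smooth_manifold_covered:
  assumes "smooth_manifold A"
  obtains U \<phi> where "(U, \<phi>) \<in> A" "x \<in> U"
proof -
  have "x \<in> (\<Union>(U, \<phi>)\<in>A. U)" using assms by (simp add: smooth_manifold_def)
  then show ?thesis using that by auto
qed

lemma smooth_manifold_transition:
  assumes "smooth_manifold A" "(U, \<phi>) \<in> A" "(V, \<psi>) \<in> A"
  shows "smooth_on (\<phi> ` (U \<inter> V)) (\<psi> \<circ> inv_into U \<phi>)"
proof -
  have *: "\<forall>(U, \<phi>)\<in>A. \<forall>(V, \<psi>)\<in>A. smooth_on (\<phi> ` (U \<inter> V)) (\<psi> \<circ> inv_into U \<phi>)"
    using assms(1) unfolding smooth_manifold_def by (elim conjE)
  from bspec[OF * assms(2)] assms(3) show ?thesis by auto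
qed

text \<open>A chart image is open only in a linear subspace, so neighbourhoods in the manifold are written as
preimages of open sets of the ambient Euclidean space.\<close>

lemma chart_neighbourhood:
  assumes "smooth_manifold A" "(U, \<phi>) \<in> A" "open X" "x \<in> U" "x \<in> X"
  obtains N where "open N" "\<phi> x \<in> N" "\<And>y. y \<in> U \<Longrightarrow> \<phi> y \<in> N \<Longrightarrow> y \<in> X"
proof -
  note c = smooth_manifold_chart[OF assms(1,2)]
  have "openin (top_of_set U) (U \<inter> X)" using assms(3) by (auto simp: openin_open)
  then have "openin (top_of_set (\<phi> ` U)) (\<phi> ` (U \<inter> X))"
    by (rule homeomorphism_imp_open_map[OF c(3)])
  then obtain N where N: "open N" "\<phi> ` (U \<inter> X) = \<phi> ` U \<inter> N" by (auto simp: openin_open)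
  have "y \<in> X" if "y \<in> U" "\<phi> y \<in> N" for y
  proof -
    have "\<phi> y \<in> \<phi> ` (U \<inter> X)" using N that by auto
    then show ?thesis using c(2) that(1) by (auto dest: inj_onD)
  qed
  moreover have "\<phi> x \<in> N" using N assms by blast
  ultimately show ?thesis using that N by blast
qed

lemma smooth_germ_cong:
  assumes "smooth_manifold A" "eventually (\<lambda>y. f y = g y) (nhds x)" "smooth_germ A x f"
  shows "smooth_germ A x g"
proof (rule smooth_germI)
  fix U \<phi> assume U: "(U, \<phi>) \<in> A" "x \<in> U"
  obtain N F where N: "open N" "\<phi> x \<in> N" "\<And>k. Ck_on k N F" "\<And>y. y \<in> U \<Longrightarrow> \<phi> y \<in> N \<Longrightarrow> f y = F (\<phi> y)"
    by (rule smooth_germE[OF assms(3) U]) blast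
  obtain X where X: "open X" "x \<in> X" "\<And>y. y \<in> X \<Longrightarrow> f y = g y"
    using assms(2) by (auto simp: eventually_nhds)
  obtain M where M: "open M" "\<phi> x \<in> M" "\<And>y. y \<in> U \<Longrightarrow> \<phi> y \<in> M \<Longrightarrow> y \<in> X"
    by (rule chart_neighbourhood[OF assms(1) U(1) X(1) U(2) X(2)]) blast
  have "g y = F (\<phi> y)" if "y \<in> U" "\<phi> y \<in> N \<inter> M" for y
    using N(4)[of y] M(3)[of y] X(3)[of y] that by simp
  then show "\<exists>N F. open N \<and> \<phi> x \<in> N \<and> (\<forall>k. Ck_on k N F) \<and> (\<forall>y\<in>U. \<phi> y \<in> N \<longrightarrow> g y = F (\<phi> y))"
    using N M by (intro exI[of _ "N \<inter> M"] exI[of _ F]) (auto intro: Ck_on_subset)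
qed

lemma smooth_fun_on_iff_germ:
  assumes "smooth_manifold A" "open X"
  shows "smooth_fun_on A X f \<longleftrightarrow> (\<forall>x\<in>X. smooth_germ A x f)"
proof
  assume L: "smooth_fun_on A X f"
  show "\<forall>x\<in>X. smooth_germ A x f"
  proof (intro ballI smooth_germI)
    fix x U \<phi> assume x: "x \<in> X" "(U, \<phi>) \<in> A" "x \<in> U"
    have "smooth_on (\<phi> ` (X \<inter> U)) (f \<circ> inv_into U \<phi>)" "\<phi> x \<in> \<phi> ` (X \<inter> U)"
      using L x by (auto simp: smooth_fun_on_def)
    then obtain N F where N: "open N" "\<phi> x \<in> N" "\<And>k. Ck_on k N F"
      "\<And>z. z \<in> \<phi> ` (X \<inter> U) \<inter> N \<Longrightarrow> (f \<circ> inv_into U \<phi>) z = F z"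
      unfolding smooth_on_def by metis
    obtain M where M: "open M" "\<phi> x \<in> M" "\<And>y. y \<in> U \<Longrightarrow> \<phi> y \<in> M \<Longrightarrow> y \<in> X"
      by (rule chart_neighbourhood[OF assms(1) x(2) assms(2) x(3,1)]) blast
    have "f y = F (\<phi> y)" if "y \<in> U" "\<phi> y \<in> N \<inter> M" for y
      using N(4)[of "\<phi> y"] M(3)[of y] that smooth_manifold_chart(2)[OF assms(1) x(2)] by auto
    then show "\<exists>N F. open N \<and> \<phi> x \<in> N \<and> (\<forall>k. Ck_on k N F) \<and> (\<forall>y\<in>U. \<phi> y \<in> N \<longrightarrow> f y = F (\<phi> y))"
      using N M by (intro exI[of _ "N \<inter> M"] exI[of _ F]) (auto intro: Ck_on_subset)
  qed
next
  assume R: "\<forall>x\<in>X. smooth_germ A x f"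
  show "smooth_fun_on A X f"
    unfolding smooth_fun_on_def
  proof (safe)
    fix U \<phi> assume U: "(U, \<phi>) \<in> A"
    show "smooth_on (\<phi> ` (X \<inter> U)) (f \<circ> inv_into U \<phi>)"
      unfolding smooth_on_def
    proof (safe)
      fix x assume x: "x \<in> X" "x \<in> U"
      obtain N F where N: "open N" "\<phi> x \<in> N" "\<And>k. Ck_on k N F" "\<And>y. y \<in> U \<Longrightarrow> \<phi> y \<in> N \<Longrightarrow> f y = F (\<phi> y)"
        by (rule smooth_germE[OF bspec[OF R x(1)] U x(2)]) blast
      then show "\<exists>N F. open N \<and> \<phi> x \<in> N \<and> (\<forall>k. Ck_on k N F) \<and>
          (\<forall>y\<in>\<phi> ` (X \<inter> U) \<inter> N. (f \<circ> inv_into U \<phi>) y = F y)"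
        using smooth_manifold_chart(2)[OF assms(1) U] by (intro exI[of _ N] exI[of _ F]) auto
    qed
  qed
qed

lemma Cinf_iff_germ: "smooth_manifold A \<Longrightarrow> f \<in> Cinf A \<longleftrightarrow> (\<forall>x. smooth_germ A x f)"
  by (simp add: Cinf_def smooth_fun_on_iff_germ)

text \<open>This is the smoothness of the transition maps.\<close>

lemma smooth_germ_chart:
  assumes "smooth_manifold A" "(U, \<phi>) \<in> A" "x \<in> U"
  shows "smooth_germ A x \<phi>"
proof (rule smooth_germI)
  fix V \<psi> assume V: "(V, \<psi>) \<in> A" "x \<in> V"
  have "smooth_on (\<psi> ` (V \<inter> U)) (\<phi> \<circ> inv_into V \<psi>)" "\<psi> x \<in> \<psi> ` (V \<inter> U)"
    using smooth_manifold_transition[OF assms(1) V(1) assms(2)] assms(3) V by auto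
  then obtain N F where N: "open N" "\<psi> x \<in> N" "\<And>k. Ck_on k N F"
    "\<And>z. z \<in> \<psi> ` (V \<inter> U) \<inter> N \<Longrightarrow> (\<phi> \<circ> inv_into V \<psi>) z = F z"
    unfolding smooth_on_def by metis
  obtain M where M: "open M" "\<psi> x \<in> M" "\<And>y. y \<in> V \<Longrightarrow> \<psi> y \<in> M \<Longrightarrow> y \<in> U"
    by (rule chart_neighbourhood[OF assms(1) V(1) smooth_manifold_chart(1)[OF assms(1,2)] V(2) assms(3)]) blast
  have "\<phi> y = F (\<psi> y)" if "y \<in> V" "\<psi> y \<in> N \<inter> M" for y
    using N(4)[of "\<psi> y"] M(3)[of y] that smooth_manifold_chart(2)[OF assms(1) V(1)] by auto
  then show "\<exists>N F. open N \<and> \<psi> x \<in> N \<and> (\<forall>k. Ck_on k N F) \<and> (\<forall>y\<in>V. \<psi> y \<in> N \<longrightarrow> \<phi> y = F (\<psi> y))"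
    using N M by (intro exI[of _ "N \<inter> M"] exI[of _ F]) (auto intro: Ck_on_subset)
qed

text \<open>In a chart \<open>\<phi>\<close> around \<open>x\<close> the function is \<open>flat_exp 0 (r\<^sup>2 - |\<phi> y - \<phi> x|\<^sup>2)\<close>. Its support lies in the compact
preimage of a closed ball, which is closed in the Hausdorff manifold, so extension by zero is
smooth. A function that is merely non-zero at \<open>x\<close> is enough below, as one may divide by it near \<open>x\<close>.\<close>

lemma bump_function:
  fixes A :: "('m::{t2_space, second_countable_topology}, 'a::euclidean_space) atlas"
  assumes A: "smooth_manifold A" and X: "open X" "x \<in> X"
  obtains \<psi> K where "\<psi> \<in> Cinf A" "\<psi> x \<noteq> 0" "closed K" "K \<subseteq> X" "\<And>y. y \<notin> K \<Longrightarrow> \<psi> y = 0"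
proof -
  obtain U \<phi> where U: "(U, \<phi>) \<in> A" "x \<in> U"
    by (rule smooth_manifold_covered[OF A])
  note c = smooth_manifold_chart[OF A U(1)]
  obtain W where W: "subspace W" "openin (top_of_set W) (\<phi> ` U)"
    using smooth_manifold_model[OF A U(1)] by blast
  then obtain Q where Q: "open Q" "\<phi> ` U = W \<inter> Q" by (auto simp: openin_open)
  obtain N where N: "open N" "\<phi> x \<in> N" "\<And>y. y \<in> U \<Longrightarrow> \<phi> y \<in> N \<Longrightarrow> y \<in> X"
    by (rule chart_neighbourhood[OF A U(1) X(1) U(2) X(2)]) blast
  have "\<phi> x \<in> N \<inter> Q" "open (N \<inter> Q)" using N Q U by auto
  then obtain r where r: "r > 0" "cball (\<phi> x) r \<subseteq> N \<inter> Q" by (meson open_contains_cball)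
  define C where "C = W \<inter> cball (\<phi> x) r"
  define K where "K = inv_into U \<phi> ` C"
  have C: "compact C" "C \<subseteq> \<phi> ` U"
    using closed_subspace[OF W(1)] r Q by (auto simp: C_def intro: closed_Int_compact)
  then have "compact K"
    unfolding K_def using c(3) by (auto simp: homeomorphism_def intro: compact_continuous_image continuous_on_subset)
  then have "closed K" by (rule compact_imp_closed)
  have KU: "y \<in> U" "\<phi> y \<in> C" if "y \<in> K" for y
    using that C c(2) by (auto simp: K_def f_inv_into_f inv_into_into subsetD)
  have KX: "K \<subseteq> X"
  proof
    fix y assume "y \<in> K"
    then show "y \<in> X" using KU[of y] N(3)[of y] r(2) by (auto simp: C_def)
  qed
  define \<psi> where "\<psi> y = (if y \<in> U then flat_exp 0 (r\<^sup>2 - (\<phi> y - \<phi> x) \<bullet> (\<phi> y - \<phi> x)) else 0)" for y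
  have out: "\<psi> y = 0" if "y \<notin> K" for y
  proof (rule ccontr)
    assume n: "\<psi> y \<noteq> 0"
    then have y: "y \<in> U" by (auto simp: \<psi>_def split: if_splits)
    then have "(\<phi> y - \<phi> x) \<bullet> (\<phi> y - \<phi> x) < r\<^sup>2"
      using n by (auto simp: \<psi>_def flat_exp_def split: if_splits)
    then have "norm (\<phi> y - \<phi> x) < r"
      using r(1) by (simp add: power2_norm_eq_inner[symmetric] power2_less_imp_less)
    then have "\<phi> y \<in> C" using Q y by (auto simp: C_def dist_norm norm_minus_commute)
    then have "inv_into U \<phi> (\<phi> y) \<in> K" by (auto simp: K_def)
    then show False using that y c(2) by simp
  qed
  have "\<psi> \<in> Cinf A"
    unfolding Cinf_iff_germ[OF A]
  proof
    fix z
    show "smooth_germ A z \<psi>"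
    proof (cases "z \<in> U")
      case True
      have "smooth_germ A z (\<lambda>y. flat_exp 0 (r\<^sup>2 - (\<phi> y - \<phi> x) \<bullet> (\<phi> y - \<phi> x)))"
        by (intro smooth_germ_flat_exp smooth_germ_diff smooth_germ_const
            smooth_germ_bilinear[OF bounded_bilinear_inner] smooth_germ_chart[OF A U(1) True])
      then show ?thesis
        by (rule smooth_germ_cong[OF A, rotated])
          (use c(1) True in \<open>auto simp: eventually_nhds \<psi>_def\<close>)
    next
      case False
      then have "z \<in> - K" using KU by auto
      then have "eventually (\<lambda>y. 0 = \<psi> y) (nhds z)"
        using \<open>closed K\<close> out by (auto simp: eventually_nhds intro!: exI[of _ "- K"])
      then show ?thesis by (rule smooth_germ_cong[OF A]) (rule smooth_germ_const)
    qed
  qed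
  moreover have "\<psi> x \<noteq> 0" using U r by (simp add: \<psi>_def flat_exp_def)
  ultimately show ?thesis using that \<open>closed K\<close> KX out by blast
qed

text \<open>Gaussian elimination in the ring of germs at \<open>x\<close>: this ring is local, its units being the germs
  that do not vanish at \<open>x\<close>, so a system whose value at \<open>x\<close> has trivial kernel can be solved
  by pivoting on entries that are non-zero at \<open>x\<close>.\<close>

lemma smooth_germ_linear_system:
  fixes c :: "'j \<Rightarrow> 'm::{t2_space, second_countable_topology} \<Rightarrow> real"
  assumes A: "smooth_manifold A" and "finite J"
    and "\<And>i j. i \<in> I \<Longrightarrow> j \<in> J \<Longrightarrow> smooth_germ A x (M i j)"
    and "\<And>i. i \<in> I \<Longrightarrow> smooth_germ A x (d i)"
    and "\<And>i. i \<in> I \<Longrightarrow> eventually (\<lambda>y. (\<Sum>j\<in>J. M i j y * c j y) = d i y) (nhds x)"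
    and "\<And>z. (\<And>i. i \<in> I \<Longrightarrow> (\<Sum>j\<in>J. M i j x * z j) = 0) \<Longrightarrow> (\<And>j. j \<in> J \<Longrightarrow> z j = 0)"
    and "j \<in> J"
  shows "smooth_germ A x (c j)"
  using assms(2-)
proof (induction J arbitrary: M d j rule: finite_induct)
  case empty then show ?case by simp
next
  case (insert j0 J)
  note M = insert.prems(1) and d = insert.prems(2) and eq = insert.prems(3) and ker = insert.prems(4)
  obtain i0 where i0: "i0 \<in> I" "M i0 j0 x \<noteq> 0"
  proof (rule ccontr)
    assume "\<not> thesis"
    with that have *: "M i j0 x = 0" if "i \<in> I" for i using \<open>i \<in> I\<close> by blast
    let ?z = "\<lambda>j. if j = j0 then 1 else 0 :: real"
    have "(\<Sum>j\<in>insert j0 J. M i j x * ?z j) = 0" if "i \<in> I" for i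
      using * insert.hyps that by (auto intro!: sum.neutral)
    from ker[OF this, of j0] show False by simp
  qed
  define p where "p y = inverse (M i0 j0 y)" for y
  have p: "smooth_germ A x p"
    unfolding p_def using M[of i0 j0] i0 by (auto intro: smooth_germ_inverse)
  have pnz: "eventually (\<lambda>y. p y * M i0 j0 y = 1) (nhds x)"
  proof -
    obtain U \<phi> where U: "(U, \<phi>) \<in> A" "x \<in> U"
      by (rule smooth_manifold_covered[OF A])
    note c = smooth_manifold_chart[OF A U(1)]
    obtain N F where N: "open N" "\<phi> x \<in> N" "\<And>k. Ck_on k N F" "\<And>y. y \<in> U \<Longrightarrow> \<phi> y \<in> N \<Longrightarrow> M i0 j0 y = F (\<phi> y)"
      by (rule smooth_germE[OF M[of i0 j0] U]) (use i0 in auto)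
    have "continuous_on N F" using N(3)[of 0] by simp
    then have o: "open (N \<inter> F -` (- {0}))" by (rule continuous_open_preimage) (use N in auto)
    have "continuous_on U \<phi>" using c(3) by (simp add: homeomorphism_def)
    then have "open (U \<inter> \<phi> -` (N \<inter> F -` (- {0})))"
      by (rule continuous_open_preimage) (use c o in auto)
    moreover have "x \<in> U \<inter> \<phi> -` (N \<inter> F -` (- {0}))" using N(2) N(4)[of x] U i0 by auto
    ultimately show ?thesis
      unfolding eventually_nhds
      by (intro exI[of _ "U \<inter> \<phi> -` (N \<inter> F -` (- {0}))"]) (auto simp: p_def N(4))
  qed
  define M' where "M' i j y = M i j y - M i j0 y * p y * M i0 j y" for i j y
  define d' where "d' i y = d i y - M i j0 y * p y * d i0 y" for i y
  \<comment> \<open>solving row \<open>i0\<close> for the unknown \<open>c j0\<close>; \<open>M'\<close>, \<open>d'\<close> is the system after its elimination\<close>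
  have pivot: "eventually (\<lambda>y. c j0 y = p y * (d i0 y - (\<Sum>j\<in>J. M i0 j y * c j y))) (nhds x)"
    using pnz eq[OF i0(1)]
  proof eventually_elim
    case (elim y)
    then have "p y * (d i0 y - (\<Sum>j\<in>J. M i0 j y * c j y)) = p y * (M i0 j0 y * c j0 y)"
      using insert.hyps by (simp flip: elim(2))
    then show ?case using elim(1) by (simp flip: mult.assoc)
  qed
  have J: "smooth_germ A x (c j)" if "j \<in> J" for j
  proof (rule insert.IH[of M' d'])
    show "smooth_germ A x (M' i j)" if "i \<in> I" "j \<in> J" for i j
      unfolding M'_def using that i0 by (intro smooth_germ_diff smooth_germ_mult p M) auto
    show "smooth_germ A x (d' i)" if "i \<in> I" for i
      unfolding d'_def using that i0 by (intro smooth_germ_diff smooth_germ_mult p M d) auto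
    show "eventually (\<lambda>y. (\<Sum>j\<in>J. M' i j y * c j y) = d' i y) (nhds x)" if i: "i \<in> I" for i
      using pivot eq[OF i]
    proof eventually_elim
      case (elim y)
      have "(\<Sum>j\<in>J. M' i j y * c j y) = (\<Sum>j\<in>J. M i j y * c j y) - M i j0 y * p y * (\<Sum>j\<in>J. M i0 j y * c j y)"
        by (simp add: M'_def left_diff_distrib sum_subtractf sum_distrib_left mult.assoc)
      moreover have "(\<Sum>j\<in>J. M i j y * c j y) = d i y - M i j0 y * c j0 y"
        using elim(2) insert.hyps by simp
      ultimately show ?case by (subst (asm) elim(1)) (simp add: d'_def algebra_simps)
    qed
    show "z j = 0" if z: "\<And>i. i \<in> I \<Longrightarrow> (\<Sum>j\<in>J. M' i j x * z j) = 0" and j: "j \<in> J" for z j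
    proof -
      \<comment> \<open>a kernel vector of the eliminated system extends to one of the original system\<close>
      define z' where "z' = z(j0 := - p x * (\<Sum>j\<in>J. M i0 j x * z j))"
      have "(\<Sum>j\<in>insert j0 J. M i j x * z' j) = 0" if "i \<in> I" for i
      proof -
        have "(\<Sum>j\<in>J. M i j x * z' j) = (\<Sum>j\<in>J. M i j x * z j)"
          using insert.hyps by (intro sum.cong) (auto simp: z'_def)
        then have "(\<Sum>j\<in>insert j0 J. M i j x * z' j) = (\<Sum>j\<in>J. M' i j x * z j)"
          using insert.hyps
          by (simp add: M'_def z'_def left_diff_distrib sum_subtractf sum_distrib_left sum_negf mult.assoc)
        then show ?thesis using z[OF that] by simp
      qed
      from ker[OF this, of j] j have "z' j = 0" by simp
      moreover have "j \<noteq> j0" using j insert.hyps by auto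
      ultimately show "z j = 0" by (simp add: z'_def)
    qed
  qed (rule that)
  have "smooth_germ A x (c j0)"
    by (rule smooth_germ_cong[OF A eventually_mono[OF pivot]])
      (auto intro!: smooth_germ_mult smooth_germ_diff smooth_germ_sum p M d J i0)
  then show ?case using J insert.prems(5) by auto
qed

section \<open>Smooth sections of vector bundles\<close>

lemma basis_family_coefficients:
  assumes "basis_family k e V" "v \<in> V"
  obtains c where "v = (\<Sum>i<k. c i *\<^sub>R e i)"
proof -
  have "v \<in> span (e ` {..<k})" using assms by (simp add: basis_family_def)
  then obtain u where "v = (\<Sum>w\<in>e ` {..<k}. u w *\<^sub>R w)"
    by (auto simp: span_finite)
  also have "\<dots> = (\<Sum>i<k. u (e i) *\<^sub>R e i)"
    using assms by (simp add: basis_family_def sum.reindex)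
  finally show ?thesis by (rule that)
qed

lemma basis_family_zero:
  assumes "basis_family k e V" "(\<Sum>i<k. z i *\<^sub>R e i) = 0" "i < k"
  shows "z i = 0"
proof -
  have inj: "inj_on e {..<k}" and ind: "independent (e ` {..<k})"
    using assms by (auto simp: basis_family_def)
  let ?u = "z \<circ> inv_into {..<k} e"
  have "(\<Sum>w\<in>e ` {..<k}. ?u w *\<^sub>R w) = (\<Sum>i<k. z i *\<^sub>R e i)"
    using inj by (simp add: sum.reindex)
  then have "?u (e i) = 0"
    using independentD[OF ind, of "e ` {..<k}" ?u "e i"] assms by auto
  then show ?thesis using inj assms by simp
qed

lemma basis_family_unique:
  assumes "basis_family k e V" "(\<Sum>i<k. c i *\<^sub>R e i) = (\<Sum>i<k. c' i *\<^sub>R e i)" "i < k"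
  shows "c i = c' i"
  using basis_family_zero[OF assms(1), of "\<lambda>i. c i - c' i"] assms
  by (simp add: scaleR_left_diff_distrib sum_subtractf)

text \<open>The pointwise form of smoothness of sections, which can be checked near each point separately.\<close>

definition section_germ ::
  "('m::topological_space, 'a::euclidean_space, 'v::real_vector) courant \<Rightarrow> 'm \<Rightarrow> ('m \<Rightarrow> 'v) \<Rightarrow> bool" where
  "section_germ E x s \<longleftrightarrow> (\<forall>(V, k, e)\<in>frames E. x \<in> V \<longrightarrow>
     (\<exists>c. (\<forall>i<k. smooth_germ (atlas E) x (c i)) \<and>
          eventually (\<lambda>y. s y = (\<Sum>i<k. c i y *\<^sub>R e i y)) (nhds x)))"

lemma section_germI:
  assumes "\<And>V k e. (V, k, e) \<in> frames E \<Longrightarrow> x \<in> V \<Longrightarrow>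
     (\<exists>c. (\<forall>i<k. smooth_germ (atlas E) x (c i)) \<and>
          eventually (\<lambda>y. s y = (\<Sum>i<k. c i y *\<^sub>R e i y)) (nhds x))"
  shows "section_germ E x s"
  using assms by (auto simp: section_germ_def)

lemma section_germE:
  assumes "section_germ E x s" "(V, k, e) \<in> frames E" "x \<in> V"
  obtains c where "\<And>i. i < k \<Longrightarrow> smooth_germ (atlas E) x (c i)"
    "eventually (\<lambda>y. s y = (\<Sum>i<k. c i y *\<^sub>R e i y)) (nhds x)"
proof -
  have "\<exists>c. (\<forall>i<k. smooth_germ (atlas E) x (c i)) \<and>
          eventually (\<lambda>y. s y = (\<Sum>i<k. c i y *\<^sub>R e i y)) (nhds x)"
    using bspec[OF assms(1)[unfolded section_germ_def] assms(2)] assms(3) by simp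
  then show ?thesis using that by blast
qed

lemma section_germ_cong:
  assumes "eventually (\<lambda>y. s y = t y) (nhds x)" "section_germ E x s"
  shows "section_germ E x t"
proof (rule section_germI)
  fix V k e assume f: "(V, k, e) \<in> frames E" "x \<in> V"
  obtain c where c: "\<And>i. i < k \<Longrightarrow> smooth_germ (atlas E) x (c i)"
    "eventually (\<lambda>y. s y = (\<Sum>i<k. c i y *\<^sub>R e i y)) (nhds x)"
    by (rule section_germE[OF assms(2) f]) blast
  have "eventually (\<lambda>y. t y = (\<Sum>i<k. c i y *\<^sub>R e i y)) (nhds x)"
    using assms(1) c(2) by eventually_elim simp
  with c(1) show "\<exists>c. (\<forall>i<k. smooth_germ (atlas E) x (c i)) \<and>
      eventually (\<lambda>y. t y = (\<Sum>i<k. c i y *\<^sub>R e i y)) (nhds x)" by blast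
qed

lemma section_germ_zero: "section_germ E x (\<lambda>y. 0)"
  by (rule section_germI, rule exI[of _ "\<lambda>i y. 0"]) (auto intro: smooth_germ_const)

lemma section_germ_add:
  assumes "section_germ E x s" "section_germ E x t"
  shows "section_germ E x (\<lambda>y. s y + t y)"
proof (rule section_germI)
  fix V k e assume f: "(V, k, e) \<in> frames E" "x \<in> V"
  obtain c where c: "\<And>i. i < k \<Longrightarrow> smooth_germ (atlas E) x (c i)"
    "eventually (\<lambda>y. s y = (\<Sum>i<k. c i y *\<^sub>R e i y)) (nhds x)"
    by (rule section_germE[OF assms(1) f]) blast
  obtain d where d: "\<And>i. i < k \<Longrightarrow> smooth_germ (atlas E) x (d i)"
    "eventually (\<lambda>y. t y = (\<Sum>i<k. d i y *\<^sub>R e i y)) (nhds x)"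
    by (rule section_germE[OF assms(2) f]) blast
  have "eventually (\<lambda>y. s y + t y = (\<Sum>i<k. (c i y + d i y) *\<^sub>R e i y)) (nhds x)"
    using c(2) d(2) by eventually_elim (simp add: scaleR_left_distrib sum.distrib)
  with c(1) d(1) show "\<exists>c. (\<forall>i<k. smooth_germ (atlas E) x (c i)) \<and>
      eventually (\<lambda>y. s y + t y = (\<Sum>i<k. c i y *\<^sub>R e i y)) (nhds x)"
    by (intro exI[of _ "\<lambda>i y. c i y + d i y"]) (auto intro: smooth_germ_add)
qed

lemma section_germ_scale:
  assumes "smooth_germ (atlas E) x f" "section_germ E x s"
  shows "section_germ E x (\<lambda>y. f y *\<^sub>R s y)"
proof (rule section_germI)
  fix V k e assume f: "(V, k, e) \<in> frames E" "x \<in> V"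
  obtain c where c: "\<And>i. i < k \<Longrightarrow> smooth_germ (atlas E) x (c i)"
    "eventually (\<lambda>y. s y = (\<Sum>i<k. c i y *\<^sub>R e i y)) (nhds x)"
    by (rule section_germE[OF assms(2) f]) blast
  have "eventually (\<lambda>y. f y *\<^sub>R s y = (\<Sum>i<k. (f y * c i y) *\<^sub>R e i y)) (nhds x)"
    using c(2) by eventually_elim (simp add: scaleR_sum_right)
  with c(1) show "\<exists>c. (\<forall>i<k. smooth_germ (atlas E) x (c i)) \<and>
      eventually (\<lambda>y. f y *\<^sub>R s y = (\<Sum>i<k. c i y *\<^sub>R e i y)) (nhds x)"
    using assms(1) by (intro exI[of _ "\<lambda>i y. f y * c i y"]) (auto intro: smooth_germ_mult)
qed

lemma section_germ_sum:
  assumes "\<And>i. i \<in> I \<Longrightarrow> section_germ E x (s i)"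
  shows "section_germ E x (\<lambda>y. \<Sum>i\<in>I. s i y)"
  using assms by (induction I rule: infinite_finite_induct) (auto intro: section_germ_add section_germ_zero)

locale smooth_bundle =
  fixes E :: "('m::{t2_space, second_countable_topology}, 'a::euclidean_space, 'v::real_vector) courant"
  assumes manifold: "smooth_manifold (atlas E)" and vbundle: "vector_bundle E"
begin

lemma subspace_fibre: "subspace (fibre E x)"
  using vbundle by (simp add: vector_bundle_def)

lemma frame_exists:
  obtains V k e where "(V, k, e) \<in> frames E" "x \<in> V"
proof -
  have "x \<in> (\<Union>(U, k, e)\<in>frames E. U)" using vbundle by (simp add: vector_bundle_def)
  then show ?thesis using that by auto
qed

lemma frameD:
  assumes "(V, k, e) \<in> frames E"
  shows "open V" "\<And>x. x \<in> V \<Longrightarrow> basis_family k (\<lambda>i. e i x) (fibre E x)"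
    "\<And>i. i < k \<Longrightarrow> smooth_section_on E V (e i)"
proof -
  have "\<forall>(U, k, e)\<in>frames E. open U \<and> (\<forall>x\<in>U. basis_family k (\<lambda>i. e i x) (fibre E x)) \<and>
        (\<forall>i<k. smooth_section_on E U (e i))"
    using vbundle by (simp add: vector_bundle_def)
  from bspec[OF this assms]
  show "open V" "\<And>x. x \<in> V \<Longrightarrow> basis_family k (\<lambda>i. e i x) (fibre E x)"
    "\<And>i. i < k \<Longrightarrow> smooth_section_on E V (e i)" by auto
qed

text \<open>Coefficients found near different points glue, since the coefficients in a frame are unique.\<close>

lemma smooth_section_on_iff_germ:
  assumes "open U"
  shows "smooth_section_on E U s \<longleftrightarrow> (\<forall>x\<in>U. s x \<in> fibre E x \<and> section_germ E x s)"
proof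
  assume L: "smooth_section_on E U s"
  show "\<forall>x\<in>U. s x \<in> fibre E x \<and> section_germ E x s"
  proof (intro ballI conjI section_germI)
    show "s x \<in> fibre E x" if "x \<in> U" for x using L that by (simp add: smooth_section_on_def)
    fix x V k e assume x: "x \<in> U" "(V, k, e) \<in> frames E" "x \<in> V"
    have o: "open (U \<inter> V)" using frameD(1)[OF x(2)] assms by auto
    have *: "\<forall>(V, k, e)\<in>frames E. \<exists>c. (\<forall>i<k. smooth_fun_on (atlas E) (U \<inter> V) (c i)) \<and>
        (\<forall>x\<in>U \<inter> V. s x = (\<Sum>i<k. c i x *\<^sub>R e i x))"
      using L by (simp add: smooth_section_on_def)
    from bspec[OF * x(2)] obtain c where c: "\<forall>i<k. smooth_fun_on (atlas E) (U \<inter> V) (c i)"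
        "\<forall>x\<in>U \<inter> V. s x = (\<Sum>i<k. c i x *\<^sub>R e i x)" by auto
    have "eventually (\<lambda>y. s y = (\<Sum>i<k. c i y *\<^sub>R e i y)) (nhds x)"
      using c(2) o x by (auto simp: eventually_nhds)
    moreover have "\<forall>i<k. smooth_germ (atlas E) x (c i)"
      using c(1) x by (simp add: smooth_fun_on_iff_germ[OF manifold o])
    ultimately show "\<exists>c. (\<forall>i<k. smooth_germ (atlas E) x (c i)) \<and>
      eventually (\<lambda>y. s y = (\<Sum>i<k. c i y *\<^sub>R e i y)) (nhds x)" by blast
  qed
next
  assume R: "\<forall>x\<in>U. s x \<in> fibre E x \<and> section_germ E x s"
  have "\<exists>c. (\<forall>i<k. smooth_fun_on (atlas E) (U \<inter> V) (c i)) \<and>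
        (\<forall>x\<in>U \<inter> V. s x = (\<Sum>i<k. c i x *\<^sub>R e i x))" if f: "(V, k, e) \<in> frames E" for V k e
  proof -
    have o: "open (U \<inter> V)" using frameD(1)[OF f] assms by auto
    have "\<exists>c. s x = (\<Sum>i<k. c i *\<^sub>R e i x)" if "x \<in> U \<inter> V" for x
      using basis_family_coefficients[OF frameD(2)[OF f, of x], of "s x"] R that by (metis IntE)
    then obtain c where c: "\<And>x. x \<in> U \<inter> V \<Longrightarrow> s x = (\<Sum>i<k. c x i *\<^sub>R e i x)" by metis
    have "smooth_germ (atlas E) x (\<lambda>x. c x i)" if i: "i < k" and x: "x \<in> U \<inter> V" for i x
    proof -
      obtain d where d: "\<And>i. i < k \<Longrightarrow> smooth_germ (atlas E) x (d i)"
          "eventually (\<lambda>y. s y = (\<Sum>i<k. d i y *\<^sub>R e i y)) (nhds x)"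
        by (rule section_germE[of E x s V k e]) (use R x f in auto)
      have "eventually (\<lambda>y. y \<in> U \<inter> V) (nhds x)" using o x by (intro eventually_nhds_in_open) auto
      with d(2) have "eventually (\<lambda>y. d i y = c y i) (nhds x)"
      proof eventually_elim
        case (elim y)
        then show ?case
          using basis_family_unique[OF frameD(2)[OF f, of y], of "\<lambda>i. d i y" "c y" i] c[of y] i by auto
      qed
      then show ?thesis by (rule smooth_germ_cong[OF manifold]) (rule d(1)[OF i])
    qed
    then show ?thesis
      using c by (intro exI[of _ "\<lambda>i x. c x i"]) (auto simp: smooth_fun_on_iff_germ[OF manifold o])
  qed
  then show "smooth_section_on E U s" using R by (auto simp: smooth_section_on_def)
qed

lemma Sec_iff: "s \<in> Sec E V \<longleftrightarrow> (\<forall>x. s x \<in> V x \<and> s x \<in> fibre E x \<and> section_germ E x s)"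
  by (auto simp: Sec_def smooth_section_on_iff_germ)

lemma Cinf_iff: "f \<in> Cinf (atlas E) \<longleftrightarrow> (\<forall>x. smooth_germ (atlas E) x f)"
  by (rule Cinf_iff_germ[OF manifold])

lemma Cinf_const: "(\<lambda>x. c) \<in> Cinf (atlas E)"
  by (simp add: Cinf_iff smooth_germ_const)

lemma Sec_zero: "(\<And>x. subspace (V x)) \<Longrightarrow> (\<lambda>x. 0) \<in> Sec E V"
  by (simp add: Sec_iff subspace_0 subspace_fibre section_germ_zero)

lemma Sec_add:
  assumes "\<And>x. subspace (V x)" "s \<in> Sec E V" "t \<in> Sec E V"
  shows "(\<lambda>x. s x + t x) \<in> Sec E V"
  using assms by (auto simp: Sec_iff intro: subspace_add subspace_fibre section_germ_add)

lemma Sec_scale: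
  assumes "\<And>x. subspace (V x)" "f \<in> Cinf (atlas E)" "s \<in> Sec E V"
  shows "(\<lambda>x. f x *\<^sub>R s x) \<in> Sec E V"
  using assms by (auto simp: Sec_iff Cinf_iff intro: subspace_scale subspace_fibre section_germ_scale)

lemma Sec_scale_const:
  assumes "\<And>x. subspace (V x)" "s \<in> Sec E V"
  shows "(\<lambda>x. c *\<^sub>R s x) \<in> Sec E V"
  using Sec_scale[OF assms(1) Cinf_const assms(2)] .

lemma Sec_diff:
  assumes "\<And>x. subspace (V x)" "s \<in> Sec E V" "t \<in> Sec E V"
  shows "(\<lambda>x. s x - t x) \<in> Sec E V"
  using Sec_add[OF assms(1,2) Sec_scale_const[OF assms(1,3), of "-1"]] by simp

lemma Sec_sum:
  assumes "\<And>x. subspace (V x)" "\<And>i. i \<in> I \<Longrightarrow> s i \<in> Sec E V"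
  shows "(\<lambda>x. \<Sum>i\<in>I. s i x) \<in> Sec E V"
  using assms by (auto simp: Sec_iff intro: subspace_sum subspace_fibre section_germ_sum)

text \<open>Local sections become global after multiplication by a bump function. This is how the axioms of a
Courant algebroid, which speak of global sections only, are applied to local frames.\<close>

lemma bump_extension:
  assumes "open U" "x \<in> U"
  obtains \<psi> where "\<psi> \<in> Cinf (atlas E)" "\<psi> x \<noteq> 0"
    "\<And>s. smooth_section_on E U s \<Longrightarrow> (\<lambda>y. \<psi> y *\<^sub>R s y) \<in> \<Gamma> E"
proof -
  obtain \<psi> K where \<psi>: "\<psi> \<in> Cinf (atlas E)" "\<psi> x \<noteq> 0" "closed K" "K \<subseteq> U" "\<And>y. y \<notin> K \<Longrightarrow> \<psi> y = 0"
    using bump_function[OF manifold assms] by blast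
  have "(\<lambda>y. \<psi> y *\<^sub>R s y) \<in> \<Gamma> E" if s: "smooth_section_on E U s" for s
  proof -
    have "\<psi> y *\<^sub>R s y \<in> fibre E y \<and> section_germ E y (\<lambda>y. \<psi> y *\<^sub>R s y)" for y
    proof (cases "y \<in> U")
      case True
      then show ?thesis
        using s \<psi>(1) by (auto simp: smooth_section_on_iff_germ[OF assms(1)] Cinf_iff
            intro: section_germ_scale subspace_scale subspace_fibre)
    next
      case False
      then have "eventually (\<lambda>y. 0 = \<psi> y *\<^sub>R s y) (nhds y)"
        using \<psi> by (auto simp: eventually_nhds intro!: exI[of _ "- K"])
      then have "section_germ E y (\<lambda>y. \<psi> y *\<^sub>R s y)"
        by (rule section_germ_cong) (rule section_germ_zero)
      moreover have "\<psi> y = 0" using False \<psi> by auto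
      ultimately show ?thesis by (simp add: subspace_0 subspace_fibre)
    qed
    then show ?thesis by (simp add: Sec_iff)
  qed
  then show ?thesis using that \<psi> by blast
qed

lemma section_through:
  assumes "v \<in> fibre E x"
  obtains t where "t \<in> \<Gamma> E" "t x = v"
proof -
  obtain V k e where f: "(V, k, e) \<in> frames E" "x \<in> V" by (rule frame_exists)
  obtain \<psi> where \<psi>: "\<psi> x \<noteq> 0" "\<And>s. smooth_section_on E V s \<Longrightarrow> (\<lambda>y. \<psi> y *\<^sub>R s y) \<in> \<Gamma> E"
    using bump_extension[OF frameD(1)[OF f(1)] f(2)] by blast
  obtain c where c: "v = (\<Sum>i<k. c i *\<^sub>R e i x)"
    using basis_family_coefficients[OF frameD(2)[OF f] assms] by blast
  have "(\<lambda>y. \<Sum>i<k. (c i / \<psi> x) *\<^sub>R (\<psi> y *\<^sub>R e i y)) \<in> \<Gamma> E"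
    by (intro Sec_sum Sec_scale_const subspace_fibre \<psi>(2) frameD(3)[OF f(1)]) auto
  then show ?thesis using that[of "\<lambda>y. \<Sum>i<k. (c i / \<psi> x) *\<^sub>R (\<psi> y *\<^sub>R e i y)"] c \<psi>(1) by simp
qed

text \<open>Written in a frame of the bundle, the equation \<open>w = \<Sum>\<^sub>j c\<^sub>j s\<^sub>j\<close> is a linear system for the functions \<open>c\<^sub>j\<close> with
smooth coefficients, and linear independence of the \<open>s\<^sub>j\<close> at \<open>x\<close> says that its kernel at \<open>x\<close> is trivial.\<close>

lemma smooth_coefficients:
  assumes "finite J" "\<And>j. j \<in> J \<Longrightarrow> section_germ E x (s j)" "section_germ E x w"
    and "eventually (\<lambda>y. w y = (\<Sum>j\<in>J. c j y *\<^sub>R s j y)) (nhds x)"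
    and "\<And>z. (\<Sum>j\<in>J. z j *\<^sub>R s j x) = 0 \<Longrightarrow> (\<And>j. j \<in> J \<Longrightarrow> z j = 0)"
    and "j \<in> J"
  shows "smooth_germ (atlas E) x (c j)"
proof -
  obtain V k e where f: "(V, k, e) \<in> frames E" "x \<in> V" by (rule frame_exists)
  obtain d where d: "\<And>i. i < k \<Longrightarrow> smooth_germ (atlas E) x (d i)"
      "eventually (\<lambda>y. w y = (\<Sum>i<k. d i y *\<^sub>R e i y)) (nhds x)"
    by (rule section_germE[OF assms(3) f]) blast
  have "\<forall>j\<in>J. \<exists>m. (\<forall>i<k. smooth_germ (atlas E) x (m i)) \<and>
      eventually (\<lambda>y. s j y = (\<Sum>i<k. m i y *\<^sub>R e i y)) (nhds x)"
  proof
    fix j assume "j \<in> J"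
    note j = assms(2)[OF this]
    obtain m where "\<And>i. i < k \<Longrightarrow> smooth_germ (atlas E) x (m i)"
        "eventually (\<lambda>y. s j y = (\<Sum>i<k. m i y *\<^sub>R e i y)) (nhds x)"
      by (rule section_germE[OF j f]) blast
    then show "\<exists>m. (\<forall>i<k. smooth_germ (atlas E) x (m i)) \<and>
      eventually (\<lambda>y. s j y = (\<Sum>i<k. m i y *\<^sub>R e i y)) (nhds x)" by blast
  qed
  from bchoice[OF this] obtain m where
      "\<forall>j\<in>J. (\<forall>i<k. smooth_germ (atlas E) x (m j i)) \<and>
        eventually (\<lambda>y. s j y = (\<Sum>i<k. m j i y *\<^sub>R e i y)) (nhds x)"
    by blast
  then have m: "\<And>j i. j \<in> J \<Longrightarrow> i < k \<Longrightarrow> smooth_germ (atlas E) x (m j i)"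
      "\<And>j. j \<in> J \<Longrightarrow> eventually (\<lambda>y. s j y = (\<Sum>i<k. m j i y *\<^sub>R e i y)) (nhds x)"
    by auto
  have sum: "(\<Sum>j\<in>J. z j *\<^sub>R (\<Sum>i<k. m j i y *\<^sub>R e i y)) = (\<Sum>i<k. (\<Sum>j\<in>J. m j i y * z j) *\<^sub>R e i y)" for z y
    by (simp add: scaleR_sum_right scaleR_sum_left mult.commute sum.swap[of _ J])
  have V: "eventually (\<lambda>y. y \<in> V) (nhds x)" using frameD(1)[OF f(1)] f(2) by (simp add: eventually_nhds_in_open)
  have s: "eventually (\<lambda>y. \<forall>j\<in>J. s j y = (\<Sum>i<k. m j i y *\<^sub>R e i y)) (nhds x)"
    using m(2) by (intro eventually_ball_finite assms(1)) auto
  show ?thesis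
  proof (rule smooth_germ_linear_system[OF manifold assms(1), of "{..<k}" x "\<lambda>i j. m j i" d c])
    fix i assume i: "i \<in> {..<k}"
    show "eventually (\<lambda>y. (\<Sum>j\<in>J. m j i y * c j y) = d i y) (nhds x)"
      using V s d(2) assms(4)
    proof eventually_elim
      case (elim y)
      have "(\<Sum>i<k. d i y *\<^sub>R e i y) = (\<Sum>j\<in>J. c j y *\<^sub>R s j y)" using elim by simp
      also have "\<dots> = (\<Sum>j\<in>J. c j y *\<^sub>R (\<Sum>i<k. m j i y *\<^sub>R e i y))"
        using elim(2) by (intro sum.cong) auto
      finally have "(\<Sum>i<k. (\<Sum>j\<in>J. m j i y * c j y) *\<^sub>R e i y) = (\<Sum>i<k. d i y *\<^sub>R e i y)"
        by (simp only: sum)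
      from basis_family_unique[OF frameD(2)[OF f(1) elim(1)] this] i show ?case by simp
    qed
  next
    fix z j assume z: "\<And>i. i \<in> {..<k} \<Longrightarrow> (\<Sum>j\<in>J. m j i x * z j) = 0" and j: "j \<in> J"
    have "(\<Sum>j\<in>J. z j *\<^sub>R s j x) = (\<Sum>j\<in>J. z j *\<^sub>R (\<Sum>i<k. m j i x *\<^sub>R e i x))"
      using eventually_nhds_x_imp_x[OF s] by (intro sum.cong) auto
    also have "\<dots> = 0" using z by (simp only: sum) simp
    finally show "z j = 0" by (rule assms(5)) (rule j)
  qed (auto simp: m(1) d(1) assms(6))
qed

end

section \<open>Symmetric bilinear forms on subspaces\<close>

definition symmetric_form :: "'v::real_vector set \<Rightarrow> ('v \<Rightarrow> 'v \<Rightarrow> real) \<Rightarrow> bool" where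
  "symmetric_form F B \<longleftrightarrow> subspace F \<and> (\<forall>v\<in>F. lin_on F (B v)) \<and> (\<forall>v\<in>F. \<forall>w\<in>F. B v w = B w v)"

lemma symmetric_formD:
  assumes "symmetric_form F B"
  shows "subspace F"
    and "u \<in> F \<Longrightarrow> v \<in> F \<Longrightarrow> B u v = B v u"
    and "u \<in> F \<Longrightarrow> v \<in> F \<Longrightarrow> w \<in> F \<Longrightarrow> B u (v + w) = B u v + B u w"
    and "u \<in> F \<Longrightarrow> v \<in> F \<Longrightarrow> w \<in> F \<Longrightarrow> B (u + v) w = B u w + B v w"
    and "u \<in> F \<Longrightarrow> v \<in> F \<Longrightarrow> B u (c *\<^sub>R v) = c * B u v"
    and "u \<in> F \<Longrightarrow> v \<in> F \<Longrightarrow> B (c *\<^sub>R u) v = c * B u v"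
    and "u \<in> F \<Longrightarrow> v \<in> F \<Longrightarrow> w \<in> F \<Longrightarrow> B u (v - w) = B u v - B u w"
    and "u \<in> F \<Longrightarrow> v \<in> F \<Longrightarrow> w \<in> F \<Longrightarrow> B (u - v) w = B u w - B v w"
    and "u \<in> F \<Longrightarrow> B u 0 = 0"
    and "u \<in> F \<Longrightarrow> B 0 u = 0"
proof -
  show F: "subspace F" using assms by (simp add: symmetric_form_def)
  have sym: "B u v = B v u" if "u \<in> F" "v \<in> F" for u v
    using assms that by (simp add: symmetric_form_def)
  have add: "B u (v + w) = B u v + B u w" if "u \<in> F" "v \<in> F" "w \<in> F" for u v w
    using assms that by (simp add: symmetric_form_def lin_on_def)
  have scale: "B u (c *\<^sub>R v) = c * B u v" if "u \<in> F" "v \<in> F" for u v c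
    using assms that by (simp add: symmetric_form_def lin_on_def)
  have diff: "B u (v - w) = B u v - B u w" if "u \<in> F" "v \<in> F" "w \<in> F" for u v w
    using add[of u v "-1 *\<^sub>R w"] scale[of u w "-1"] that subspace_neg[OF F, of w] by simp
  have zero: "B u 0 = 0" if "u \<in> F" for u
    using scale[of u u 0] that by simp
  note cl = subspace_add[OF F] subspace_diff[OF F] subspace_scale[OF F] subspace_0[OF F]
  show "u \<in> F \<Longrightarrow> v \<in> F \<Longrightarrow> B u v = B v u" by (rule sym)
  show "u \<in> F \<Longrightarrow> v \<in> F \<Longrightarrow> w \<in> F \<Longrightarrow> B u (v + w) = B u v + B u w" by (rule add)
  show "u \<in> F \<Longrightarrow> v \<in> F \<Longrightarrow> B u (c *\<^sub>R v) = c * B u v" by (rule scale)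
  show "u \<in> F \<Longrightarrow> v \<in> F \<Longrightarrow> w \<in> F \<Longrightarrow> B u (v - w) = B u v - B u w" by (rule diff)
  show "u \<in> F \<Longrightarrow> B u 0 = 0" by (rule zero)
  show "B (u + v) w = B u w + B v w" if "u \<in> F" "v \<in> F" "w \<in> F"
    using add[of w u v] sym[of "u + v" w] sym[of u w] sym[of v w] that cl by simp
  show "B (c *\<^sub>R u) v = c * B u v" if "u \<in> F" "v \<in> F"
    using scale[of v u c] sym[of "c *\<^sub>R u" v] sym[of u v] that cl by simp
  show "B (u - v) w = B u w - B v w" if "u \<in> F" "v \<in> F" "w \<in> F"
    using diff[of w u v] sym[of "u - v" w] sym[of u w] sym[of v w] that cl by simp
  show "B 0 u = 0" if "u \<in> F"
    using zero[of u] sym[of 0 u] that cl by simp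
qed

lemma lin_on_sum:
  assumes "subspace V" "lin_on V f" "finite I" "\<And>i. i \<in> I \<Longrightarrow> e i \<in> V"
  shows "f (\<Sum>i\<in>I. c i *\<^sub>R e i) = (\<Sum>i\<in>I. c i *\<^sub>R f (e i))"
  using assms(3,4)
proof (induction I rule: finite_induct)
  case empty
  have "f (0 *\<^sub>R 0) = 0 *\<^sub>R f 0" using assms(1,2) subspace_0 unfolding lin_on_def by blast
  then show ?case by simp
next
  case (insert i I)
  have "c i *\<^sub>R e i \<in> V" "(\<Sum>i\<in>I. c i *\<^sub>R e i) \<in> V"
    using insert.prems assms(1) by (auto intro!: subspace_sum subspace_scale)
  then show ?case using insert assms(2) by (simp add: lin_on_def)
qed

lemma symmetric_form_sum_left:
  assumes "symmetric_form F B" "finite I" "\<And>i. i \<in> I \<Longrightarrow> e i \<in> F" "w \<in> F"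
  shows "B (\<Sum>i\<in>I. c i *\<^sub>R e i) w = (\<Sum>i\<in>I. c i * B (e i) w)"
proof -
  note F = symmetric_formD(1)[OF assms(1)]
  have "lin_on F (B w)" using assms by (simp add: symmetric_form_def)
  from lin_on_sum[OF F this assms(2,3)]
  have "B w (\<Sum>i\<in>I. c i *\<^sub>R e i) = (\<Sum>i\<in>I. c i * B w (e i))" by simp
  moreover have "(\<Sum>i\<in>I. c i *\<^sub>R e i) \<in> F"
    using assms(3) by (auto intro!: subspace_sum[OF F] subspace_scale[OF F])
  moreover have "(\<Sum>i\<in>I. c i * B w (e i)) = (\<Sum>i\<in>I. c i * B (e i) w)"
    using symmetric_formD(2)[OF assms(1,4) assms(3)] by (intro sum.cong) auto
  ultimately show ?thesis using symmetric_formD(2)[OF assms(1,4)] by simp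
qed

lemma symmetric_form_subset:
  "symmetric_form F B \<Longrightarrow> subspace V \<Longrightarrow> V \<subseteq> F \<Longrightarrow> symmetric_form V B"
  by (simp add: symmetric_form_def lin_on_def subset_eq)

lemma dependent_family:
  assumes "basis_family k e V" "\<And>i. i \<le> k \<Longrightarrow> f i \<in> V"
  obtains z j where "(\<Sum>i\<le>k. z i *\<^sub>R f i) = 0" "j \<le> k" "z j \<noteq> 0"
proof (rule ccontr)
  assume "\<not> thesis"
  then have ind: "\<And>z i. (\<Sum>i\<le>k. z i *\<^sub>R f i) = 0 \<Longrightarrow> i \<le> k \<Longrightarrow> z i = 0"
    using that by blast
  have inj: "inj_on f {..k}"
  proof (rule inj_onI, rule ccontr)
    fix i j assume ij: "i \<in> {..k}" "j \<in> {..k}" "f i = f j" "i \<noteq> j"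
    let ?z = "\<lambda>l. if l = i then 1 else if l = j then -1 else 0 :: real"
    have "(\<Sum>l\<le>k. ?z l *\<^sub>R f l) = (\<Sum>l\<in>{i, j}. ?z l *\<^sub>R f l)"
      using ij by (intro sum.mono_neutral_right) auto
    then have "(\<Sum>l\<le>k. ?z l *\<^sub>R f l) = 0" using ij by simp
    from ind[OF this, of i] ij show False by simp
  qed
  have "independent (f ` {..k})"
  proof
    assume "dependent (f ` {..k})"
    then obtain u v where u: "v \<in> f ` {..k}" "u v \<noteq> 0" "(\<Sum>v\<in>f ` {..k}. u v *\<^sub>R v) = 0"
      by (auto simp: dependent_finite)
    then have "(\<Sum>i\<le>k. u (f i) *\<^sub>R f i) = 0" using inj by (simp add: sum.reindex)
    with ind[OF this] u show False by auto
  qed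
  moreover have "f ` {..k} \<subseteq> span (e ` {..<k})" using assms by (auto simp: basis_family_def)
  ultimately have "card (f ` {..k}) \<le> card (e ` {..<k})"
    using independent_span_bound[of "e ` {..<k}" "f ` {..k}"] by simp
  also have "\<dots> \<le> k" using card_image_le[of "{..<k}" e] by simp
  finally show False using inj by (simp add: card_image)
qed

text \<open>The representation of linear functionals by a non-degenerate form, by counting dimensions. Put
\<open>T w = \<Sum>\<^sub>i B(w, e\<^sub>i) e\<^sub>i\<close> and \<open>t = \<Sum>\<^sub>i \<alpha>(e\<^sub>i) e\<^sub>i\<close>. The \<open>k + 1\<close> vectors \<open>T e\<^sub>0, \<dots>, T e\<^sub>k\<^sub>-\<^sub>1, t\<close> are dependent, and
injectivity of \<open>T\<close> forces the coefficient of \<open>t\<close> to be non-zero, so that \<open>t\<close> is in the image of \<open>T\<close>.\<close>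

lemma nondegenerate_represents:
  assumes B: "symmetric_form V B" and e: "basis_family k e V"
    and nd: "\<And>v. v \<in> V \<Longrightarrow> (\<And>w. w \<in> V \<Longrightarrow> B v w = 0) \<Longrightarrow> v = 0"
    and \<alpha>: "lin_on V \<alpha>"
  obtains w where "w \<in> V" "\<And>v. v \<in> V \<Longrightarrow> B w v = \<alpha> v"
proof -
  note V = symmetric_formD(1)[OF B]
  have ei: "e i \<in> V" if "i < k" for i
  proof -
    have "e i \<in> span (e ` {..<k})" using that by (intro span_base) auto
    then show ?thesis using e by (simp add: basis_family_def)
  qed
  define T where "T w = (\<Sum>i<k. B w (e i) *\<^sub>R e i)" for w
  define t where "t = (\<Sum>i<k. \<alpha> (e i) *\<^sub>R e i)"
  define f where "f i = (if i < k then T (e i) else t)" for i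
  have fV: "f i \<in> V" for i
    unfolding f_def T_def t_def using ei by (auto intro!: subspace_sum[OF V] subspace_scale[OF V])
  obtain z j where z: "(\<Sum>i\<le>k. z i *\<^sub>R f i) = 0" "j \<le> k" "z j \<noteq> 0"
    by (rule dependent_family[OF e fV])
  let ?w = "\<Sum>i<k. z i *\<^sub>R e i"
  have w: "?w \<in> V" using ei by (auto intro!: subspace_sum[OF V] subspace_scale[OF V])
  have "(\<Sum>i\<le>k. z i *\<^sub>R f i) = (\<Sum>i<k. z i *\<^sub>R T (e i)) + z k *\<^sub>R t"
    unfolding lessThan_Suc_atMost[symmetric] by (simp add: f_def)
  also have "(\<Sum>i<k. z i *\<^sub>R T (e i)) = (\<Sum>j<k. (\<Sum>i<k. z i * B (e i) (e j)) *\<^sub>R e j)"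
    unfolding T_def by (simp add: scaleR_sum_right scaleR_sum_left) (rule sum.swap)
  also have "\<dots> = (\<Sum>j<k. B ?w (e j) *\<^sub>R e j)"
    using symmetric_form_sum_left[OF B, of "{..<k}" e _ z] ei by (intro sum.cong refl) auto
  also have "\<dots> + z k *\<^sub>R t = (\<Sum>j<k. (B ?w (e j) + z k * \<alpha> (e j)) *\<^sub>R e j)"
    by (simp add: t_def scaleR_sum_right sum.distrib scaleR_left_distrib)
  finally have "(\<Sum>j<k. (B ?w (e j) + z k * \<alpha> (e j)) *\<^sub>R e j) = 0" using z(1) by simp
  then have *: "B ?w (e j) = - z k * \<alpha> (e j)" if "j < k" for j
    using basis_family_zero[OF e _ that, of "\<lambda>j. B ?w (e j) + z k * \<alpha> (e j)"] by simp
  have **: "B ?w v = - z k * \<alpha> v" if v: "v \<in> V" for v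
  proof -
    obtain c where c: "v = (\<Sum>i<k. c i *\<^sub>R e i)" using basis_family_coefficients[OF e v] .
    have "lin_on V (B ?w)" using B w by (simp add: symmetric_form_def)
    from lin_on_sum[OF V this, of "{..<k}" e c] lin_on_sum[OF V \<alpha>, of "{..<k}" e c]
    show ?thesis using ei by (simp add: c * sum_distrib_left sum_negf mult_ac)
  qed
  have "z k \<noteq> 0"
  proof
    assume k: "z k = 0"
    then have "?w = 0" using ** w by (intro nd) auto
    then have "z i = 0" if "i < k" for i using basis_family_zero[OF e _ that] by blast
    then show False using z k by (cases "j = k") auto
  qed
  then have "B ((- 1 / z k) *\<^sub>R ?w) v = \<alpha> v" if "v \<in> V" for v
    by (subst symmetric_formD(6)[OF B w that]) (simp add: **[OF that])
  moreover have "(- 1 / z k) *\<^sub>R ?w \<in> V" using w subspace_scale[OF V] by blast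
  ultimately show ?thesis using that by blast
qed

lemma orth_proj_eqI:
  assumes "symmetric_form (fibre E x) (pairing E x)" "subspace (V x)" "V x \<subseteq> fibre E x"
    and "\<And>v. v \<in> V x \<Longrightarrow> (\<And>w. w \<in> V x \<Longrightarrow> pairing E x v w = 0) \<Longrightarrow> v = 0"
    and "w \<in> V x" "s x - w \<in> perp E V x"
  shows "orth_proj E V s x = w"
  unfolding orth_proj_def
proof (rule the_equality)
  show "w \<in> V x \<and> s x - w \<in> perp E V x" using assms by simp
  fix w' assume w': "w' \<in> V x \<and> s x - w' \<in> perp E V x"
  have "w - w' = 0"
  proof (rule assms(4))
    show "w - w' \<in> V x" using assms w' by (simp add: subspace_diff)
    fix u assume u: "u \<in> V x"
    have "pairing E x ((s x - w') - (s x - w)) u = pairing E x (s x - w') u - pairing E x (s x - w) u"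
      using assms w' u by (intro symmetric_formD(8)[OF assms(1)]) (auto simp: perp_def)
    then show "pairing E x (w - w') u = 0" using assms w' u by (simp add: perp_def)
  qed
  then show "w' = w" by simp
qed

section \<open>Courant algebroids with a generalized pseudometric\<close>

locale courant_alg =
  fixes E :: "('m::{t2_space, second_countable_topology}, 'a::euclidean_space, 'v::real_vector) courant"
  assumes courant: "courant_algebroid E"
begin

sublocale smooth_bundle E
  using courant by unfold_locales (simp_all add: courant_algebroid_def)

lemma form: "symmetric_form (fibre E x) (pairing E x)"
  using courant subspace_fibre by (simp add: courant_algebroid_def symmetric_form_def)

lemma nondegenerate:
  assumes "v \<in> fibre E x" "\<And>w. w \<in> fibre E x \<Longrightarrow> pairing E x v w = 0" shows "v = 0"
proof -
  have "nondegenerate_on E (fibre E)" using courant by (simp add: courant_algebroid_def)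
  then show ?thesis using assms by (simp add: nondegenerate_on_def)
qed

lemma pairing_smooth: "u \<in> \<Gamma> E \<Longrightarrow> v \<in> \<Gamma> E \<Longrightarrow> pair_sections E u v \<in> Cinf (atlas E)"
  using courant by (simp add: courant_algebroid_def)

lemma anchor_zero: "v \<in> fibre E x \<Longrightarrow> anchor E x v (\<lambda>x. 0) = 0"
proof -
  assume v: "v \<in> fibre E x"
  have "derivation_at (atlas E) x (anchor E x v)"
    using courant v by (simp add: courant_algebroid_def)
  then have "\<forall>c. \<forall>f\<in>Cinf (atlas E). anchor E x v (\<lambda>y. c * f y) = c * anchor E x v f"
    unfolding derivation_at_def by blast
  from this[rule_format, OF Cinf_const[of 0], of 0] show ?thesis by simp
qed

lemma courant_bracket_axioms:
  shows   "\<forall>u\<in>\<Gamma> E. \<forall>v\<in>\<Gamma> E. bracket E u v \<in> \<Gamma> E" (is ?A)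
    and "\<forall>u\<in>\<Gamma> E. \<forall>v\<in>\<Gamma> E. \<forall>w\<in>\<Gamma> E.
     bracket E (\<lambda>x. u x + v x) w = (\<lambda>x. bracket E u w x + bracket E v w x) \<and>
     bracket E w (\<lambda>x. u x + v x) = (\<lambda>x. bracket E w u x + bracket E w v x)" (is ?B)
    and "\<forall>c. \<forall>u\<in>\<Gamma> E. \<forall>v\<in>\<Gamma> E.
     bracket E (\<lambda>x. c *\<^sub>R u x) v = (\<lambda>x. c *\<^sub>R bracket E u v x) \<and>
     bracket E u (\<lambda>x. c *\<^sub>R v x) = (\<lambda>x. c *\<^sub>R bracket E u v x)" (is ?C)
    and "\<forall>u\<in>\<Gamma> E. \<forall>v\<in>\<Gamma> E. \<forall>w\<in>\<Gamma> E.
     bracket E u (bracket E v w) =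
       (\<lambda>x. bracket E (bracket E u v) w x + bracket E v (bracket E u w) x)" (is ?D)
    and "\<forall>u\<in>\<Gamma> E. \<forall>v\<in>\<Gamma> E. \<forall>f\<in>Cinf (atlas E).
     bracket E u (\<lambda>x. f x *\<^sub>R v x) = (\<lambda>x. f x *\<^sub>R bracket E u v x + act E u f x *\<^sub>R v x)" (is ?F)
    and "\<forall>u\<in>\<Gamma> E. \<forall>v\<in>\<Gamma> E. \<forall>w\<in>\<Gamma> E.
     act E u (pair_sections E v w) =
       (\<lambda>x. pair_sections E (bracket E u v) w x + pair_sections E v (bracket E u w) x)" (is ?G)
    and "\<forall>u\<in>\<Gamma> E. \<forall>v\<in>\<Gamma> E.
     (\<lambda>x. bracket E u v x + bracket E v u x) = dE E (pair_sections E u v)" (is ?H)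
proof -
  note c = courant[unfolded courant_algebroid_def]
  show ?A using c by (elim conjE)
  show ?B using c by (elim conjE)
  show ?C using c by (elim conjE)
  show ?D using c by (elim conjE)
  show ?F using c by (elim conjE)
  show ?G using c by (elim conjE)
  show ?H using c by (elim conjE)
qed

lemmas bracket_closed = courant_bracket_axioms(1)[rule_format]
lemmas bracket_add_left = courant_bracket_axioms(2)[rule_format, THEN conjunct1]
lemmas bracket_add_right = courant_bracket_axioms(2)[rule_format, THEN conjunct2]
lemmas bracket_scale_left = courant_bracket_axioms(3)[rule_format, THEN conjunct1]
lemmas bracket_scale_right = courant_bracket_axioms(3)[rule_format, THEN conjunct2]
lemmas bracket_jacobi = courant_bracket_axioms(4)[rule_format]
lemmas bracket_leibniz = courant_bracket_axioms(5)[rule_format]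
lemmas act_pairing = courant_bracket_axioms(6)[rule_format]
lemmas bracket_symmetric_part = courant_bracket_axioms(7)[rule_format]

lemma SecD: "s \<in> Sec E V \<Longrightarrow> s \<in> \<Gamma> E" "s \<in> Sec E V \<Longrightarrow> s x \<in> V x" "s \<in> Sec E V \<Longrightarrow> s x \<in> fibre E x"
  by (auto simp: Sec_iff)

lemma bracket_zero_left: "v \<in> \<Gamma> E \<Longrightarrow> bracket E (\<lambda>x. 0) v = (\<lambda>x. 0)"
  using bracket_scale_left[of v v 0] by simp

lemma bracket_zero_right: "v \<in> \<Gamma> E \<Longrightarrow> bracket E v (\<lambda>x. 0) = (\<lambda>x. 0)"
  using bracket_scale_right[of v v 0] by simp

lemma bracket_diff_right:
  assumes "u \<in> \<Gamma> E" "v \<in> \<Gamma> E" "w \<in> \<Gamma> E"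
  shows "bracket E w (\<lambda>x. u x - v x) = (\<lambda>x. bracket E w u x - bracket E w v x)"
  using bracket_add_right[OF assms(1) Sec_scale_const[OF subspace_fibre assms(2), of "-1"] assms(3)]
    bracket_scale_right[OF assms(3,2), of "-1"] by simp

lemma dE_zero: "dE E (\<lambda>x. 0) = (\<lambda>x. 0)"
proof
  fix x
  have "w = 0" if "w \<in> fibre E x" "\<forall>v\<in>fibre E x. pairing E x v w = anchor E x v (\<lambda>x. 0)" for w
  proof (rule nondegenerate[OF that(1)])
    fix v assume v: "v \<in> fibre E x"
    show "pairing E x w v = 0"
      using symmetric_formD(2)[OF form that(1) v] that(2) v by (simp add: anchor_zero)
  qed
  then show "dE E (\<lambda>x. 0) x = 0"
    unfolding dE_def
    by (intro the_equality)
      (auto simp: subspace_0 subspace_fibre anchor_zero symmetric_formD(9)[OF form])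
qed

lemma bracket_skew:
  assumes "u \<in> \<Gamma> E" "v \<in> \<Gamma> E" "pair_sections E u v = (\<lambda>x. 0)"
  shows "bracket E u v = (\<lambda>x. - bracket E v u x)"
  using bracket_symmetric_part[OF assms(1,2)] assms(3)
  by (simp add: dE_zero fun_eq_iff eq_neg_iff_add_eq_0)

text \<open>The bracket with \<open>u\<close> is skew-adjoint up to the derivative of the pairing, which vanishes for orthogonal
sections.\<close>

lemma pairing_bracket_move:
  assumes "u \<in> \<Gamma> E" "v \<in> \<Gamma> E" "w \<in> \<Gamma> E" "pair_sections E v w = (\<lambda>x. 0)"
  shows "pairing E x (bracket E u v x) (w x) = - pairing E x (v x) (bracket E u w x)"
proof -
  have "act E u (pair_sections E v w) x = 0"
    using assms(4) SecD(3)[OF assms(1)] by (simp add: act_def anchor_zero)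
  then show ?thesis using fun_cong[OF act_pairing[OF assms(1-3)], of x] by (simp add: pair_sections_def)
qed

lemma subspace_perp: "(\<And>x. V x \<subseteq> fibre E x) \<Longrightarrow> subspace (perp E V x)"
  unfolding subspace_def perp_def
  using subspace_fibre[of x] symmetric_formD(4,6,10)[OF form[of x]]
  by (auto simp: subset_eq subspace_0 subspace_add subspace_scale)

lemma perp_subset: "perp E V x \<subseteq> fibre E x"
  by (auto simp: perp_def)

end

locale pseudometric = courant_alg E
  for E :: "('m::{t2_space, second_countable_topology}, 'a::euclidean_space, 'v::real_vector) courant" +
  fixes V :: "'m \<Rightarrow> 'v set"
  assumes pseudometric: "generalized_pseudometric E V"
begin

lemma subspace_V: "subspace (V x)" and V_subset: "V x \<subseteq> fibre E x"
  using pseudometric by (simp_all add: generalized_pseudometric_def subbundle_def)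

lemma V_fibre: "v \<in> V x \<Longrightarrow> v \<in> fibre E x"
  using V_subset by blast

lemma V_nondegenerate: "v \<in> V x \<Longrightarrow> (\<And>w. w \<in> V x \<Longrightarrow> pairing E x v w = 0) \<Longrightarrow> v = 0"
  using pseudometric by (simp add: generalized_pseudometric_def nondegenerate_on_def)

lemma V_frame:
  obtains U k e where "open U" "x \<in> U" "\<And>i. i < k \<Longrightarrow> smooth_section_on E U (e i)"
    "\<And>y. y \<in> U \<Longrightarrow> basis_family k (\<lambda>i. e i y) (V y)"
proof -
  have "\<exists>U k e. open U \<and> x \<in> U \<and> (\<forall>i<k. smooth_section_on E U (e i)) \<and>
        (\<forall>y\<in>U. basis_family k (\<lambda>i. e i y) (V y))"
    using pseudometric by (simp add: generalized_pseudometric_def subbundle_def)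
  then obtain U k e where "open U \<and> x \<in> U \<and> (\<forall>i<k. smooth_section_on E U (e i)) \<and>
        (\<forall>y\<in>U. basis_family k (\<lambda>i. e i y) (V y))"
    by (elim exE)
  then show ?thesis by (intro that[of U k e]) auto
qed

abbreviation "pos s \<equiv> orth_proj E V s"
abbreviation "neg s \<equiv> orth_proj E (perp E V) s"

lemmas subspace_neg_part = subspace_perp[of V, OF V_subset]

lemma pos_eqI: "w \<in> V x \<Longrightarrow> s x - w \<in> perp E V x \<Longrightarrow> pos s x = w"
  by (rule orth_proj_eqI[where V = V, OF form subspace_V V_subset V_nondegenerate])

lemma pos_in:
  assumes "s x \<in> fibre E x"
  shows "pos s x \<in> V x" "s x - pos s x \<in> perp E V x"
proof -
  obtain U k e where "x \<in> U" "\<And>y. y \<in> U \<Longrightarrow> basis_family k (\<lambda>i. e i y) (V y)"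
    by (rule V_frame[of x]) blast
  then have b: "basis_family k (\<lambda>i. e i x) (V x)" by blast
  have lin: "lin_on (V x) (pairing E x (s x))"
    using symmetric_formD(3,5)[OF form assms] V_subset by (auto simp: lin_on_def subset_eq)
  obtain w where w: "w \<in> V x" "\<And>v. v \<in> V x \<Longrightarrow> pairing E x w v = pairing E x (s x) v"
  proof (rule nondegenerate_represents[OF symmetric_form_subset[OF form subspace_V V_subset] b _ lin])
    fix v assume "v \<in> V x" "\<And>w. w \<in> V x \<Longrightarrow> pairing E x v w = 0"
    then show "v = 0" by (rule V_nondegenerate)
  qed blast
  have "s x - w \<in> perp E V x"
    using w assms V_subset[of x] subspace_fibre[of x]
    by (auto simp: perp_def subspace_diff subset_eq symmetric_formD(8)[OF form])
  with w pos_eqI show "pos s x \<in> V x" "s x - pos s x \<in> perp E V x" by auto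
qed

text \<open>The complement \<open>V\<^sup>\<bottom>\<close> is non-degenerate because \<open>V\<close> and \<open>V\<^sup>\<bottom>\<close> span the fibre, on which the pairing is
non-degenerate.\<close>

lemma neg_eq:
  assumes "s x \<in> fibre E x"
  shows "neg s x = s x - pos s x"
proof (rule orth_proj_eqI[where V = "perp E V", OF form subspace_neg_part perp_subset])
  show "s x - pos s x \<in> perp E V x" by (rule pos_in[of s, OF assms])
  show "s x - (s x - pos s x) \<in> perp E (perp E V) x"
    using pos_in(1)[of s, OF assms] V_subset symmetric_formD(2)[OF form[of x]]
    by (auto simp: perp_def subset_eq)
  fix v assume v: "v \<in> perp E V x" "\<And>w. w \<in> perp E V x \<Longrightarrow> pairing E x v w = 0"
  show "v = 0"
  proof (rule nondegenerate)
    show vf: "v \<in> fibre E x" using v perp_subset by blast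
    fix w assume w: "w \<in> fibre E x"
    let ?s = "\<lambda>_. w"
    have p: "pos ?s x \<in> V x" "w - pos ?s x \<in> perp E V x" using pos_in[of ?s x] w by auto
    have "pairing E x v (pos ?s x + (w - pos ?s x)) = pairing E x v (pos ?s x) + pairing E x v (w - pos ?s x)"
      by (rule symmetric_formD(3)[OF form vf]) (use p V_subset perp_subset in blast)+
    also have "\<dots> = 0" using v p by (simp add: perp_def)
    finally show "pairing E x v w = 0" by simp
  qed
qed

lemma pos_add: "s x \<in> fibre E x \<Longrightarrow> t x \<in> fibre E x \<Longrightarrow> pos (\<lambda>x. s x + t x) x = pos s x + pos t x"
  using pos_in[of s x] pos_in[of t x] subspace_V subspace_neg_part[of x]
  by (intro pos_eqI) (auto simp: add_diff_add intro: subspace_add)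

lemma pos_scale: "s x \<in> fibre E x \<Longrightarrow> pos (\<lambda>x. c *\<^sub>R s x) x = c *\<^sub>R pos s x"
  using pos_in[of s x] subspace_V subspace_neg_part[of x]
  by (intro pos_eqI) (auto simp flip: scaleR_diff_right intro: subspace_scale)

text \<open>The coefficients \<open>c\<^sub>i\<close> of the projection in a local frame \<open>f\<close> of \<open>V\<close> solve the system with the Gram matrix
\<open>\<langle>f\<^sub>i, f\<^sub>j\<rangle>\<close> and right-hand side \<open>\<langle>s, f\<^sub>j\<rangle>\<close>, whose kernel at every point is trivial by non-degeneracy. The
frame is multiplied by a bump function \<open>\<psi>\<close>, as pairings are known to be smooth only for global sections.\<close>

lemma pos_smooth:
  assumes s: "s \<in> \<Gamma> E"
  shows "pos s \<in> Sec E V"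
proof -
  have "section_germ E x (pos s)" for x
  proof -
    obtain U k e where U: "open U" "x \<in> U" "\<And>i. i < k \<Longrightarrow> smooth_section_on E U (e i)"
      "\<And>y. y \<in> U \<Longrightarrow> basis_family k (\<lambda>i. e i y) (V y)"
      by (rule V_frame[of x]) blast
    obtain \<psi> where \<psi>: "\<psi> \<in> Cinf (atlas E)" "\<psi> x \<noteq> 0"
      "\<And>s. smooth_section_on E U s \<Longrightarrow> (\<lambda>y. \<psi> y *\<^sub>R s y) \<in> \<Gamma> E"
      using bump_extension[OF U(1,2)] by blast
    define f where "f i = (\<lambda>y. \<psi> y *\<^sub>R e i y)" for i
    have f: "f i \<in> \<Gamma> E" if "i < k" for i unfolding f_def using U(3)[OF that] by (rule \<psi>(3))
    have "\<exists>c. pos s y = (\<Sum>i<k. c i *\<^sub>R e i y)" if "y \<in> U" for y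
      using basis_family_coefficients[OF U(4)[OF that] pos_in(1)[of s y, OF SecD(3)[OF s]]] by blast
    then obtain c where c: "\<And>y. y \<in> U \<Longrightarrow> pos s y = (\<Sum>i<k. c y i *\<^sub>R e i y)" by metis
    have eV: "e i y \<in> V y" if "i < k" "y \<in> U" for i y
      using U(4)[OF that(2)] that(1) unfolding basis_family_def by (metis span_base imageI lessThan_iff)
    have nU: "eventually (\<lambda>y. y \<in> U) (nhds x)" using U by (simp add: eventually_nhds_in_open)
    have gram: "pairing E y (pos s y) (f j y) = pairing E y (s y) (f j y)" if "j < k" "y \<in> U" for j y
    proof -
      have sy: "s y \<in> fibre E y" by (rule SecD(3)[OF s])
      have fj: "f j y \<in> V y" using eV[OF that] subspace_V subspace_scale by (auto simp: f_def)
      have "pairing E y (s y - pos s y) (f j y) = 0" using pos_in(2)[of s y, OF sy] fj by (simp add: perp_def)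
      then show ?thesis
        using symmetric_formD(8)[OF form sy V_fibre V_fibre, OF pos_in(1)[of s y, OF sy] fj] by simp
    qed
    have germ: "smooth_germ (atlas E) x (\<lambda>y. c y i)" if "i < k" for i
    proof (rule smooth_germ_linear_system[OF manifold, of "{..<k}" "{..<k}" x
          "\<lambda>j i. pair_sections E (f i) (f j)" "\<lambda>j y. \<psi> y * pair_sections E s (f j) y" "\<lambda>i y. c y i"])
      show "smooth_germ (atlas E) x (pair_sections E (f i) (f j))" if "j \<in> {..<k}" "i \<in> {..<k}" for i j
        using pairing_smooth[OF f f] that by (simp add: Cinf_iff)
      show "smooth_germ (atlas E) x (\<lambda>y. \<psi> y * pair_sections E s (f j) y)" if "j \<in> {..<k}" for j
        using pairing_smooth[OF s f] that \<psi>(1) by (auto simp: Cinf_iff intro: smooth_germ_mult)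
      show "eventually (\<lambda>y. (\<Sum>i<k. pair_sections E (f i) (f j) y * c y i) = \<psi> y * pair_sections E s (f j) y) (nhds x)"
        if j: "j \<in> {..<k}" for j
        using nU
      proof eventually_elim
        case (elim y)
        have m: "f i y \<in> fibre E y" if "i < k" for i using f[OF that] SecD(3) by blast
        have "pos s y \<in> fibre E y" using pos_in(1)[of s y, OF SecD(3)[OF s]] V_subset by blast
        then have "\<psi> y * pairing E y (pos s y) (f j y) = pairing E y (\<psi> y *\<^sub>R pos s y) (f j y)"
          using symmetric_formD(6)[OF form] m j by simp
        also have "\<psi> y *\<^sub>R pos s y = (\<Sum>i<k. c y i *\<^sub>R f i y)"
          by (simp add: c[OF elim] f_def scaleR_sum_right mult.commute)
        also have "pairing E y \<dots> (f j y) = (\<Sum>i<k. c y i * pairing E y (f i y) (f j y))"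
          using m j by (intro symmetric_form_sum_left[OF form]) auto
        finally show ?case using gram[of j y] elim j by (simp add: pair_sections_def mult.commute)
      qed
      show "z i = 0" if z: "\<And>j. j \<in> {..<k} \<Longrightarrow> (\<Sum>i<k. pair_sections E (f i) (f j) x * z i) = 0"
        and i: "i \<in> {..<k}" for z i
      proof -
        let ?w = "\<Sum>i<k. z i *\<^sub>R f i x"
        have fV: "f i x \<in> V x" if "i < k" for i
          using eV[OF that U(2)] subspace_V subspace_scale by (auto simp: f_def)
        have w: "?w \<in> V x" using fV by (auto intro!: subspace_sum subspace_V subspace_scale)
        have wf: "pairing E x ?w (f j x) = 0" if "j < k" for j
          using z[of j] that symmetric_form_sum_left[OF form, of "{..<k}" "\<lambda>i. f i x" x "f j x" z] fV V_subset
          by (auto simp: pair_sections_def mult.commute subset_eq)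
        have "?w = 0"
        proof (rule V_nondegenerate[OF w])
          fix v assume v: "v \<in> V x"
          obtain b where b: "v = (\<Sum>i<k. b i *\<^sub>R e i x)" using basis_family_coefficients[OF U(4)[OF U(2)] v] .
          have "v = (\<Sum>i<k. (b i / \<psi> x) *\<^sub>R f i x)" using \<psi>(2) by (simp add: b f_def)
          then have "pairing E x v ?w = (\<Sum>j<k. (b j / \<psi> x) * pairing E x (f j x) ?w)"
            using symmetric_form_sum_left[OF form, of "{..<k}" "\<lambda>i. f i x" x ?w "\<lambda>i. b i / \<psi> x"] fV w V_subset
            by (auto simp: subset_eq)
          also have "\<dots> = 0"
          proof (intro sum.neutral ballI)
            fix j assume "j \<in> {..<k}"
            then have j: "j < k" by simp
            have "pairing E x (f j x) ?w = 0"
              using wf[OF j] symmetric_formD(2)[OF form subsetD[OF V_subset w] subsetD[OF V_subset fV[OF j]]] by simp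
            then show "b j / \<psi> x * pairing E x (f j x) ?w = 0" by simp
          qed
          finally show "pairing E x ?w v = 0" using symmetric_formD(2)[OF form V_fibre[OF v] V_fibre[OF w]] by simp
        qed
        then have "(\<Sum>i<k. (z i * \<psi> x) *\<^sub>R e i x) = 0" by (simp add: f_def)
        from basis_family_zero[OF U(4)[OF U(2)] this] i \<psi>(2) show "z i = 0" by simp
      qed
    qed (use that in auto)
    have "section_germ E x (\<lambda>y. \<Sum>i<k. c y i *\<^sub>R e i y)"
      using U(1-3) germ by (intro section_germ_sum section_germ_scale) (auto simp: smooth_section_on_iff_germ)
    moreover have "eventually (\<lambda>y. (\<Sum>i<k. c y i *\<^sub>R e i y) = pos s y) (nhds x)"
      using nU by eventually_elim (simp add: c)
    ultimately show ?thesis by (rule section_germ_cong[rotated])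
  qed
  then show ?thesis
    using pos_in(1)[of s, OF SecD(3)[OF s]] V_subset by (auto simp: Sec_iff)
qed

lemma neg_fun: "s \<in> \<Gamma> E \<Longrightarrow> neg s = (\<lambda>x. s x - pos s x)"
  using neg_eq[of s] SecD(3) by blast

lemma neg_smooth:
  assumes "s \<in> \<Gamma> E"
  shows "neg s \<in> Sec E (perp E V)"
proof -
  have "(\<lambda>x. s x - pos s x) \<in> \<Gamma> E"
    using assms pos_smooth SecD(1) by (intro Sec_diff subspace_fibre) auto
  then show ?thesis using pos_in(2)[of s, OF SecD(3)[OF assms]] by (auto simp: Sec_iff neg_fun[OF assms])
qed

lemma V_section_through:
  assumes "v \<in> V x"
  obtains d where "d \<in> Sec E V" "d x = v"
proof -
  obtain t where t: "t \<in> \<Gamma> E" "t x = v" using section_through[of v x] assms V_subset by auto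
  have "pos t x = v"
    using assms t subspace_neg_part[of x] by (intro pos_eqI) (auto simp: subspace_0)
  then show ?thesis using that[OF pos_smooth[OF t(1)]] by simp
qed

lemma pairing_pos_neg: "v \<in> V x \<Longrightarrow> w \<in> perp E V x \<Longrightarrow> pairing E x v w = 0 \<and> pairing E x w v = 0"
  using V_subset[of x] symmetric_formD(2)[OF form, of v x w] by (auto simp: perp_def)

text \<open>The operator whose trace appears in the generalized Ricci tensor.\<close>

definition "ricci_op a b c = pos (bracket E (neg (bracket E c b)) a)"

lemma ricci_op_smooth:
  assumes "a \<in> \<Gamma> E" "b \<in> \<Gamma> E" "c \<in> \<Gamma> E"
  shows "ricci_op a b c \<in> Sec E V"
  unfolding ricci_op_def by (intro pos_smooth bracket_closed SecD(1)[OF neg_smooth] assms)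

text \<open>With \<open>e = [c, b]\<^sub>-\<close> and \<open>g = [a, d]\<^sub>-\<close> one has
\<open>\<langle>[e, a], d\<rangle> = - \<langle>[a, e], d\<rangle> = \<langle>e, [a, d]\<rangle> = \<langle>e, g\<rangle> = \<langle>[c, b], g\<rangle> = - \<langle>[b, c], g\<rangle> = \<langle>c, [b, g]\<rangle>\<close>: all derivatives of
pairings drop out, because each of them involves a section of \<open>V\<close> and one of \<open>V\<^sup>\<bottom>\<close>. The right-hand side
contains no derivative of \<open>c\<close>.\<close>

lemma pairing_ricci_op:
  assumes a: "a \<in> Sec E V" and b: "b \<in> Sec E (perp E V)" and c: "c \<in> Sec E V" and d: "d \<in> Sec E V"
  shows "pairing E x (ricci_op a b c x) (d x) =
    pairing E x (c x) (bracket E b (neg (bracket E a d)) x)"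
proof -
  note G = SecD(1)[OF a] SecD(1)[OF b] SecD(1)[OF c] SecD(1)[OF d]
  define e where "e = neg (bracket E c b)"
  define g where "g = neg (bracket E a d)"
  have e: "e \<in> Sec E (perp E V)" unfolding e_def by (intro neg_smooth bracket_closed G)
  have g: "g \<in> Sec E (perp E V)" unfolding g_def by (intro neg_smooth bracket_closed G)
  have orth: "pair_sections E s t = (\<lambda>x. 0)" "pair_sections E t s = (\<lambda>x. 0)"
    if "s \<in> Sec E V" "t \<in> Sec E (perp E V)" for s t
    using that pairing_pos_neg by (auto simp: pair_sections_def fun_eq_iff SecD(2))
  have pos: "pairing E x (pos s x) v = pairing E x (s x) v" if "s \<in> \<Gamma> E" "v \<in> V x" for s v
  proof -
    have "pairing E x (s x - pos s x) v = 0" using pos_in(2)[of s x] that SecD(3) by (auto simp: perp_def)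
    then show ?thesis
      using symmetric_formD(8)[OF form SecD(3)[OF that(1)] V_fibre V_fibre,
          OF pos_in(1)[of s x, OF SecD(3)[OF that(1)]] that(2)] by simp
  qed
  have neg: "pairing E x (neg s x) v = pairing E x (s x) v" if "s \<in> \<Gamma> E" "v \<in> perp E V x" for s v
  proof -
    have "pairing E x (pos s x) v = 0" using pos_in(1)[of s x] that SecD(3) pairing_pos_neg by blast
    moreover have "v \<in> fibre E x" using that(2) perp_subset by blast
    ultimately show ?thesis
      using symmetric_formD(8)[OF form SecD(3)[OF that(1)] V_fibre,
          OF pos_in(1)[of s x, OF SecD(3)[OF that(1)]]]
      by (simp add: neg_fun that(1))
  qed
  have minus: "pairing E x (- v) w = - pairing E x v w" if "v \<in> fibre E x" "w \<in> fibre E x" for v w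
    using symmetric_formD(6)[OF form that, of "-1"] by simp
  have br: "bracket E s t x \<in> fibre E x" if "s \<in> \<Gamma> E" "t \<in> \<Gamma> E" for s t
    using bracket_closed[OF that] SecD(3) by blast
  note Ge = SecD(1)[OF e] note Gg = SecD(1)[OF g]
  have "pairing E x (ricci_op a b c x) (d x) = pairing E x (bracket E e a x) (d x)"
    unfolding ricci_op_def e_def[symmetric] by (rule pos[OF bracket_closed[OF Ge G(1)] SecD(2)[OF d]])
  also have "\<dots> = - pairing E x (bracket E a e x) (d x)"
    using bracket_skew[OF Ge G(1) orth(2)[OF a e]] minus[OF br[OF G(1) Ge] SecD(3)[OF d]] by simp
  also have "\<dots> = pairing E x (e x) (bracket E a d x)"
    using pairing_bracket_move[OF G(1) Ge G(4) orth(2)[OF d e], of x] by simp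
  also have "\<dots> = pairing E x (bracket E a d x) (e x)"
    using symmetric_formD(2)[OF form br[OF G(1,4)] SecD(3)[OF e]] by simp
  also have "\<dots> = pairing E x (g x) (e x)"
    unfolding g_def using neg[OF bracket_closed[OF G(1,4)] SecD(2)[OF e]] by simp
  also have "\<dots> = pairing E x (e x) (g x)"
    by (rule symmetric_formD(2)[OF form SecD(3)[OF g] SecD(3)[OF e]])
  also have "\<dots> = pairing E x (bracket E c b x) (g x)"
    unfolding e_def using neg[OF bracket_closed[OF G(3,2)] SecD(2)[OF g]] by simp
  also have "\<dots> = - pairing E x (bracket E b c x) (g x)"
    using bracket_skew[OF G(3,2) orth(1)[OF c b]] minus[OF br[OF G(2,3)] SecD(3)[OF g]] by simp
  also have "\<dots> = pairing E x (c x) (bracket E b g x)"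
    using pairing_bracket_move[OF G(2,3) Gg orth(1)[OF c g], of x] by simp
  finally show ?thesis unfolding g_def .
qed

lemma ricci_op_tensorial:
  assumes "a \<in> Sec E V" "b \<in> Sec E (perp E V)" "c \<in> Sec E V" "c' \<in> Sec E V" "c x = c' x"
  shows "ricci_op a b c x = ricci_op a b c' x"
proof -
  note T = SecD(2)[OF ricci_op_smooth[OF SecD(1)[OF assms(1)] SecD(1)[OF assms(2)]]]
  have T1: "ricci_op a b c x \<in> V x" "ricci_op a b c' x \<in> V x" using T SecD(1) assms by blast+
  have "ricci_op a b c x - ricci_op a b c' x = 0"
  proof (rule V_nondegenerate)
    show "ricci_op a b c x - ricci_op a b c' x \<in> V x" using T1 subspace_V subspace_diff by blast
    fix w assume w: "w \<in> V x"
    obtain d where d: "d \<in> Sec E V" "d x = w" by (rule V_section_through[OF w])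
    have "pairing E x (ricci_op a b c x) w = pairing E x (ricci_op a b c' x) w"
      using pairing_ricci_op[OF assms(1-3) d(1), of x] pairing_ricci_op[OF assms(1,2,4) d(1), of x] d(2) assms(5)
      by simp
    then show "pairing E x (ricci_op a b c x - ricci_op a b c' x) w = 0"
      using symmetric_formD(8)[OF form V_fibre[OF T1(1)] V_fibre[OF T1(2)] V_fibre[OF w]] by simp
  qed
  then show ?thesis by simp
qed

text \<open>By tensoriality the choice of the section extending a vector does not matter.\<close>

lemma fibre_map_ricci_op:
  assumes "a \<in> Sec E V" "b \<in> Sec E (perp E V)" "c \<in> Sec E V"
  shows "fibre_map E V (ricci_op a b) x (c x) = ricci_op a b c x"
proof -
  let ?c = "SOME c'. c' \<in> Sec E V \<and> c' x = c x"
  have "?c \<in> Sec E V \<and> ?c x = c x" by (rule someI[of _ c]) (use assms in simp)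
  then show ?thesis unfolding fibre_map_def using ricci_op_tensorial[OF assms(1,2) _ assms(3)] by blast
qed

lemma fibre_map_ricci_op_in:
  assumes "a \<in> Sec E V" "b \<in> Sec E (perp E V)" "v \<in> V x"
  shows "fibre_map E V (ricci_op a b) x v \<in> V x"
proof -
  obtain c where c: "c \<in> Sec E V" "c x = v" by (rule V_section_through[OF assms(3)])
  then show ?thesis
    using fibre_map_ricci_op[OF assms(1,2) c(1), of x]
      SecD(2)[OF ricci_op_smooth[OF SecD(1)[OF assms(1)] SecD(1)[OF assms(2)] SecD(1)[OF c(1)]], of x]
    by simp
qed

lemma fibre_map_ricci_op_linear:
  assumes a: "a \<in> Sec E V" and b: "b \<in> Sec E (perp E V)"
  shows "lin_on (V x) (fibre_map E V (ricci_op a b) x)"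
proof -
  note Ga = SecD(1)[OF a] and Gb = SecD(1)[OF b]
  have "fibre_map E V (ricci_op a b) x (v + w) =
      fibre_map E V (ricci_op a b) x v + fibre_map E V (ricci_op a b) x w" if vw: "v \<in> V x" "w \<in> V x" for v w
  proof -
    obtain c where c: "c \<in> Sec E V" "c x = v" by (rule V_section_through[OF vw(1)])
    obtain d where d: "d \<in> Sec E V" "d x = w" by (rule V_section_through[OF vw(2)])
    note Gc = SecD(1)[OF c(1)] and Gd = SecD(1)[OF d(1)]
    note cb = bracket_closed[OF Gc Gb] and db = bracket_closed[OF Gd Gb]
    note ncb = SecD(1)[OF neg_smooth[OF cb]] and ndb = SecD(1)[OF neg_smooth[OF db]]
    have "neg (bracket E (\<lambda>y. c y + d y) b) = (\<lambda>y. neg (bracket E c b) y + neg (bracket E d b) y)"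
      using bracket_add_left[OF Gc Gd Gb] pos_add[of "bracket E c b" _ "bracket E d b"]
        SecD(3)[OF cb] SecD(3)[OF db] neg_fun[OF cb] neg_fun[OF db] neg_fun[OF Sec_add[OF subspace_fibre cb db]]
      by (simp add: add_diff_add)
    then have "ricci_op a b (\<lambda>y. c y + d y) x = ricci_op a b c x + ricci_op a b d x"
      unfolding ricci_op_def using bracket_add_left[OF ncb ndb Ga]
        pos_add[of "bracket E (neg (bracket E c b)) a" x "bracket E (neg (bracket E d b)) a",
          OF SecD(3)[OF bracket_closed[OF ncb Ga]] SecD(3)[OF bracket_closed[OF ndb Ga]]] by simp
    then show ?thesis
      using fibre_map_ricci_op[OF a b c(1), of x] fibre_map_ricci_op[OF a b d(1), of x]
        fibre_map_ricci_op[OF a b Sec_add[OF subspace_V c(1) d(1)], of x] c d by simp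
  qed
  moreover have "fibre_map E V (ricci_op a b) x (r *\<^sub>R v) = r *\<^sub>R fibre_map E V (ricci_op a b) x v"
    if v: "v \<in> V x" for r v
  proof -
    obtain c where c: "c \<in> Sec E V" "c x = v" by (rule V_section_through[OF v])
    note Gc = SecD(1)[OF c(1)]
    note cb = bracket_closed[OF Gc Gb]
    note ncb = SecD(1)[OF neg_smooth[OF cb]]
    have "neg (bracket E (\<lambda>y. r *\<^sub>R c y) b) = (\<lambda>y. r *\<^sub>R neg (bracket E c b) y)"
      using bracket_scale_left[OF Gc Gb, of r] pos_scale[of "bracket E c b" _ r]
        SecD(3)[OF cb] neg_fun[OF cb] neg_fun[OF Sec_scale_const[OF subspace_fibre cb, of r]]
      by (simp add: scaleR_diff_right)
    then have "ricci_op a b (\<lambda>y. r *\<^sub>R c y) x = r *\<^sub>R ricci_op a b c x"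
      unfolding ricci_op_def using bracket_scale_left[OF ncb Ga, of r]
        pos_scale[of "bracket E (neg (bracket E c b)) a" x r, OF SecD(3)[OF bracket_closed[OF ncb Ga]]] by simp
    then show ?thesis
      using fibre_map_ricci_op[OF a b c(1), of x]
        fibre_map_ricci_op[OF a b Sec_scale_const[OF subspace_V c(1), of r], of x] c by simp
  qed
  ultimately show ?thesis by (simp add: lin_on_def)
qed

lemma GRic_ricci_op:
  "GRic E V dv a b = (\<lambda>x. dv (pos (bracket E b a)) x - act E b (dv a) x - section_trace E V (ricci_op a b) x)"
  by (simp add: GRic_def ricci_op_def[abs_def])

end

section \<open>Traces\<close>

lemma trace_on_basis:
  assumes B: "independent B" "span B = V" "finite B"
    and T: "lin_on V T" "\<And>v. v \<in> V \<Longrightarrow> T v \<in> V"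
  shows "trace_on V T = (\<Sum>b\<in>B. representation B (T b) b)"
proof -
  define C where "C = (SOME B. independent B \<and> span B = V)"
  have C: "independent C" "span C = V"
    using someI[of "\<lambda>B. independent B \<and> span B = V" B] B by (simp_all add: C_def)
  have fC: "finite C"
    using independent_span_bound[OF B(3) C(1)] C(2) B(2) span_superset[of C] by auto
  have V: "subspace V" using B(2) subspace_span by metis
  have BV: "b \<in> V" if "b \<in> B" for b using that B(2) span_superset by blast
  have CV: "c \<in> V" if "c \<in> C" for c using that C(2) span_superset by blast
  have 1: "representation C (T c) c = (\<Sum>b\<in>B. representation B c b * representation C (T b) c)"
    if c: "c \<in> C" for c
  proof -
    have "T c = T (\<Sum>b\<in>B. representation B c b *\<^sub>R b)"
      using sum_representation_eq[OF B(1), of c B] B CV[OF c] by simp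
    also have "\<dots> = (\<Sum>b\<in>B. representation B c b *\<^sub>R T b)"
      by (rule lin_on_sum[OF V T(1) B(3) BV])
    finally have "representation C (T c) c = representation C (\<Sum>b\<in>B. representation B c b *\<^sub>R T b) c"
      by simp
    also have "\<dots> = (\<Sum>b\<in>B. representation C (representation B c b *\<^sub>R T b) c)"
      using T(2)[OF BV] C(2) V by (subst representation_sum[OF C(1)]) (auto intro: subspace_scale)
    also have "\<dots> = (\<Sum>b\<in>B. representation B c b * representation C (T b) c)"
      using T(2)[OF BV] C(2) by (intro sum.cong refl) (simp add: representation_scale[OF C(1)])
    finally show ?thesis .
  qed
  have 2: "representation B (T b) b = (\<Sum>c\<in>C. representation C (T b) c * representation B c b)"
    if b: "b \<in> B" for b
  proof -
    have "representation B (T b) b = representation B (\<Sum>c\<in>C. representation C (T b) c *\<^sub>R c) b"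
      using sum_representation_eq[OF C(1), of "T b" C] C fC T(2)[OF BV[OF b]] by simp
    also have "\<dots> = (\<Sum>c\<in>C. representation B (representation C (T b) c *\<^sub>R c) b)"
      using CV B(2) V by (subst representation_sum[OF B(1)]) (auto intro: subspace_scale)
    also have "\<dots> = (\<Sum>c\<in>C. representation C (T b) c * representation B c b)"
      using CV B(2) by (intro sum.cong refl) (simp add: representation_scale[OF B(1)])
    finally show ?thesis .
  qed
  have "trace_on V T = (\<Sum>c\<in>C. representation C (T c) c)"
    by (simp add: trace_on_def C_def Let_def)
  also have "\<dots> = (\<Sum>c\<in>C. \<Sum>b\<in>B. representation C (T b) c * representation B c b)"
    using 1 by (intro sum.cong refl) (simp add: mult.commute)
  also have "\<dots> = (\<Sum>b\<in>B. \<Sum>c\<in>C. representation C (T b) c * representation B c b)"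
    by (rule sum.swap)
  also have "\<dots> = (\<Sum>b\<in>B. representation B (T b) b)"
    using 2 by (intro sum.cong refl) simp
  finally show ?thesis .
qed

text \<open>The image under \<open>q\<close> of a basis of \<open>V\<close> is a basis of \<open>q ` V\<close>, and the matrices of \<open>T\<close> and \<open>S\<close> in these two bases
coincide.\<close>

lemma trace_on_conjugate:
  fixes q :: "'v::real_vector \<Rightarrow> 'w::real_vector"
  assumes V: "basis_family k e V" and q: "lin_on V q" "inj_on q V"
    and T: "lin_on V T" "\<And>v. v \<in> V \<Longrightarrow> T v \<in> V"
    and S: "\<And>v. v \<in> V \<Longrightarrow> S (q v) = q (T v)"
  shows "trace_on (q ` V) S = trace_on V T"
proof -
  define B where "B = e ` {..<k}"
  have B: "independent B" "span B = V" "finite B" using V by (auto simp: basis_family_def B_def)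
  have sV: "subspace V" using B(2) subspace_span by metis
  have BV: "b \<in> V" if "b \<in> B" for b using that B(2) span_superset by blast
  obtain g where g: "linear g" "\<And>b. b \<in> B \<Longrightarrow> g b = q b"
    using linear_independent_extend[OF B(1), of q] by blast
  have gq: "g v = q v" if v: "v \<in> V" for v
  proof -
    have v': "v = (\<Sum>b\<in>B. representation B v b *\<^sub>R b)"
      using sum_representation_eq[OF B(1), of v B] B v by simp
    have "g v = (\<Sum>b\<in>B. representation B v b *\<^sub>R g b)"
      by (subst v') (simp add: linear_sum[OF g(1)] linear_scale[OF g(1)])
    also have "\<dots> = (\<Sum>b\<in>B. representation B v b *\<^sub>R q b)" using g(2) by simp
    also have "\<dots> = q v"
      using lin_on_sum[OF sV q(1) B(3), of "\<lambda>b. b" "representation B v"] BV v' by simp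
    finally show ?thesis .
  qed
  have "inj_on g (span B)" using q(2) gq B(2) by (metis inj_on_cong)
  then have "independent (g ` B)" using linear_independent_injective_image[OF g(1) B(1)] by blast
  moreover have "g ` B = q ` B" using g(2) by (rule image_cong[OF refl])
  ultimately have qB: "independent (q ` B)" by simp
  have "span (g ` B) = g ` span B" by (rule linear_span_image[OF g(1)])
  then have qV: "span (q ` B) = q ` V" using \<open>g ` B = q ` B\<close> gq B(2) by (simp cong: image_cong)
  have inj: "inj_on q B" using q(2) BV by (meson inj_on_subset subsetI)
  have rep: "representation (q ` B) (q v) (q b) = representation B v b" if v: "v \<in> V" and b: "b \<in> B" for v b
  proof -
    have v': "v = (\<Sum>b\<in>B. representation B v b *\<^sub>R b)"
      using sum_representation_eq[OF B(1), of v B] B v by simp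
    have "q v = (\<Sum>b\<in>B. representation B v b *\<^sub>R q b)"
      using lin_on_sum[OF sV q(1) B(3), of "\<lambda>b. b" "representation B v"] BV v' by simp
    also have "representation (q ` B) \<dots> (q b) =
        (\<Sum>c\<in>B. representation (q ` B) (representation B v c *\<^sub>R q c) (q b))"
      by (subst representation_sum[OF qB]) (auto intro: span_scale span_base)
    also have "\<dots> = (\<Sum>c\<in>B. representation B v c * representation (q ` B) (q c) (q b))"
      by (intro sum.cong refl) (simp add: representation_scale[OF qB] span_base)
    also have "\<dots> = (\<Sum>c\<in>B. if c = b then representation B v c else 0)"
      using b inj by (intro sum.cong refl) (auto simp: representation_basis[OF qB] dest: inj_onD)
    also have "\<dots> = representation B v b" using b B(3) by simp
    finally show ?thesis .
  qed
  have lS: "lin_on (q ` V) S"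
    unfolding lin_on_def
  proof (intro conjI ballI allI)
    fix v' w' assume "v' \<in> q ` V" "w' \<in> q ` V"
    then obtain v w where *: "v' = q v" "w' = q w" "v \<in> V" "w \<in> V" by blast
    have "S (q (v + w)) = q (T (v + w))" using * S subspace_add[OF sV] by blast
    then show "S (v' + w') = S v' + S w'" using * S T q(1) by (simp add: lin_on_def)
  next
    fix c v' assume "v' \<in> q ` V"
    then obtain v where *: "v' = q v" "v \<in> V" by blast
    have "S (q (c *\<^sub>R v)) = q (T (c *\<^sub>R v))" using * S subspace_scale[OF sV] by blast
    then show "S (c *\<^sub>R v') = c *\<^sub>R S v'" using * S T q(1) by (simp add: lin_on_def)
  qed
  have "trace_on (q ` V) S = (\<Sum>b\<in>q ` B. representation (q ` B) (S b) b)"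
    using S T(2) B(3) by (intro trace_on_basis[OF qB qV _ lS]) auto
  also have "\<dots> = (\<Sum>b\<in>B. representation (q ` B) (q (T b)) (q b))"
    using S BV by (subst sum.reindex[OF inj]) simp
  also have "\<dots> = (\<Sum>b\<in>B. representation B (T b) b)"
    using rep T(2) BV by (intro sum.cong refl) blast
  also have "\<dots> = trace_on V T" by (rule trace_on_basis[OF B T, symmetric])
  finally show ?thesis .
qed

section \<open>Equivariant Courant algebroids\<close>

locale equivariant_courant =
  fixes E :: "('m::{t2_space, second_countable_topology}, 'a::euclidean_space, 'v::real_vector) courant"
    and lb :: "'s::real_vector \<Rightarrow> 's \<Rightarrow> 's" and \<xi> :: "'s \<Rightarrow> 'm \<Rightarrow> 'v"
  assumes equivariant: "lie_equivariant_CA E lb \<xi>"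
begin

sublocale courant_alg E
  using equivariant by unfold_locales (simp add: lie_equivariant_CA_def)

abbreviation "sp \<equiv> perp E (sE \<xi>)"
abbreviation "inv_sections W \<equiv> invariant_sections E \<xi> W"

lemma \<xi>_section: "\<xi> u \<in> \<Gamma> E"
  and \<xi>_linear: "linear (\<lambda>u. \<xi> u x)"
  and \<xi>_inj: "inj (\<lambda>u. \<xi> u x)"
  and \<xi>_bracket: "bracket E (\<xi> u) (\<xi> v) = \<xi> (lb u v)"
  using equivariant by (auto simp: lie_equivariant_CA_def)

lemma \<xi>_eq_zero: "\<xi> u x = 0 \<Longrightarrow> u = 0"
  using injD[OF \<xi>_inj[of x], of u 0] linear_0[OF \<xi>_linear[of x]] by simp

lemma subspace_sE: "subspace (sE \<xi> x)"
  unfolding sE_def using linear_subspace_image[OF \<xi>_linear subspace_UNIV] .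

lemma sE_fibre: "sE \<xi> x \<subseteq> fibre E x"
  using \<xi>_section SecD(3) by (auto simp: sE_def)

lemmas subspace_sp = subspace_perp[of "sE \<xi>", OF sE_fibre]
lemmas sp_fibre = subsetD[OF perp_subset[of "sE \<xi>"]]

lemma inv_sections_iff: "s \<in> inv_sections W \<longleftrightarrow> s \<in> Sec E W \<and> (\<forall>u. bracket E (\<xi> u) s = (\<lambda>x. 0))"
  by (simp add: invariant_sections_def)

lemma inv_sections_mono: "s \<in> inv_sections W \<Longrightarrow> (\<And>x. W x \<subseteq> W' x) \<Longrightarrow> s \<in> inv_sections W'"
  by (auto simp: inv_sections_iff Sec_iff)

lemma inv_sections_diff:
  assumes "s \<in> inv_sections W" "t \<in> inv_sections W" "\<And>x. subspace (W x)"
  shows "(\<lambda>x. s x - t x) \<in> inv_sections W"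
  using assms bracket_diff_right[of s t] Sec_diff[of W s t] \<xi>_section SecD(1)
  by (auto simp: inv_sections_iff)

lemma inv_sections_bracket:
  assumes s: "s \<in> inv_sections sp" and t: "t \<in> inv_sections sp"
  shows "bracket E s t \<in> inv_sections sp"
proof -
  have S: "s \<in> Sec E sp" "\<And>u. bracket E (\<xi> u) s = (\<lambda>x. 0)"
    and T: "t \<in> Sec E sp" "\<And>u. bracket E (\<xi> u) t = (\<lambda>x. 0)"
    using s t by (auto simp: inv_sections_iff)
  note G = SecD(1)[OF S(1)] SecD(1)[OF T(1)]
  have orth: "pair_sections E r (\<xi> u) = (\<lambda>x. 0)" if "r \<in> Sec E sp" for r u
    using that by (auto simp: Sec_iff perp_def sE_def pair_sections_def)
  have "bracket E s t x \<in> sp x" for x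
  proof -
    have "pairing E x (bracket E s t x) (\<xi> u x) = 0" for u
    proof -
      have "bracket E s (\<xi> u) = (\<lambda>x. - bracket E (\<xi> u) s x)"
        by (rule bracket_skew[OF G(1) \<xi>_section orth[OF S(1)]])
      then have "bracket E s (\<xi> u) = (\<lambda>x. 0)" using S(2) by simp
      then show ?thesis
        using pairing_bracket_move[OF G \<xi>_section orth[OF T(1)], of x u]
          symmetric_formD(9)[OF form SecD(3)[OF T(1)]] by simp
    qed
    then show ?thesis using SecD(3)[OF bracket_closed[OF G]] by (auto simp: perp_def sE_def)
  qed
  then have "bracket E s t \<in> Sec E sp" using bracket_closed[OF G] by (auto simp: Sec_iff)
  moreover have "bracket E (\<xi> u) (bracket E s t) = (\<lambda>x. 0)" for u
    using bracket_jacobi[OF \<xi>_section G] by (simp add: S(2) T(2) bracket_zero_left bracket_zero_right G)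
  ultimately show ?thesis by (simp add: inv_sections_iff)
qed

text \<open>A vector outside \<open>\<s>\<^sub>E\<close> is separated from it by a linear functional; the vector representing that
functional lies in \<open>\<s>\<^sub>E\<^sup>\<bottom>\<close>.\<close>

lemma sp_perp_subset_sE:
  assumes v: "v \<in> fibre E x" and orth: "\<And>w. w \<in> sp x \<Longrightarrow> pairing E x v w = 0"
  shows "v \<in> sE \<xi> x"
proof (rule ccontr)
  assume n: "v \<notin> sE \<xi> x"
  obtain B where B: "B \<subseteq> sE \<xi> x" "independent B" "sE \<xi> x \<subseteq> span B"
    using maximal_independent_subset by blast
  have sB: "span B = sE \<xi> x" using B span_minimal[OF B(1) subspace_sE] by blast
  then have iB: "independent (insert v B)" using n B(2) by (intro independent_insertI) auto
  obtain g :: "'v \<Rightarrow> real" where g: "linear g" "\<And>b. b \<in> insert v B \<Longrightarrow> g b = (if b = v then 1 else 0)"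
    using linear_independent_extend[OF iB, of "\<lambda>b. if b = v then 1 else 0"] by blast
  have "v \<notin> B" using n B(1) by blast
  then have gB: "g b = 0" if "b \<in> B" for b using g(2)[of b] that by auto
  have gs: "g s = 0" if "s \<in> sE \<xi> x" for s
    using linear_eq_0_on_span[OF g(1) gB, of B s] that sB by simp
  obtain V k e where f: "(V, k, e) \<in> frames E" "x \<in> V" by (rule frame_exists)
  have lin: "lin_on (fibre E x) g" using g(1) by (simp add: lin_on_def linear_add linear_scale)
  obtain w where w: "w \<in> fibre E x" "\<And>u. u \<in> fibre E x \<Longrightarrow> pairing E x w u = g u"
  proof (rule nondegenerate_represents[OF form frameD(2)[OF f] _ lin])
    fix v assume "v \<in> fibre E x" "\<And>w. w \<in> fibre E x \<Longrightarrow> pairing E x v w = 0"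
    then show "v = 0" by (rule nondegenerate)
  qed blast
  have "w \<in> sp x" using w gs sE_fibre[of x] by (auto simp: perp_def)
  then have "pairing E x v w = 0" by (rule orth)
  then have "g v = 0" using w v symmetric_formD(2)[OF form v w(1)] by simp
  then show False using g(2)[of v] by simp
qed

text \<open>The basis is the one chosen in the definition of the trace.\<close>

lemma lie_basis:
  obtains B :: "'s set" where "independent B" "span B = UNIV" "finite B"
    "\<And>T. trace_on UNIV T = (\<Sum>b\<in>B. representation B (T b) b)"
proof -
  have "\<exists>S::'s set. finite S \<and> span S = UNIV"
    using equivariant by (simp add: lie_equivariant_CA_def lie_algebra_def)
  then obtain S :: "'s set" where S: "finite S" "span S = UNIV" by blast
  define B where "B = (SOME B::'s set. independent B \<and> span B = UNIV)"
  have "\<exists>B::'s set. independent B \<and> span B = UNIV"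
    by (metis maximal_independent_subset span_eq span_UNIV subset_UNIV top.extremum_unique)
  then have B: "independent B \<and> span B = UNIV" unfolding B_def by (rule someI_ex)
  then have "independent B" "span B = UNIV" "finite B"
    using independent_span_bound[OF S(1), of B] S by auto
  moreover have "trace_on UNIV T = (\<Sum>b\<in>B. representation B (T b) b)" for T
    by (simp add: trace_on_def B_def Let_def)
  ultimately show ?thesis by (rule that)
qed

lemma divergenceD:
  assumes "divergence E dv"
  shows "a \<in> \<Gamma> E \<Longrightarrow> dv a \<in> Cinf (atlas E)"
    and "a \<in> \<Gamma> E \<Longrightarrow> b \<in> \<Gamma> E \<Longrightarrow> dv (\<lambda>x. a x + b x) = (\<lambda>x. dv a x + dv b x)"
    and "a \<in> \<Gamma> E \<Longrightarrow> dv (\<lambda>x. c *\<^sub>R a x) = (\<lambda>x. c * dv a x)"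
    and "f \<in> Cinf (atlas E) \<Longrightarrow> a \<in> \<Gamma> E \<Longrightarrow>
      dv (\<lambda>x. f x *\<^sub>R a x) = (\<lambda>x. f x * dv a x + act E a f x)"
proof -
  note d = assms[unfolded divergence_def]
  show "dv a \<in> Cinf (atlas E)" if "a \<in> \<Gamma> E"
    using d that by (elim conjE bspec)
  have "\<forall>a\<in>\<Gamma> E. \<forall>b\<in>\<Gamma> E. dv (\<lambda>x. a x + b x) = (\<lambda>x. dv a x + dv b x)"
    using d by (elim conjE)
  from this[rule_format] show "dv (\<lambda>x. a x + b x) = (\<lambda>x. dv a x + dv b x)" if "a \<in> \<Gamma> E" "b \<in> \<Gamma> E"
    using that .
  have "\<forall>c. \<forall>a\<in>\<Gamma> E. dv (\<lambda>x. c *\<^sub>R a x) = (\<lambda>x. c * dv a x)"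
    using d by (elim conjE)
  from this[rule_format] show "dv (\<lambda>x. c *\<^sub>R a x) = (\<lambda>x. c * dv a x)" if "a \<in> \<Gamma> E"
    using that .
  have "\<forall>f\<in>Cinf (atlas E). \<forall>a\<in>\<Gamma> E. dv (\<lambda>x. f x *\<^sub>R a x) = (\<lambda>x. f x * dv a x + act E a f x)"
    using d by (elim conjE)
  from this[rule_format] show "dv (\<lambda>x. f x *\<^sub>R a x) = (\<lambda>x. f x * dv a x + act E a f x)"
    if "f \<in> Cinf (atlas E)" "a \<in> \<Gamma> E"
    using that .
qed

lemma div_sum:
  assumes dv: "divergence E dv" and "finite B"
    and "\<And>b. b \<in> B \<Longrightarrow> f b \<in> Cinf (atlas E)" "\<And>b. b \<in> B \<Longrightarrow> s b \<in> \<Gamma> E"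
  shows "dv (\<lambda>x. \<Sum>b\<in>B. f b x *\<^sub>R s b x) = (\<lambda>x. \<Sum>b\<in>B. f b x * dv (s b) x + act E (s b) (f b) x)"
  using assms(2-)
proof (induction B rule: finite_induct)
  case empty
  have "(\<lambda>x. 0) \<in> \<Gamma> E" using Sec_zero[OF subspace_fibre] by simp
  from divergenceD(3)[OF dv this, of 0] show ?case by simp
next
  case (insert b B)
  have "(\<lambda>x. f b x *\<^sub>R s b x) \<in> \<Gamma> E" "(\<lambda>x. \<Sum>b\<in>B. f b x *\<^sub>R s b x) \<in> \<Gamma> E"
    using insert.prems by (auto intro!: Sec_scale Sec_sum subspace_fibre)
  from divergenceD(2)[OF dv this] divergenceD(4)[OF dv, of "f b" "s b"] insert
  show ?case by simp
qed

lemma bracket_sum_right: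
  assumes "finite B" "r \<in> \<Gamma> E"
    and "\<And>b. b \<in> B \<Longrightarrow> f b \<in> Cinf (atlas E)" "\<And>b. b \<in> B \<Longrightarrow> s b \<in> \<Gamma> E"
  shows "bracket E r (\<lambda>x. \<Sum>b\<in>B. f b x *\<^sub>R s b x) =
    (\<lambda>x. \<Sum>b\<in>B. f b x *\<^sub>R bracket E r (s b) x + act E r (f b) x *\<^sub>R s b x)"
  using assms(1,3,4)
proof (induction B rule: finite_induct)
  case empty then show ?case using bracket_zero_right[OF assms(2)] by simp
next
  case (insert b B)
  have "(\<lambda>x. f b x *\<^sub>R s b x) \<in> \<Gamma> E" "(\<lambda>x. \<Sum>b\<in>B. f b x *\<^sub>R s b x) \<in> \<Gamma> E"
    using insert.prems by (auto intro!: Sec_scale Sec_sum subspace_fibre)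
  from bracket_add_right[OF this assms(2)] bracket_leibniz[OF assms(2), of "s b" "f b"] insert
  show ?case by simp
qed

text \<open>In a basis \<open>B\<close> of the Lie algebra, \<open>w = \<Sum>\<^sub>b f\<^sub>b \<xi>(b)\<close> with smooth \<open>f\<^sub>b\<close>. Invariance of \<open>w\<close> under \<open>\<xi>(c)\<close>, read off in the
component of \<open>c\<close>, is \<open>\<xi>(c) \<cdot> f\<^sub>c = - \<Sum>\<^sub>b f\<^sub>b [c, b]\<^sub>c\<close>. Summation over \<open>c\<close> and antisymmetry of the Lie bracket turn the
right-hand side into \<open>\<Sum>\<^sub>b f\<^sub>b Tr ad\<^sub>b\<close>, which cancels \<open>\<Sum>\<^sub>b f\<^sub>b div \<xi>(b)\<close>.\<close>

lemma div_invariant_sE: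
  assumes dv: "equivariant_divergence E lb \<xi> dv" and w: "w \<in> inv_sections (sE \<xi>)"
  shows "dv w = (\<lambda>x. 0)"
proof -
  obtain B :: "'s set" where B: "independent B" "span B = UNIV" "finite B"
    "\<And>T. trace_on UNIV T = (\<Sum>b\<in>B. representation B (T b) b)"
    by (rule lie_basis) blast
  have W: "w \<in> Sec E (sE \<xi>)" "\<And>u. bracket E (\<xi> u) w = (\<lambda>x. 0)"
    using w by (auto simp: inv_sections_iff)
  have "\<exists>u. w x = \<xi> u x" for x using SecD(2)[OF W(1), of x] by (auto simp: sE_def)
  then obtain g where g: "\<And>x. w x = \<xi> (g x) x" by metis
  define f where "f b x = representation B (g x) b" for b x
  have \<xi>_sum: "\<xi> (\<Sum>b\<in>B. z b *\<^sub>R b) x = (\<Sum>b\<in>B. z b *\<^sub>R \<xi> b x)" for z x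
    by (simp add: linear_sum[OF \<xi>_linear] linear_scale[OF \<xi>_linear])
  have wf: "w = (\<lambda>x. \<Sum>b\<in>B. f b x *\<^sub>R \<xi> b x)"
  proof
    fix x
    have "(\<Sum>b\<in>B. f b x *\<^sub>R b) = g x"
      unfolding f_def using sum_representation_eq[OF B(1), of "g x" B] B by simp
    then show "w x = (\<Sum>b\<in>B. f b x *\<^sub>R \<xi> b x)" using g \<xi>_sum[of "\<lambda>b. f b x" x] by simp
  qed
  have f: "f b \<in> Cinf (atlas E)" if b: "b \<in> B" for b
    unfolding Cinf_iff
  proof
    fix x
    show "smooth_germ (atlas E) x (f b)"
    proof (rule smooth_coefficients[OF B(3), of x \<xi> w f])
      show "section_germ E x (\<xi> b)" for b using \<xi>_section[of b] by (simp add: Sec_iff)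
      show "section_germ E x w" using W(1) by (simp add: Sec_iff)
      show "eventually (\<lambda>y. w y = (\<Sum>j\<in>B. f j y *\<^sub>R \<xi> j y)) (nhds x)" by (simp add: wf)
      show "z j = 0" if z: "(\<Sum>j\<in>B. z j *\<^sub>R \<xi> j x) = 0" and j: "j \<in> B" for z j
      proof -
        have "(\<Sum>b\<in>B. z b *\<^sub>R b) = 0" using z \<xi>_eq_zero by (simp flip: \<xi>_sum)
        then show ?thesis using independentD[OF B(1,3), of z j] j by simp
      qed
    qed (rule b)
  qed
  have inv: "(\<Sum>b\<in>B. f b x * representation B (lb c b) c) = - act E (\<xi> c) (f c) x" if c: "c \<in> B" for c x
  proof -
    have "0 = (\<Sum>b\<in>B. f b x *\<^sub>R \<xi> (lb c b) x + act E (\<xi> c) (f b) x *\<^sub>R \<xi> b x)"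
      using W(2)[of c] bracket_sum_right[OF B(3) \<xi>_section[of c], of f \<xi>] f \<xi>_section
      by (simp add: wf[symmetric] \<xi>_bracket fun_eq_iff)
    also have "\<dots> = \<xi> (\<Sum>b\<in>B. f b x *\<^sub>R lb c b + act E (\<xi> c) (f b) x *\<^sub>R b) x"
      by (simp add: linear_sum[OF \<xi>_linear] linear_add[OF \<xi>_linear] linear_scale[OF \<xi>_linear])
    finally have "(\<Sum>b\<in>B. f b x *\<^sub>R lb c b + act E (\<xi> c) (f b) x *\<^sub>R b) = 0" by (metis \<xi>_eq_zero)
    then have "0 = representation B (\<Sum>b\<in>B. f b x *\<^sub>R lb c b + act E (\<xi> c) (f b) x *\<^sub>R b) c"
      by (simp add: representation_zero)
    also have "\<dots> = (\<Sum>b\<in>B. f b x * representation B (lb c b) c + act E (\<xi> c) (f b) x * representation B b c)"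
      by (simp add: representation_sum[OF B(1)] representation_add[OF B(1)] representation_scale[OF B(1)] B(2))
    also have "\<dots> = (\<Sum>b\<in>B. f b x * representation B (lb c b) c) +
        (\<Sum>b\<in>B. if b = c then act E (\<xi> c) (f b) x else 0)"
      unfolding sum.distrib by (intro arg_cong2[of _ _ _ _ "(+)"] sum.cong refl) (simp add: representation_basis[OF B(1)])
    also have "\<dots> = (\<Sum>b\<in>B. f b x * representation B (lb c b) c) + act E (\<xi> c) (f c) x"
      using c B(3) by simp
    finally show ?thesis by simp
  qed
  have anti: "representation B (lb b c) d = - representation B (lb c b) d" for b c d
  proof -
    have lb: "bilinear lb" "\<And>u. lb u u = 0"
      using equivariant by (auto simp: lie_equivariant_CA_def lie_algebra_def)
    have "lb (b + c) (b + c) = lb b b + lb b c + (lb c b + lb c c)"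
      by (simp add: bilinear_ladd[OF lb(1)] bilinear_radd[OF lb(1)])
    then have "lb b c = - lb c b" using lb(2) by (simp add: eq_neg_iff_add_eq_0)
    then show ?thesis by (simp add: representation_neg[OF B(1)] B(2))
  qed
  have D: "divergence E dv" and tr: "\<And>u. dv (\<xi> u) = (\<lambda>x. - trace_on UNIV (lb u))"
    using dv by (auto simp: equivariant_divergence_def)
  show ?thesis
  proof
    fix x
    have "dv w x = (\<Sum>b\<in>B. f b x * dv (\<xi> b) x + act E (\<xi> b) (f b) x)"
      using div_sum[OF D B(3), of f \<xi>] f \<xi>_section by (simp add: wf[symmetric])
    also have "\<dots> = (\<Sum>b\<in>B. \<Sum>c\<in>B. - (f b x * representation B (lb b c) c)) -
        (\<Sum>c\<in>B. \<Sum>b\<in>B. f b x * representation B (lb c b) c)"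
      using inv by (simp add: sum.distrib sum_subtractf tr B(4) sum_distrib_left sum_negf)
    also have "(\<Sum>c\<in>B. \<Sum>b\<in>B. f b x * representation B (lb c b) c) =
        (\<Sum>b\<in>B. \<Sum>c\<in>B. f b x * representation B (lb c b) c)"
      by (rule sum.swap)
    also have "\<dots> = (\<Sum>b\<in>B. \<Sum>c\<in>B. - (f b x * representation B (lb b c) c))"
      by (intro sum.cong refl) (subst anti, simp)
    finally show "dv w x = 0" by simp
  qed
qed

end

section \<open>Invariance of the generalized Ricci tensor under reduction\<close>

locale courant_reduction =
  equivariant_courant E lb \<xi> + pseudometric E V
  for E :: "('m::{t2_space, second_countable_topology}, 'a::euclidean_space, 'v::real_vector) courant"
    and lb :: "'s::real_vector \<Rightarrow> 's \<Rightarrow> 's" and \<xi> :: "'s \<Rightarrow> 'm \<Rightarrow> 'v"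
    and V :: "'m \<Rightarrow> 'v set" +
  fixes G :: "'g monoid" and \<phi> :: "'g \<Rightarrow> 'm \<Rightarrow> 'm" and \<Phi> :: "'g \<Rightarrow> 'm \<Rightarrow> 'v \<Rightarrow> 'v"
    and R :: "('n::{t2_space, second_countable_topology}, 'c::euclidean_space, 'w::real_vector) courant"
    and \<pi> :: "'m \<Rightarrow> 'n" and q :: "'m \<Rightarrow> 'v \<Rightarrow> 'w"
  assumes reduced: "reduced_CA G E \<xi> \<phi> \<Phi> R \<pi> q"
    and admissible: "admissible E \<xi> V"
begin

sublocale R: smooth_bundle R
  using reduced by unfold_locales (simp_all add: reduced_CA_def Let_def)

lemma V_invariant: "s \<in> Sec E V \<Longrightarrow> bracket E (\<xi> u) s \<in> Sec E V"
  and V_sp: "V x \<subseteq> sp x"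
  using admissible by (simp_all add: admissible_def)

lemma reduced_axioms:
  shows \<pi>_surj: "surj \<pi>"
    and reduced_functions: "bij_betw (\<lambda>h. h \<circ> \<pi>) (Cinf (atlas R)) (invariant_functions E \<xi>)"
    and q_fibre: "\<forall>x. lin_on (sp x) (q x) \<and> q x ` sp x = fibre R (\<pi> x) \<and> {v \<in> sp x. q x v = 0} = sE \<xi> x"
    and sections_descend: "\<forall>a\<in>inv_sections sp. \<exists>t\<in>\<Gamma> R. descends_to \<pi> q a t"
    and sections_lift: "\<forall>t\<in>\<Gamma> R. \<exists>a\<in>inv_sections sp. descends_to \<pi> q a t"
    and pairing_all: "\<forall>x. \<forall>v\<in>sp x. \<forall>w\<in>sp x. pairing R (\<pi> x) (q x v) (q x w) = pairing E x v w"
    and anchor_all: "\<forall>x. \<forall>v\<in>sp x. \<forall>h\<in>Cinf (atlas R). anchor R (\<pi> x) (q x v) h = anchor E x v (h \<circ> \<pi>)"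
    and bracket_all: "\<forall>a\<in>inv_sections sp. \<forall>b\<in>inv_sections sp. \<forall>s t.
        descends_to \<pi> q a s \<longrightarrow> descends_to \<pi> q b t \<longrightarrow> descends_to \<pi> q (bracket E a b) (bracket R s t)"
proof -
  note r = reduced[unfolded reduced_CA_def Let_def]
  show "surj \<pi>" using r by (elim conjE)
  show "bij_betw (\<lambda>h. h \<circ> \<pi>) (Cinf (atlas R)) (invariant_functions E \<xi>)" using r by (elim conjE)
  show "\<forall>x. lin_on (sp x) (q x) \<and> q x ` sp x = fibre R (\<pi> x) \<and> {v \<in> sp x. q x v = 0} = sE \<xi> x"
    using r by (elim conjE)
  show "\<forall>a\<in>inv_sections sp. \<exists>t\<in>\<Gamma> R. descends_to \<pi> q a t" using r by (elim conjE)
  show "\<forall>t\<in>\<Gamma> R. \<exists>a\<in>inv_sections sp. descends_to \<pi> q a t" using r by (elim conjE)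
  show "\<forall>x. \<forall>v\<in>sp x. \<forall>w\<in>sp x. pairing R (\<pi> x) (q x v) (q x w) = pairing E x v w"
    using r by (elim conjE)
  show "\<forall>x. \<forall>v\<in>sp x. \<forall>h\<in>Cinf (atlas R). anchor R (\<pi> x) (q x v) h = anchor E x v (h \<circ> \<pi>)"
    using r by (elim conjE)
  show "\<forall>a\<in>inv_sections sp. \<forall>b\<in>inv_sections sp. \<forall>s t.
        descends_to \<pi> q a s \<longrightarrow> descends_to \<pi> q b t \<longrightarrow> descends_to \<pi> q (bracket E a b) (bracket R s t)"
    using r by (elim conjE)
qed

lemmas pairing_R = pairing_all[rule_format]
lemmas anchor_R = anchor_all[rule_format]
lemmas bracket_R = bracket_all[rule_format]
lemmas q_linear = q_fibre[rule_format, THEN conjunct1]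
lemmas q_image = q_fibre[rule_format, THEN conjunct2, THEN conjunct1]
lemmas q_kernel = q_fibre[rule_format, THEN conjunct2, THEN conjunct2]

lemma q_add: "v \<in> sp x \<Longrightarrow> w \<in> sp x \<Longrightarrow> q x (v + w) = q x v + q x w"
  and q_scale: "v \<in> sp x \<Longrightarrow> q x (c *\<^sub>R v) = c *\<^sub>R q x v"
  using q_linear[of x] by (simp_all add: lin_on_def)

lemma q_diff: "v \<in> sp x \<Longrightarrow> w \<in> sp x \<Longrightarrow> q x (v - w) = q x v - q x w"
  by (metis q_add subspace_diff[OF subspace_sp] diff_add_cancel add_diff_cancel_right')

lemma q_eq_iff:
  assumes "v \<in> sp x" "w \<in> sp x"
  shows "q x v = q x w \<longleftrightarrow> v - w \<in> sE \<xi> x"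
proof -
  have "v - w \<in> sE \<xi> x \<longleftrightarrow> v - w \<in> sp x \<and> q x (v - w) = 0"
    unfolding q_kernel[of x, symmetric] by blast
  then show ?thesis using q_diff[OF assms] subspace_diff[OF subspace_sp assms] by simp
qed

lemma sE_perp_V: "sE \<xi> x \<subseteq> perp E V x"
proof
  fix v assume v: "v \<in> sE \<xi> x"
  have "pairing E x v w = 0" if w: "w \<in> V x" for w
  proof -
    have "pairing E x w v = 0" using V_sp w v unfolding perp_def by blast
    then show ?thesis using symmetric_formD(2)[OF form V_fibre[OF w] subsetD[OF sE_fibre v]] by simp
  qed
  then show "v \<in> perp E V x" using v sE_fibre by (auto simp: perp_def)
qed

text \<open>Since \<open>\<s>\<^sub>E\<close> is orthogonal to \<open>V\<close>, the projection to \<open>V\<close> forgets differences in \<open>\<s>\<^sub>E\<close>.\<close>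

lemma pos_unique: "v \<in> V x \<Longrightarrow> s x - v \<in> sE \<xi> x \<Longrightarrow> pos s x = v"
  using sE_perp_V by (intro pos_eqI) auto

lemma q_inj_V: "inj_on (q x) (V x)"
proof (rule inj_onI)
  fix v w assume v: "v \<in> V x" "w \<in> V x" "q x v = q x w"
  then have "v - w \<in> sE \<xi> x" using q_eq_iff V_sp by blast
  then have "pos (\<lambda>_. v) x = w" "pos (\<lambda>_. v) x = v"
    using v subspace_0[OF subspace_sE] by (auto intro!: pos_unique)
  then show "v = w" by simp
qed

text \<open>The bracket with \<open>\<xi> u\<close> preserves \<open>\<Gamma>(V)\<close>, hence \<open>\<Gamma>(V\<^sup>\<bottom>)\<close> too, and so it commutes with the projections.\<close>

lemma pos_invariant:
  assumes s: "s \<in> \<Gamma> E" and inv: "bracket E (\<xi> u) s = (\<lambda>x. 0)"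
  shows "bracket E (\<xi> u) (pos s) = (\<lambda>x. 0)"
proof
  fix x
  define p where "p = pos s"
  define n where "n = neg s"
  have p: "p \<in> Sec E V" and n: "n \<in> Sec E (perp E V)"
    unfolding p_def n_def using pos_smooth[OF s] neg_smooth[OF s] by auto
  note Gp = SecD(1)[OF p] and Gn = SecD(1)[OF n]
  have "(\<lambda>x. p x + n x) = s" by (simp add: p_def n_def neg_fun[OF s])
  from fun_cong[OF bracket_add_right[OF Gp Gn \<xi>_section[of u], unfolded this inv], of x]
  have sum: "bracket E (\<xi> u) p x + bracket E (\<xi> u) n x = 0" by simp
  have bp: "bracket E (\<xi> u) p x \<in> V x" using V_invariant[OF p] by (rule SecD(2))
  have bn: "bracket E (\<xi> u) n x \<in> fibre E x" using bracket_closed[OF \<xi>_section Gn] by (rule SecD(3))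
  have "bracket E (\<xi> u) p x = 0"
  proof (rule V_nondegenerate[OF bp])
    fix w assume w: "w \<in> V x"
    obtain d where d: "d \<in> Sec E V" "d x = w" by (rule V_section_through[OF w])
    have "pair_sections E n d = (\<lambda>x. 0)"
      using pairing_pos_neg SecD(2)[OF d(1)] SecD(2)[OF n] by (simp add: pair_sections_def)
    from pairing_bracket_move[OF \<xi>_section Gn SecD(1)[OF d(1)] this, of x u]
    have "pairing E x (bracket E (\<xi> u) n x) w = 0"
      using pairing_pos_neg[OF SecD(2)[OF V_invariant[OF d(1)]] SecD(2)[OF n], of x u] d(2) by simp
    then show "pairing E x (bracket E (\<xi> u) p x) w = 0"
      using symmetric_formD(4)[OF form V_fibre[OF bp] bn V_fibre[OF w]] sum
        symmetric_formD(10)[OF form V_fibre[OF w]] by simp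
  qed
  then show "bracket E (\<xi> u) (pos s) x = 0" by (simp add: p_def)
qed

lemma pos_inv_sections: "s \<in> inv_sections sp \<Longrightarrow> pos s \<in> inv_sections V"
  using pos_smooth[of s] pos_invariant[of s] SecD(1)[of s sp] by (simp add: inv_sections_iff)

lemma V_inv_sections: "s \<in> inv_sections V \<Longrightarrow> s \<in> inv_sections sp"
  using inv_sections_mono V_sp by blast

lemma neg_inv_sections:
  assumes "s \<in> inv_sections sp" shows "neg s \<in> inv_sections sp"
proof -
  have "s \<in> \<Gamma> E" using assms SecD(1) by (auto simp: inv_sections_iff)
  then show ?thesis
    using inv_sections_diff[OF assms V_inv_sections[OF pos_inv_sections[OF assms]] subspace_sp]
    by (simp add: neg_fun)
qed

text \<open>The invariant section is produced downstairs: a section of \<open>R\<close> through \<open>q x v\<close> is lifted to an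
invariant section of \<open>\<s>\<^sub>E\<^sup>\<bottom>\<close> and then projected to \<open>V\<close>.\<close>

lemma inv_V_section_through:
  assumes v: "v \<in> V x"
  obtains d where "d \<in> inv_sections V" "d x = v"
proof -
  have vs: "v \<in> sp x" using v V_sp by blast
  then have "q x v \<in> fibre R (\<pi> x)" using q_image by blast
  then obtain t where t: "t \<in> \<Gamma> R" "t (\<pi> x) = q x v" by (rule R.section_through)
  then obtain s where s: "s \<in> inv_sections sp" "descends_to \<pi> q s t" using sections_lift by blast
  have "s x \<in> sp x" using s(1) SecD(2) by (auto simp: inv_sections_iff)
  then have "s x - v \<in> sE \<xi> x" using s(2) t(2) vs q_eq_iff[of "s x" x v] by (simp add: descends_to_def)
  then have "pos s x = v" by (rule pos_unique[OF v])
  then show ?thesis using that pos_inv_sections[OF s(1)] by blast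
qed

abbreviation "V' \<equiv> reduced_pseudometric \<pi> q V"

text \<open>The union over the orbit in the definition of the reduced pseudometric is constant: an invariant
section through a vector of \<open>V\<close> at \<open>y\<close> descends, so it has the same image at all points of the orbit.\<close>

lemma reduced_V: "V' (\<pi> x) = q x ` V x"
proof
  show "q x ` V x \<subseteq> V' (\<pi> x)" by (auto simp: reduced_pseudometric_def)
  show "V' (\<pi> x) \<subseteq> q x ` V x"
  proof
    fix w assume "w \<in> V' (\<pi> x)"
    then obtain y v where y: "\<pi> y = \<pi> x" "v \<in> V y" "w = q y v" by (auto simp: reduced_pseudometric_def)
    obtain d where d: "d \<in> inv_sections V" "d y = v" by (rule inv_V_section_through[OF y(2)])
    obtain t where t: "descends_to \<pi> q d t" using sections_descend V_inv_sections[OF d(1)] by blast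
    have "w = q x (d x)" using t d(2) y by (metis descends_to_def)
    moreover have "d x \<in> V x" using d(1) SecD(2) by (auto simp: inv_sections_iff)
    ultimately show "w \<in> q x ` V x" by blast
  qed
qed

lemma form_R: "symmetric_form (fibre R (\<pi> x)) (pairing R (\<pi> x))"
proof -
  have 1: "pairing R (\<pi> x) (q x u) (q x v + q x w) =
      pairing R (\<pi> x) (q x u) (q x v) + pairing R (\<pi> x) (q x u) (q x w)"
    if "u \<in> sp x" "v \<in> sp x" "w \<in> sp x" for u v w
  proof -
    have "q x v + q x w = q x (v + w)" using q_add that by simp
    then show ?thesis
      using pairing_R that subspace_add[OF subspace_sp that(2,3)]
        symmetric_formD(3)[OF form sp_fibre sp_fibre sp_fibre, OF that] by simp
  qed
  have 2: "pairing R (\<pi> x) (q x u) (c *\<^sub>R q x v) = c * pairing R (\<pi> x) (q x u) (q x v)"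
    if "u \<in> sp x" "v \<in> sp x" for u v c
  proof -
    have "c *\<^sub>R q x v = q x (c *\<^sub>R v)" using q_scale that by simp
    then show ?thesis
      using pairing_R that subspace_scale[OF subspace_sp that(2)]
        symmetric_formD(5)[OF form sp_fibre sp_fibre, OF that] by simp
  qed
  have 3: "pairing R (\<pi> x) (q x u) (q x v) = pairing R (\<pi> x) (q x v) (q x u)"
    if "u \<in> sp x" "v \<in> sp x" for u v
    using pairing_R that symmetric_formD(2)[OF form sp_fibre sp_fibre, OF that] by simp
  have "subspace (q x ` sp x)" by (simp add: q_image R.subspace_fibre)
  then show ?thesis
    unfolding symmetric_form_def q_image[symmetric] lin_on_def by (auto simp: 1 2 intro: 3)
qed

lemma perp_reduced_V: "perp R V' (\<pi> x) = q x ` (perp E V x \<inter> sp x)"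
proof -
  have "q x v \<in> perp R V' (\<pi> x) \<longleftrightarrow> v \<in> perp E V x" if v: "v \<in> sp x" for v
  proof -
    have "q x v \<in> fibre R (\<pi> x)" "v \<in> fibre E x" using v q_image sp_fibre by blast+
    moreover have "pairing R (\<pi> x) (q x v) (q x w) = pairing E x v w" if "w \<in> V x" for w
      by (rule pairing_R[OF v subsetD[OF V_sp that]])
    ultimately show ?thesis unfolding perp_def[of R] perp_def[of E V] by (simp add: reduced_V)
  qed
  moreover have "perp R V' (\<pi> x) \<subseteq> q x ` sp x" unfolding q_image perp_def[of R] by blast
  ultimately show ?thesis by blast
qed

lemma subspace_image_q: "subspace W \<Longrightarrow> W \<subseteq> sp x \<Longrightarrow> subspace (q x ` W)"
proof -
  assume W: "subspace W" "W \<subseteq> sp x"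
  have "q x 0 = 0" using q_scale[OF subspace_0[OF subspace_sp], of x 0] by simp
  then have "0 \<in> q x ` W" using subspace_0[OF W(1)] by (metis imageI)
  moreover have "q x v + q x w \<in> q x ` W" if "v \<in> W" "w \<in> W" for v w
    using q_add[OF subsetD[OF W(2) that(1)] subsetD[OF W(2) that(2)]] subspace_add[OF W(1) that]
    by (metis imageI)
  moreover have "c *\<^sub>R q x v \<in> q x ` W" if "v \<in> W" for v c
    using q_scale[OF subsetD[OF W(2) that], of c] subspace_scale[OF W(1) that, of c]
    by (metis imageI)
  ultimately show ?thesis by (auto simp: subspace_def)
qed

lemma pos_descends:
  assumes s: "s \<in> Sec E sp" and t: "descends_to \<pi> q s t"
  shows "descends_to \<pi> q (pos s) (orth_proj R V' t)"
  unfolding descends_to_def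
proof
  fix x
  have sx: "s x \<in> sp x" "s x \<in> fibre E x" using SecD(2,3)[OF s] by auto
  have px: "pos s x \<in> V x" "s x - pos s x \<in> perp E V x" by (rule pos_in[of s, OF sx(2)])+
  have ps: "pos s x \<in> sp x" using px V_sp by blast
  show "orth_proj R V' t (\<pi> x) = q x (pos s x)"
  proof (rule orth_proj_eqI[OF form_R])
    show "subspace (V' (\<pi> x))" unfolding reduced_V by (rule subspace_image_q[OF subspace_V V_sp])
    show "V' (\<pi> x) \<subseteq> fibre R (\<pi> x)" unfolding reduced_V q_image[symmetric] using V_sp by blast
    show "q x (pos s x) \<in> V' (\<pi> x)" using px by (auto simp: reduced_V)
    show "t (\<pi> x) - q x (pos s x) \<in> perp R V' (\<pi> x)"
      using t px q_diff[OF sx(1) ps] subspace_diff[OF subspace_sp sx(1) ps]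
      by (auto simp: descends_to_def perp_reduced_V intro!: image_eqI[of _ _ "s x - pos s x"])
  next
    fix v' assume v': "v' \<in> V' (\<pi> x)" "\<And>w'. w' \<in> V' (\<pi> x) \<Longrightarrow> pairing R (\<pi> x) v' w' = 0"
    then obtain v where v: "v \<in> V x" "v' = q x v" by (auto simp: reduced_V)
    have "pairing E x v w = 0" if w: "w \<in> V x" for w
    proof -
      have "v \<in> sp x" "w \<in> sp x" using v w V_sp by blast+
      then have "pairing R (\<pi> x) (q x v) (q x w) = pairing E x v w" using pairing_R by blast
      then show ?thesis using v'(2)[of "q x w"] v w by (simp add: reduced_V)
    qed
    then have "v = 0" by (rule V_nondegenerate[OF v(1)])
    moreover have "q x 0 = 0" using q_diff[OF sx(1) sx(1)] by simp
    ultimately show "v' = 0" using v by simp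
  qed
qed

text \<open>Uniqueness of the projection needs the reduced \<open>V\<^sup>\<bottom>\<close> to be non-degenerate. A vector \<open>v\<close> of \<open>V\<^sup>\<bottom> \<inter> \<s>\<^sub>E\<^sup>\<bottom>\<close> that
is orthogonal to \<open>V\<^sup>\<bottom> \<inter> \<s>\<^sub>E\<^sup>\<bottom>\<close> is orthogonal to all of \<open>\<s>\<^sub>E\<^sup>\<bottom>\<close>, hence lies in \<open>\<s>\<^sub>E\<close> and is killed by \<open>q\<close>.\<close>

lemma neg_descends:
  assumes s: "s \<in> Sec E sp" and t: "descends_to \<pi> q s t"
  shows "descends_to \<pi> q (neg s) (orth_proj R (perp R V') t)"
  unfolding descends_to_def
proof
  fix x
  have sx: "s x \<in> sp x" "s x \<in> fibre E x" using SecD(2,3)[OF s] by auto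
  have px: "pos s x \<in> V x" "s x - pos s x \<in> perp E V x" by (rule pos_in[of s, OF sx(2)])+
  have ps: "pos s x \<in> sp x" using px V_sp by blast
  have n: "neg s x = s x - pos s x" by (rule neg_eq[of s, OF sx(2)])
  have ns: "neg s x \<in> sp x" using subspace_diff[OF subspace_sp sx(1) ps] by (simp add: n)
  have W: "subspace (perp E V x \<inter> sp x)" by (intro subspace_inter subspace_neg_part subspace_sp)
  show "orth_proj R (perp R V') t (\<pi> x) = q x (neg s x)"
  proof (rule orth_proj_eqI[OF form_R])
    show "subspace (perp R V' (\<pi> x))" unfolding perp_reduced_V by (rule subspace_image_q[OF W]) simp
    show "perp R V' (\<pi> x) \<subseteq> fibre R (\<pi> x)" by (auto simp: perp_def)
    show "q x (neg s x) \<in> perp R V' (\<pi> x)" using px ns by (auto simp: perp_reduced_V n)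
    have "t (\<pi> x) - q x (neg s x) = q x (pos s x)"
      using t q_diff[OF sx(1) ns] by (simp add: descends_to_def n)
    moreover have "pairing R (\<pi> x) (q x (pos s x)) (q x w) = 0" if "w \<in> perp E V x" "w \<in> sp x" for w
      using pairing_R ps that pairing_pos_neg[OF px(1) that(1)] by simp
    moreover have "q x (pos s x) \<in> fibre R (\<pi> x)" using ps q_image by blast
    ultimately show "t (\<pi> x) - q x (neg s x) \<in> perp R (perp R V') (\<pi> x)"
      unfolding perp_def[of R "perp R V'"] by (auto simp: perp_reduced_V)
  next
    fix v' assume v': "v' \<in> perp R V' (\<pi> x)" "\<And>w'. w' \<in> perp R V' (\<pi> x) \<Longrightarrow> pairing R (\<pi> x) v' w' = 0"
    then obtain v where v: "v \<in> perp E V x" "v \<in> sp x" "v' = q x v" by (auto simp: perp_reduced_V)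
    have "v \<in> sE \<xi> x"
    proof (rule sp_perp_subset_sE[OF sp_fibre[OF v(2)]])
      fix w assume w: "w \<in> sp x"
      have wf: "w \<in> fibre E x" by (rule sp_fibre[OF w])
      define p where "p = pos (\<lambda>_. w) x"
      have p: "p \<in> V x" "w - p \<in> perp E V x" unfolding p_def using pos_in[of "\<lambda>_. w" x] wf by auto
      have wp: "w - p \<in> sp x" using p(1) V_sp w subspace_diff[OF subspace_sp w] by blast
      have "pairing R (\<pi> x) (q x v) (q x (w - p)) = 0"
        using v'(2)[of "q x (w - p)"] p(2) wp v(3) by (simp add: perp_reduced_V)
      then have "pairing E x v (w - p) = 0" using pairing_R v(2) wp by simp
      moreover have "pairing E x v p = 0" using pairing_pos_neg[OF p(1) v(1)] by simp
      ultimately show "pairing E x v w = 0"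
        using symmetric_formD(7)[OF form sp_fibre[OF v(2)] wf V_fibre[OF p(1)]] by simp
    qed
    then show "v' = 0" using q_kernel v(3) by blast
  qed
qed

definition "reduced_ricci_op a' b' c' =
  orth_proj R V' (bracket R (orth_proj R (perp R V') (bracket R c' b')) a')"

lemma ricci_op_descends:
  assumes "a \<in> inv_sections V" "b \<in> inv_sections sp" "c \<in> inv_sections V"
    and "descends_to \<pi> q a a'" "descends_to \<pi> q b b'" "descends_to \<pi> q c c'"
  shows "descends_to \<pi> q (ricci_op a b c) (reduced_ricci_op a' b' c')"
proof -
  note a = V_inv_sections[OF assms(1)] and c = V_inv_sections[OF assms(3)]
  note cb = inv_sections_bracket[OF c assms(2)]
  have 1: "descends_to \<pi> q (bracket E c b) (bracket R c' b')" by (rule bracket_R[OF c assms(2,6,5)])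
  have 2: "descends_to \<pi> q (neg (bracket E c b)) (orth_proj R (perp R V') (bracket R c' b'))"
    using neg_descends[OF _ 1] cb by (simp add: inv_sections_iff)
  note ncb = neg_inv_sections[OF cb]
  have 3: "descends_to \<pi> q (bracket E (neg (bracket E c b)) a)
      (bracket R (orth_proj R (perp R V') (bracket R c' b')) a')"
    by (rule bracket_R[OF ncb a 2 assms(4)])
  show ?thesis
    unfolding ricci_op_def reduced_ricci_op_def
    using pos_descends[OF _ 3] inv_sections_bracket[OF ncb a] by (simp add: inv_sections_iff)
qed

text \<open>A lift to an invariant section of \<open>\<s>\<^sub>E\<^sup>\<bottom>\<close> exists; its projection to \<open>V\<close> descends to the same section, as
the two differ by a section of \<open>\<s>\<^sub>E\<close>.\<close>

lemma V_section_lift: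
  assumes "t \<in> Sec R V'"
  obtains d where "d \<in> inv_sections V" "descends_to \<pi> q d t"
proof -
  have "t \<in> \<Gamma> R" using assms by (auto simp: R.Sec_iff)
  then obtain s where s: "s \<in> inv_sections sp" "descends_to \<pi> q s t" using sections_lift by blast
  have "q x (pos s x) = q x (s x)" for x
  proof -
    have "t (\<pi> x) \<in> V' (\<pi> x)" using assms by (auto simp: R.Sec_iff)
    then obtain v where v: "v \<in> V x" "q x (s x) = q x v"
      using s(2) by (auto simp: reduced_V descends_to_def)
    have "s x \<in> sp x" using s(1) SecD(2) by (auto simp: inv_sections_iff)
    then have "s x - v \<in> sE \<xi> x" using v V_sp q_eq_iff by blast
    then show ?thesis using pos_unique[OF v(1)] v(2) by simp
  qed
  then have "descends_to \<pi> q (pos s) t" using s(2) by (simp add: descends_to_def)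
  then show ?thesis using that pos_inv_sections[OF s(1)] by blast
qed

text \<open>The section of \<open>R\<close> through \<open>q x v\<close> that the trace uses is an arbitrary choice. It lifts to an invariant section
of \<open>V\<close> whose value at \<open>x\<close> is \<open>v\<close> by injectivity of \<open>q\<close> on \<open>V\<close>, and tensoriality upstairs does the rest.\<close>

lemma fibre_map_descends:
  assumes a: "a \<in> inv_sections V" and b: "b \<in> inv_sections (\<lambda>x. perp E V x \<inter> sp x)"
    and "descends_to \<pi> q a a'" "descends_to \<pi> q b b'" and v: "v \<in> V x"
  shows "fibre_map R V' (reduced_ricci_op a' b') (\<pi> x) (q x v) = q x (fibre_map E V (ricci_op a b) x v)"
proof -
  have b': "b \<in> inv_sections sp" "b \<in> Sec E (perp E V)" "a \<in> Sec E V"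
    using a b by (auto simp: inv_sections_iff Sec_iff)
  obtain d where d: "d \<in> inv_sections V" "d x = v" by (rule inv_V_section_through[OF v])
  \<comment> \<open>an admissible section exists, so the choice in the definition of the fibre map is meaningful\<close>
  obtain t where t: "t \<in> \<Gamma> R" "descends_to \<pi> q d t" using sections_descend V_inv_sections[OF d(1)] by blast
  have "t y \<in> V' y" for y
  proof -
    obtain z where "y = \<pi> z" using \<pi>_surj by blast
    then show ?thesis using t(2) d(1) SecD(2) by (auto simp: descends_to_def reduced_V inv_sections_iff)
  qed
  then have ex: "t \<in> Sec R V' \<and> t (\<pi> x) = q x v"
    using t d(2) by (auto simp: R.Sec_iff descends_to_def)
  define c' where "c' = (SOME c'. c' \<in> Sec R V' \<and> c' (\<pi> x) = q x v)"
  have c': "c' \<in> Sec R V'" "c' (\<pi> x) = q x v" 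
    using someI[of "\<lambda>c'. c' \<in> Sec R V' \<and> c' (\<pi> x) = q x v", OF ex] by (simp_all add: c'_def)
  obtain c where c: "c \<in> inv_sections V" "descends_to \<pi> q c c'" by (rule V_section_lift[OF c'(1)])
  have cS: "c \<in> Sec E V" using c(1) by (simp add: inv_sections_iff)
  have "q x (c x) = q x v" using c(2) c'(2) by (simp add: descends_to_def)
  then have "c x = v" using q_inj_V SecD(2)[OF cS] v by (blast dest: inj_onD)
  then have "fibre_map E V (ricci_op a b) x v = ricci_op a b c x"
    using fibre_map_ricci_op[OF b'(3,2) cS, of x] by simp
  moreover have "descends_to \<pi> q (ricci_op a b c) (reduced_ricci_op a' b' c')"
    by (rule ricci_op_descends) (use assms b' c in auto)
  ultimately show ?thesis by (simp add: fibre_map_def c'_def[symmetric] descends_to_def)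
qed

lemma section_trace_descends:
  assumes a: "a \<in> inv_sections V" and b: "b \<in> inv_sections (\<lambda>x. perp E V x \<inter> sp x)"
    and "descends_to \<pi> q a a'" "descends_to \<pi> q b b'"
  shows "section_trace R V' (reduced_ricci_op a' b') (\<pi> x) = section_trace E V (ricci_op a b) x"
proof -
  have ab: "a \<in> Sec E V" "b \<in> Sec E (perp E V)" using a b by (auto simp: inv_sections_iff Sec_iff)
  obtain U k e where "x \<in> U" "\<And>y. y \<in> U \<Longrightarrow> basis_family k (\<lambda>i. e i y) (V y)"
    by (rule V_frame[of x]) blast
  then have e: "basis_family k (\<lambda>i. e i x) (V x)" by blast
  have "lin_on (V x) (q x)" using q_linear[of x] V_sp[of x] by (auto simp: lin_on_def subset_eq)
  then show ?thesis
    unfolding section_trace_def reduced_V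
    using fibre_map_descends[OF assms] fibre_map_ricci_op_in[OF ab]
    by (intro trace_on_conjugate[OF e _ q_inj_V fibre_map_ricci_op_linear[OF ab]]) auto
qed

text \<open>The divergence of an invariant section is an invariant function and so comes from the base; it does
not depend on the lift because invariant sections of \<open>\<s>\<^sub>E\<close> are divergence free.\<close>

lemma reduced_divergence_eq:
  assumes dv: "equivariant_divergence E lb \<xi> dv"
    and s: "s \<in> inv_sections sp" and t: "descends_to \<pi> q s t"
  shows "reduced_divergence E \<xi> \<pi> q dv t \<in> Cinf (atlas R)"
    and "reduced_divergence E \<xi> \<pi> q dv t \<circ> \<pi> = dv s"
proof -
  have D: "divergence E dv" and eqv: "\<And>u a. a \<in> \<Gamma> E \<Longrightarrow> act E (\<xi> u) (dv a) = dv (bracket E (\<xi> u) a)"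
    using dv by (auto simp: equivariant_divergence_def)
  have S: "s \<in> Sec E sp" "\<And>u. bracket E (\<xi> u) s = (\<lambda>x. 0)" using s by (auto simp: inv_sections_iff)
  note Gs = SecD(1)[OF S(1)]
  have "dv (\<lambda>x. 0) = (\<lambda>x. 0)" using divergenceD(3)[OF D Gs, of 0] by simp
  then have "dv s \<in> invariant_functions E \<xi>"
    using divergenceD(1)[OF D Gs] eqv[OF Gs] S(2) by (simp add: invariant_functions_def)
  then have "dv s \<in> (\<lambda>h. h \<circ> \<pi>) ` Cinf (atlas R)" using reduced_functions by (simp add: bij_betw_def)
  then obtain h where h: "h \<in> Cinf (atlas R)" "dv s = h \<circ> \<pi>" by blast
  have indep: "dv a = dv s" if a: "a \<in> inv_sections sp" "descends_to \<pi> q a t" for a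
  proof -
    have aS: "a \<in> Sec E sp" using a by (simp add: inv_sections_iff)
    note Ga = SecD(1)[OF aS]
    have d: "(\<lambda>x. a x - s x) \<in> inv_sections sp" by (rule inv_sections_diff[OF a(1) s subspace_sp])
    have "a x - s x \<in> sE \<xi> x" for x
      using a(2) t q_eq_iff[OF SecD(2)[OF aS] SecD(2)[OF S(1)], of x] by (simp add: descends_to_def)
    then have d': "(\<lambda>x. a x - s x) \<in> inv_sections (sE \<xi>)" using d by (auto simp: inv_sections_iff Sec_iff)
    have "dv (\<lambda>x. (a x - s x) + s x) = (\<lambda>x. dv (\<lambda>x. a x - s x) x + dv s x)"
      by (rule divergenceD(2)[OF D Sec_diff[OF subspace_fibre Ga Gs] Gs])
    then show ?thesis using div_invariant_sE[OF dv d'] by simp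
  qed
  have "reduced_divergence E \<xi> \<pi> q dv t = h"
    unfolding reduced_divergence_def
  proof (rule the_equality)
    show "\<forall>a\<in>inv_sections sp. descends_to \<pi> q a t \<longrightarrow> h \<circ> \<pi> = dv a" using indep h(2) by simp
    fix h' assume "\<forall>a\<in>inv_sections sp. descends_to \<pi> q a t \<longrightarrow> h' \<circ> \<pi> = dv a"
    then have "h' \<circ> \<pi> = h \<circ> \<pi>" using s t h(2) by simp
    then show "h' = h" using \<pi>_surj by (simp add: surj_fun_eq)
  qed
  then show "reduced_divergence E \<xi> \<pi> q dv t \<in> Cinf (atlas R)"
    and "reduced_divergence E \<xi> \<pi> q dv t \<circ> \<pi> = dv s" using h by simp_all
qed

lemma GRic_reduction:
  assumes dv: "equivariant_divergence E lb \<xi> dv"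
    and a: "a \<in> inv_sections V" and b: "b \<in> inv_sections (\<lambda>x. perp E V x \<inter> sp x)"
    and desc: "descends_to \<pi> q a a'" "descends_to \<pi> q b b'"
  shows "GRic E V dv a b = GRic R V' (reduced_divergence E \<xi> \<pi> q dv) a' b' \<circ> \<pi>"
proof
  fix x
  let ?dv' = "reduced_divergence E \<xi> \<pi> q dv"
  note as = V_inv_sections[OF a]
  have bs: "b \<in> inv_sections sp" by (rule inv_sections_mono[OF b]) simp
  have ba: "bracket E b a \<in> inv_sections sp" by (rule inv_sections_bracket[OF bs as])
  have "descends_to \<pi> q (bracket E b a) (bracket R b' a')" by (rule bracket_R[OF bs as desc(2,1)])
  then have "descends_to \<pi> q (pos (bracket E b a)) (orth_proj R V' (bracket R b' a'))"
    using ba by (intro pos_descends) (simp_all add: inv_sections_iff)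
  from fun_cong[OF reduced_divergence_eq(2)[OF dv V_inv_sections[OF pos_inv_sections[OF ba]] this], of x]
  have 1: "?dv' (orth_proj R V' (bracket R b' a')) (\<pi> x) = dv (pos (bracket E b a)) x" by simp
  have "b x \<in> sp x" using bs SecD(2) by (auto simp: inv_sections_iff)
  then have "anchor R (\<pi> x) (q x (b x)) (?dv' a') = anchor E x (b x) (?dv' a' \<circ> \<pi>)"
    by (rule anchor_R[OF _ reduced_divergence_eq(1)[OF dv as desc(1)]])
  then have 2: "act R b' (?dv' a') (\<pi> x) = act E b (dv a) x"
    using desc(2) reduced_divergence_eq(2)[OF dv as desc(1)] by (simp add: act_def descends_to_def)
  show "GRic E V dv a b x = (GRic R V' ?dv' a' b' \<circ> \<pi>) x"
    using 1 2 section_trace_descends[OF a b desc, of x]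
    by (simp add: GRic_ricci_op) (simp add: GRic_def reduced_ricci_op_def[abs_def])
qed

end

theorem theorem5p14:
  fixes G :: "'g::{t2_space, second_countable_topology} monoid"
    and A :: "('g, 'b::euclidean_space) atlas"
    and lb :: "'s::real_vector \<Rightarrow> 's \<Rightarrow> 's"
    and L :: "'s \<Rightarrow> ('g \<Rightarrow> real) \<Rightarrow> 'g \<Rightarrow> real"
    and E :: "('m::{t2_space, second_countable_topology}, 'a::euclidean_space, 'v::real_vector) courant"
    and \<xi> :: "'s \<Rightarrow> 'm \<Rightarrow> 'v"
    and \<phi> :: "'g \<Rightarrow> 'm \<Rightarrow> 'm"
    and \<Phi> :: "'g \<Rightarrow> 'm \<Rightarrow> 'v \<Rightarrow> 'v"
    and R :: "('n::{t2_space, second_countable_topology}, 'c::euclidean_space, 'w::real_vector) courant"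
    and \<pi> :: "'m \<Rightarrow> 'n"
    and q :: "'m \<Rightarrow> 'v \<Rightarrow> 'w"
    and Vp :: "'m \<Rightarrow> 'v set"
    and dv :: "('m \<Rightarrow> 'v) \<Rightarrow> 'm \<Rightarrow> real"
    and a b :: "'m \<Rightarrow> 'v"
    and a' b' :: "'n \<Rightarrow> 'w"
  assumes "group_equivariant_CA G A lb L E \<xi> \<phi> \<Phi>"
    and "free_action G \<phi>" and "proper_action \<phi>"
    and "reduced_CA G E \<xi> \<phi> \<Phi> R \<pi> q"
    and "admissible E \<xi> Vp"
    and "equivariant_divergence E lb \<xi> dv"
    and "a \<in> invariant_sections E \<xi> Vp"
    and "b \<in> invariant_sections E \<xi> (\<lambda>x. perp E Vp x \<inter> perp E (sE \<xi>) x)"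
    and "descends_to \<pi> q a a'" and "descends_to \<pi> q b b'"
  shows "GRic E Vp dv a b =
    GRic R (reduced_pseudometric \<pi> q Vp) (reduced_divergence E \<xi> \<pi> q dv) a' b' \<circ> \<pi>"
proof -
  have eq: "lie_equivariant_CA E lb \<xi>" using assms(1) by (simp add: group_equivariant_CA_def)
  then have "courant_algebroid E" by (simp add: lie_equivariant_CA_def)
  moreover have "generalized_pseudometric E Vp" using assms(5) by (simp add: admissible_def)
  ultimately interpret courant_reduction E lb \<xi> Vp G \<phi> \<Phi> R \<pi> q
    using eq assms(4,5) by unfold_locales
  show ?thesis by (rule GRic_reduction[OF assms(6-10)])
qed

end
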